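(* Let $R$ be a ring and let $M$ be a left $R$-module which is projective in $\sigma[M]$ and semiprime. Suppose that $M$ is a Goldie module and that $P_1,\dots,P_n$ are the minimal prime in $M$ submodules. Then: (1) $\mathrm{Hom}_R\big(E^{[M]}(M/P_i),E^{[M]}(M/P_j)\big)=0$ if $i\neq j$. (2) If $M$ is also a generator in $\sigma[M]$, then $E^{[M]}(M/P_i)=\widehat{M/P_i}$ for every $1\le i\le n$ (that is, the $M$-injective hull of $M/P_i$ coincides with its $M/P_i$-injective hull).
   Context: Rings are associative with unit and modules are left unital modules. $\sigma[M]$ is the full subcategory of $R$-Mod of $M$-subgenerated modules (submodules of quotients of direct sums of copies of $M$). "Projective in $\sigma[M]$" means that $\mathrm{Hom}_R(M,-)$ is exact on short exact sequences in $\sigma[M]$; "generator in $\sigma[M]$" means every module in $\sigma[M]$ is a quotient of a direct sum of copies of $M$. For $K\in\sigma[X]$, $E^{[X]}(K)$ denotes the $X$-injective hull of $K$ (its injective hull in the category $\sigma[X]$), and $\widehat{X}=E^{[X]}(X)$; in particular $\widehat{M/P_i}=E^{[M/P_i]}(M/P_i)$. A submodule $N\le M$ is fully invariant, $N\leq_{FI}M$, if $f(N)\le N$ for all $f\in \mathrm{End}_R(M)$. For $N,K\le M$, the product is $N_MK=\sum\{f(N)\mid f\in \mathrm{Hom}_R(M,K)\}$. A proper submodule $P\leq_{FI}M$ is prime in $M$ if whenever $N,K\leq_{FI}M$ and $N_MK\le P$, then $N\le P$ or $K\le P$; the minimal prime in $M$ submodules are the minimal elements (under inclusion) of the set of prime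 in $M$ submodules. $M$ is semiprime if whenever $K\leq_{FI}M$ and $K_MK=0$, then $K=0$. A left annihilator in $M$ is a submodule of the form $\bigcap_{f\in X}\mathrm{Ker}(f)$ for some $X\subseteq \mathrm{End}_R(M)$. $M$ is a Goldie module if it satisfies ACC on left annihilators and has finite uniform dimension. *)

theory Defs
  imports "HOL-Algebra.Module" "HOL-Algebra.AbelCoset" "HOL-Library.Equipollence"
begin

section \<open>Left modules over an arbitrary ring\<close>

text \<open>
  The locale \<open>module\<close> of HOL-Algebra demands a commutative ring of scalars, so left modules are
  introduced anew on top of its record type. The ring fields \<open>mult\<close> and \<open>one\<close> of that record
  carry no meaning for a module. The predicate \<open>submodule\<close> of HOL-Algebra does not depend
  on commutativity and is used as it is; a submodule \<open>K\<close> of \<open>M\<close>, seen as a module of its own, is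
  \<open>M\<lparr>carrier := K\<rparr>\<close>.
\<close>

locale left_module = R?: ring R + M?: abelian_group M
  for R :: "('r, 'x) ring_scheme" (structure) and M :: "('r, 'm) module" (structure) +
  assumes smult_closed [simp, intro]:
      "\<lbrakk>a \<in> carrier R; x \<in> carrier M\<rbrakk> \<Longrightarrow> a \<odot>\<^bsub>M\<^esub> x \<in> carrier M"
    and smult_l_distr:
      "\<lbrakk>a \<in> carrier R; b \<in> carrier R; x \<in> carrier M\<rbrakk>
        \<Longrightarrow> (a \<oplus>\<^bsub>R\<^esub> b) \<odot>\<^bsub>M\<^esub> x = a \<odot>\<^bsub>M\<^esub> x \<oplus>\<^bsub>M\<^esub> b \<odot>\<^bsub>M\<^esub> x"
    and smult_r_distr:
      "\<lbrakk>a \<in> carrier R; x \<in> carrier M; y \<in> carrier M\<rbrakk>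
        \<Longrightarrow> a \<odot>\<^bsub>M\<^esub> (x \<oplus>\<^bsub>M\<^esub> y) = a \<odot>\<^bsub>M\<^esub> x \<oplus>\<^bsub>M\<^esub> a \<odot>\<^bsub>M\<^esub> y"
    and smult_assoc1:
      "\<lbrakk>a \<in> carrier R; b \<in> carrier R; x \<in> carrier M\<rbrakk>
        \<Longrightarrow> (a \<otimes>\<^bsub>R\<^esub> b) \<odot>\<^bsub>M\<^esub> x = a \<odot>\<^bsub>M\<^esub> (b \<odot>\<^bsub>M\<^esub> x)"
    and smult_one [simp]:
      "x \<in> carrier M \<Longrightarrow> \<one>\<^bsub>R\<^esub> \<odot>\<^bsub>M\<^esub> x = x"

text \<open>
  Homomorphisms are extensional (undefined outside the carrier), so that equality of
  homomorphisms is equality in the logic; they are composed with \<^const>\<open>compose\<close>.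
\<close>

definition lmod_hom ::
    "('r, 'x) ring_scheme \<Rightarrow> ('r, 'm) module \<Rightarrow> ('r, 'n) module \<Rightarrow> ('m \<Rightarrow> 'n) set"
  where "lmod_hom R M N =
    {f \<in> carrier M \<rightarrow>\<^sub>E carrier N.
       (\<forall>x\<in>carrier M. \<forall>y\<in>carrier M. f (x \<oplus>\<^bsub>M\<^esub> y) = f x \<oplus>\<^bsub>N\<^esub> f y) \<and>
       (\<forall>r\<in>carrier R. \<forall>x\<in>carrier M. f (r \<odot>\<^bsub>M\<^esub> x) = r \<odot>\<^bsub>N\<^esub> f x)}"

definition zero_hom :: "('r, 'm) module \<Rightarrow> ('r, 'n) module \<Rightarrow> 'm \<Rightarrow> 'n"
  where "zero_hom M N = (\<lambda>x\<in>carrier M. \<zero>\<^bsub>N\<^esub>)"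

definition quotient_module :: "('r, 'm) module \<Rightarrow> 'm set \<Rightarrow> ('r, 'm set) module"
  where "quotient_module M N =
    \<lparr>carrier = a_rcosets\<^bsub>M\<^esub> N,
     mult = undefined, one = undefined,
     zero = N, add = set_add M,
     smult = (\<lambda>r X. \<Union>x\<in>X. N +>\<^bsub>M\<^esub> (r \<odot>\<^bsub>M\<^esub> x))\<rparr>"

text \<open>The direct sum of copies of \<open>M\<close> indexed by \<open>I\<close>.\<close>

definition copower_module :: "'i set \<Rightarrow> ('r, 'm) module \<Rightarrow> ('r, 'i \<Rightarrow> 'm) module"
  where "copower_module I M =
    \<lparr>carrier = {v \<in> I \<rightarrow>\<^sub>E carrier M. finite {i \<in> I. v i \<noteq> \<zero>\<^bsub>M\<^esub>}},
     mult = undefined, one = undefined,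
     zero = (\<lambda>i\<in>I. \<zero>\<^bsub>M\<^esub>), add = (\<lambda>v w. \<lambda>i\<in>I. v i \<oplus>\<^bsub>M\<^esub> w i),
     smult = (\<lambda>r v. \<lambda>i\<in>I. r \<odot>\<^bsub>M\<^esub> v i)\<rparr>"

section \<open>The category of subgenerated modules\<close>

text \<open>
  \<open>N\<close> is \<open>M\<close>-subgenerated if it embeds into a quotient of a direct sum of copies of \<open>M\<close>.
  Index sets of type \<open>('n \<times> nat) set\<close> lose no generality: each of the elements of \<open>N\<close> involves
  finitely many summands only, so \<open>card N * \<aleph>\<^sub>0\<close> summands always suffice.
\<close>

definition in_sigma :: "('r, 'x) ring_scheme \<Rightarrow> ('r, 'm) module \<Rightarrow> ('r, 'n) module \<Rightarrow> bool"
  where "in_sigma R M N \<longleftrightarrow>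
    left_module R N \<and>
    (\<exists>(I :: ('n \<times> nat) set) K.
       submodule K R (copower_module I M) \<and>
       (\<exists>h \<in> lmod_hom R N (quotient_module (copower_module I M) K). inj_on h (carrier N)))"

text \<open>
  Notions that refer to all modules in \<open>\<sigma>[M]\<close> quantify over the modules whose carrier lives in a
  type \<open>'u\<close>, which plays the role of the universe and is passed as an \<open>itself\<close> argument. Once
  \<open>'u\<close> is infinite and at least as large as the ring and \<open>M\<close>, these notions no
  longer depend on \<open>'u\<close>: it suffices to test generation on cyclic modules, injectivity on
  the inclusions of the submodules of \<open>M\<close> (Baer's criterion), and projectivity on modules
  with at most \<open>card M\<close> generators.
\<close>

definition generator_in_sigma ::
    "'u itself \<Rightarrow> ('r, 'x) ring_scheme \<Rightarrow> ('r, 'm) module \<Rightarrow> bool"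
  where "generator_in_sigma (U :: 'u itself) R M \<longleftrightarrow>
    (\<forall>N :: ('r, 'u) module. in_sigma R M N \<longrightarrow>
       (\<exists>(I :: ('u \<times> nat) set). \<exists>h \<in> lmod_hom R (copower_module I M) N.
          h ` carrier (copower_module I M) = carrier N))"

definition short_exact ::
    "('r, 'x) ring_scheme \<Rightarrow> ('r, 'a) module \<Rightarrow> ('r, 'b) module \<Rightarrow> ('r, 'c) module
      \<Rightarrow> ('a \<Rightarrow> 'b) \<Rightarrow> ('b \<Rightarrow> 'c) \<Rightarrow> bool"
  where "short_exact R A B C f g \<longleftrightarrow>
    f \<in> lmod_hom R A B \<and> g \<in> lmod_hom R B C \<and>
    inj_on f (carrier A) \<and>
    f ` carrier A = {b \<in> carrier B. g b = \<zero>\<^bsub>C\<^esub>} \<and>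
    g ` carrier B = carrier C"

definition projective_in_sigma ::
    "'u itself \<Rightarrow> ('r, 'x) ring_scheme \<Rightarrow> ('r, 'm) module \<Rightarrow> bool"
  where "projective_in_sigma (U :: 'u itself) R M \<longleftrightarrow>
    (\<forall>(A :: ('r, 'u) module) (B :: ('r, 'u) module) (C :: ('r, 'u) module) f g.
       in_sigma R M A \<and> in_sigma R M B \<and> in_sigma R M C \<and> short_exact R A B C f g \<longrightarrow>
       inj_on (compose (carrier M) f) (lmod_hom R M A) \<and>
       compose (carrier M) f ` lmod_hom R M A =
         {h \<in> lmod_hom R M B. compose (carrier M) g h = zero_hom M C} \<and>
       compose (carrier M) g ` lmod_hom R M B = lmod_hom R M C)"

definition injective_in_sigma ::
    "'u itself \<Rightarrow> ('r, 'x) ring_scheme \<Rightarrow> ('r, 'm) module \<Rightarrow> ('r, 'e) module \<Rightarrow> bool"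
  where "injective_in_sigma (U :: 'u itself) R X E \<longleftrightarrow>
    in_sigma R X E \<and>
    (\<forall>(A :: ('r, 'u) module) (B :: ('r, 'u) module) f g.
       in_sigma R X A \<and> in_sigma R X B \<and>
       f \<in> lmod_hom R A B \<and> inj_on f (carrier A) \<and> g \<in> lmod_hom R A E \<longrightarrow>
       (\<exists>h \<in> lmod_hom R B E. compose (carrier A) h f = g))"

definition essential_submodule ::
    "('r, 'x) ring_scheme \<Rightarrow> ('r, 'e) module \<Rightarrow> 'e set \<Rightarrow> bool"
  where "essential_submodule R E K \<longleftrightarrow>
    submodule K R E \<and>
    (\<forall>L. submodule L R E \<and> L \<noteq> {\<zero>\<^bsub>E\<^esub>} \<longrightarrow> K \<inter> L \<noteq> {\<zero>\<^bsub>E\<^esub>})"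

text \<open>
  \<open>is_injective_hull TYPE('u) R X K E \<iota>\<close> says that \<open>E\<close> together with the embedding \<open>\<iota>\<close> of \<open>K\<close> is
  an \<open>X\<close>-injective hull of \<open>K\<close>. Hulls are unique up to an isomorphism
  over \<open>K\<close>, so that statements on ``the'' hull are made for every pair \<open>E\<close>, \<open>\<iota>\<close> of this kind.
\<close>

definition is_injective_hull ::
    "'u itself \<Rightarrow> ('r, 'x) ring_scheme \<Rightarrow> ('r, 'm) module \<Rightarrow> ('r, 'k) module
      \<Rightarrow> ('r, 'e) module \<Rightarrow> ('k \<Rightarrow> 'e) \<Rightarrow> bool"
  where "is_injective_hull U R X K E \<iota> \<longleftrightarrow>
    injective_in_sigma U R X E \<and>
    \<iota> \<in> lmod_hom R K E \<and> inj_on \<iota> (carrier K) \<and>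
    essential_submodule R E (\<iota> ` carrier K)"

section \<open>Prime submodules, semiprime modules, Goldie modules\<close>

definition fully_invariant :: "('r, 'x) ring_scheme \<Rightarrow> ('r, 'm) module \<Rightarrow> 'm set \<Rightarrow> bool"
  where "fully_invariant R M N \<longleftrightarrow>
    submodule N R M \<and> (\<forall>f \<in> lmod_hom R M M. f ` N \<subseteq> N)"

definition sum_of_submodules :: "('r, 'm) module \<Rightarrow> 'm set set \<Rightarrow> 'm set"
  where "sum_of_submodules M \<N> =
    {finsum M c \<F> |\<F> c. finite \<F> \<and> \<F> \<subseteq> \<N> \<and> (\<forall>N\<in>\<F>. c N \<in> N)}"

text \<open>The product \<open>N\<^sub>M K\<close> of submodules.\<close>

definition submodule_prod ::
    "('r, 'x) ring_scheme \<Rightarrow> ('r, 'm) module \<Rightarrow> 'm set \<Rightarrow> 'm set \<Rightarrow> 'm set"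
  where "submodule_prod R M N K =
    sum_of_submodules M {f ` N |f. f \<in> lmod_hom R M (M\<lparr>carrier := K\<rparr>)}"

definition prime_in :: "('r, 'x) ring_scheme \<Rightarrow> ('r, 'm) module \<Rightarrow> 'm set \<Rightarrow> bool"
  where "prime_in R M P \<longleftrightarrow>
    fully_invariant R M P \<and> P \<noteq> carrier M \<and>
    (\<forall>N K. fully_invariant R M N \<and> fully_invariant R M K \<and> submodule_prod R M N K \<subseteq> P
       \<longrightarrow> N \<subseteq> P \<or> K \<subseteq> P)"

definition minimal_primes_in :: "('r, 'x) ring_scheme \<Rightarrow> ('r, 'm) module \<Rightarrow> 'm set set"
  where "minimal_primes_in R M =
    {P. prime_in R M P \<and> (\<forall>Q. prime_in R M Q \<and> Q \<subseteq> P \<longrightarrow> Q = P)}"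

definition semiprime_module :: "('r, 'x) ring_scheme \<Rightarrow> ('r, 'm) module \<Rightarrow> bool"
  where "semiprime_module R M \<longleftrightarrow>
    (\<forall>K. fully_invariant R M K \<and> submodule_prod R M K K = {\<zero>\<^bsub>M\<^esub>} \<longrightarrow> K = {\<zero>\<^bsub>M\<^esub>})"

definition left_annihilator :: "('r, 'x) ring_scheme \<Rightarrow> ('r, 'm) module \<Rightarrow> 'm set \<Rightarrow> bool"
  where "left_annihilator R M A \<longleftrightarrow>
    (\<exists>X \<subseteq> lmod_hom R M M. A = {m \<in> carrier M. \<forall>f\<in>X. f m = \<zero>\<^bsub>M\<^esub>})"

definition acc_on_left_annihilators :: "('r, 'x) ring_scheme \<Rightarrow> ('r, 'm) module \<Rightarrow> bool"
  where "acc_on_left_annihilators R M \<longleftrightarrow>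
    (\<forall>A :: nat \<Rightarrow> 'm set. (\<forall>n. left_annihilator R M (A n) \<and> A n \<subseteq> A (Suc n)) \<longrightarrow>
       (\<exists>n. \<forall>m\<ge>n. A m = A n))"

definition independent_submodules :: "('r, 'm) module \<Rightarrow> ('i \<Rightarrow> 'm set) \<Rightarrow> 'i set \<Rightarrow> bool"
  where "independent_submodules M N I \<longleftrightarrow>
    (\<forall>F c. finite F \<and> F \<subseteq> I \<and> (\<forall>i\<in>F. c i \<in> N i) \<and> finsum M c F = \<zero>\<^bsub>M\<^esub> \<longrightarrow>
       (\<forall>i\<in>F. c i = \<zero>\<^bsub>M\<^esub>))"

text \<open>Finite uniform dimension: no infinite direct sum of nonzero submodules.\<close>

definition finite_uniform_dim :: "('r, 'x) ring_scheme \<Rightarrow> ('r, 'm) module \<Rightarrow> bool"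
  where "finite_uniform_dim R M \<longleftrightarrow>
    \<not> (\<exists>N :: nat \<Rightarrow> 'm set.
         (\<forall>i. submodule (N i) R M \<and> N i \<noteq> {\<zero>\<^bsub>M\<^esub>}) \<and> independent_submodules M N UNIV)"

definition goldie_module :: "('r, 'x) ring_scheme \<Rightarrow> ('r, 'm) module \<Rightarrow> bool"
  where "goldie_module R M \<longleftrightarrow> acc_on_left_annihilators R M \<and> finite_uniform_dim R M"

end

theory Submission
  imports Defs
begin

text \<open>
  Membership in \<open>\<sigma>[M]\<close> is tested on annihilators: \<open>N\<close> is \<open>M\<close>-subgenerated iff the annihilator of
  each element of \<open>N\<close> contains that of a finite subset of \<open>M\<close>.

  Semiprimeness makes the intersection of the minimal primes zero, so if there are only finitely
  many of them, each minimal prime \<open>P\<close> meets the intersection \<open>I\<close> of the others in \<open>0\<close>, and \<open>I\<close> is not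
  contained in \<open>P\<close>. Let \<open>X\<close> be an essential extension of a submodule of \<open>M / P\<close> and suppose
  \<open>f : M \<rightarrow> X\<close> does not kill \<open>P\<close>. Then some \<open>z = f p \<noteq> 0\<close> with \<open>p \<in> P\<close> has the annihilator of an element \<open>k + P\<close>
  of \<open>M / P\<close>. By projectivity every \<open>M \<rightarrow> Rz\<close> lifts to \<open>M \<rightarrow> Rp\<close>, which maps \<open>I\<close> into
  \<open>I \<inter> P = 0\<close>. Hence every \<open>M \<rightarrow> Rk\<close> maps \<open>I\<close> into \<open>P\<close>, and primeness of \<open>P\<close> gives \<open>k \<in> P\<close>, that is,
  \<open>z = 0\<close>, a contradiction. So all homomorphisms from \<open>M\<close> to \<open>E(M / P)\<close> kill \<open>P\<close>.

  For (1), if \<open>f x \<noteq> 0\<close> for some \<open>f : E(M / P) \<rightarrow> E(M / Q)\<close>, the same argument applies to a multiple \<open>z\<close> of \<open>f x\<close>, with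
  \<open>P\<close> in the role of \<open>I\<close>. For (2), if \<open>M\<close> is a generator, the modules in \<open>\<sigma>[M]\<close> all of whose
  homomorphisms from \<open>M\<close> kill \<open>P\<close> belong to \<open>\<sigma>[M / P]\<close>; hence \<open>\<sigma>[M / P]\<close> is closed under the essential
  extensions above, and the two notions of injective hull agree.
\<close>

section \<open>Modules and homomorphisms\<close>

context left_module
begin

lemma smult_l_null [simp]: "x \<in> carrier M \<Longrightarrow> \<zero>\<^bsub>R\<^esub> \<odot>\<^bsub>M\<^esub> x = \<zero>\<^bsub>M\<^esub>"
  by (metis M.add.r_cancel_one' R.l_zero R.zero_closed smult_closed smult_l_distr)

lemma smult_r_null [simp]: "a \<in> carrier R \<Longrightarrow> a \<odot>\<^bsub>M\<^esub> \<zero>\<^bsub>M\<^esub> = \<zero>\<^bsub>M\<^esub>"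
  by (metis M.add.r_cancel_one' M.l_zero M.zero_closed smult_closed smult_r_distr)

lemma smult_l_minus:
  assumes "a \<in> carrier R" "x \<in> carrier M"
  shows "(\<ominus>\<^bsub>R\<^esub> a) \<odot>\<^bsub>M\<^esub> x = \<ominus>\<^bsub>M\<^esub> (a \<odot>\<^bsub>M\<^esub> x)"
proof -
  have "(\<ominus>\<^bsub>R\<^esub> a) \<odot>\<^bsub>M\<^esub> x \<oplus>\<^bsub>M\<^esub> a \<odot>\<^bsub>M\<^esub> x = \<zero>\<^bsub>M\<^esub>"
    using assms smult_l_distr[of "\<ominus>\<^bsub>R\<^esub> a" a x] by (simp add: R.l_neg)
  then show ?thesis
    using assms by (simp add: M.minus_equality)
qed

lemma smult_neg_one: "x \<in> carrier M \<Longrightarrow> (\<ominus>\<^bsub>R\<^esub> \<one>\<^bsub>R\<^esub>) \<odot>\<^bsub>M\<^esub> x = \<ominus>\<^bsub>M\<^esub> x"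
  by (simp add: smult_l_minus)

lemma minus_eq_zero_iff:
  "\<lbrakk>x \<in> carrier M; y \<in> carrier M\<rbrakk> \<Longrightarrow> x \<ominus>\<^bsub>M\<^esub> y = \<zero>\<^bsub>M\<^esub> \<longleftrightarrow> x = y"
  by (metis M.add.inv_closed M.minus_eq M.minus_equality M.minus_minus M.r_neg)

lemma smult_l_minus_eq_zero_iff:
  assumes "a \<in> carrier R" "b \<in> carrier R" "x \<in> carrier M"
  shows "(a \<ominus>\<^bsub>R\<^esub> b) \<odot>\<^bsub>M\<^esub> x = \<zero>\<^bsub>M\<^esub> \<longleftrightarrow> a \<odot>\<^bsub>M\<^esub> x = b \<odot>\<^bsub>M\<^esub> x"
  using assms by (simp add: R.minus_eq smult_l_distr smult_l_minus minus_eq_zero_iff flip: M.minus_eq)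

text \<open>Closure under negation, which \<open>submodule\<close> demands by way of
  \<open>subgroup\<close>, is automatic: the negative of an element is its multiple by -1.\<close>

lemma submodule_iff:
  "submodule H R M \<longleftrightarrow> H \<subseteq> carrier M \<and> \<zero>\<^bsub>M\<^esub> \<in> H \<and> (\<forall>x\<in>H. \<forall>y\<in>H. x \<oplus>\<^bsub>M\<^esub> y \<in> H) \<and>
    (\<forall>a\<in>carrier R. \<forall>x\<in>H. a \<odot>\<^bsub>M\<^esub> x \<in> H)" (is "?L \<longleftrightarrow> ?R")
proof
  assume ?L
  then interpret submodule H R M .
  show ?R
    using subset one_closed m_closed by (auto simp: subset_iff)
next
  assume r: ?R
  then have "\<ominus>\<^bsub>M\<^esub> x \<in> H" if "x \<in> H" for x
    using that smult_neg_one[of x] by (metis R.add.inv_closed R.one_closed subsetD)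
  with r show ?L
    by (intro submodule.intro subgroup.intro) (auto simp: submodule_axioms_def a_inv_def)
qed

lemma submoduleI:
  assumes "H \<subseteq> carrier M" "\<zero>\<^bsub>M\<^esub> \<in> H" "\<And>x y. \<lbrakk>x \<in> H; y \<in> H\<rbrakk> \<Longrightarrow> x \<oplus>\<^bsub>M\<^esub> y \<in> H"
    "\<And>a x. \<lbrakk>a \<in> carrier R; x \<in> H\<rbrakk> \<Longrightarrow> a \<odot>\<^bsub>M\<^esub> x \<in> H"
  shows "submodule H R M"
  using assms by (auto simp: submodule_iff)

lemma submoduleD:
  assumes "submodule H R M"
  shows "H \<subseteq> carrier M" "\<And>x. x \<in> H \<Longrightarrow> x \<in> carrier M" "\<zero>\<^bsub>M\<^esub> \<in> H"
    "\<And>x y. \<lbrakk>x \<in> H; y \<in> H\<rbrakk> \<Longrightarrow> x \<oplus>\<^bsub>M\<^esub> y \<in> H"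
    "\<And>a x. \<lbrakk>a \<in> carrier R; x \<in> H\<rbrakk> \<Longrightarrow> a \<odot>\<^bsub>M\<^esub> x \<in> H"
    "\<And>x. x \<in> H \<Longrightarrow> \<ominus>\<^bsub>M\<^esub> x \<in> H"
    "\<And>x y. \<lbrakk>x \<in> H; y \<in> H\<rbrakk> \<Longrightarrow> x \<ominus>\<^bsub>M\<^esub> y \<in> H"
proof -
  show 1: "H \<subseteq> carrier M" "\<zero>\<^bsub>M\<^esub> \<in> H" and 2: "\<And>x y. \<lbrakk>x \<in> H; y \<in> H\<rbrakk> \<Longrightarrow> x \<oplus>\<^bsub>M\<^esub> y \<in> H"
    and "\<And>a x. \<lbrakk>a \<in> carrier R; x \<in> H\<rbrakk> \<Longrightarrow> a \<odot>\<^bsub>M\<^esub> x \<in> H"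
    using assms unfolding submodule_iff by auto
  then show 3: "\<And>x. x \<in> H \<Longrightarrow> \<ominus>\<^bsub>M\<^esub> x \<in> H"
    by (metis R.add.inv_closed R.one_closed subsetD smult_neg_one)
  show "\<And>x. x \<in> H \<Longrightarrow> x \<in> carrier M"
    using 1 by blast
  show "\<And>x y. \<lbrakk>x \<in> H; y \<in> H\<rbrakk> \<Longrightarrow> x \<ominus>\<^bsub>M\<^esub> y \<in> H"
    using 2 3 by (simp add: M.minus_eq)
qed

lemma submodule_carrier: "submodule (carrier M) R M"
  by (rule submoduleI) auto

lemma submodule_zero: "submodule {\<zero>\<^bsub>M\<^esub>} R M"
  by (rule submoduleI) auto

lemma submodule_finsum:
  assumes "submodule H R M" "\<And>i. i \<in> I \<Longrightarrow> f i \<in> H"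
  shows "finsum M f I \<in> H"
proof (cases "finite I")
  case True
  then show ?thesis using assms(2)
  proof (induction I)
    case empty then show ?case using submoduleD[OF assms(1)] by simp
  next
    case (insert i I)
    then have "finsum M f (insert i I) = f i \<oplus>\<^bsub>M\<^esub> finsum M f I"
      using submoduleD[OF assms(1)] by (intro M.finsum_insert) auto
    then show ?case
      using insert submoduleD[OF assms(1)] by simp
  qed
next
  case False
  then show ?thesis
    using submoduleD[OF assms(1)] by (simp add: M.finsum_infinite)
qed

lemma smult_finsum:
  assumes "a \<in> carrier R" "f \<in> I \<rightarrow> carrier M"
  shows "a \<odot>\<^bsub>M\<^esub> finsum M f I = finsum M (\<lambda>i. a \<odot>\<^bsub>M\<^esub> f i) I"
proof (cases "finite I")
  case True
  then show ?thesis using assms(2)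
  proof (induction I)
    case (insert i I)
    have "finsum M f (insert i I) = f i \<oplus>\<^bsub>M\<^esub> finsum M f I"
      using insert by (intro M.finsum_insert) auto
    moreover have "finsum M (\<lambda>i. a \<odot>\<^bsub>M\<^esub> f i) (insert i I)
        = a \<odot>\<^bsub>M\<^esub> f i \<oplus>\<^bsub>M\<^esub> finsum M (\<lambda>i. a \<odot>\<^bsub>M\<^esub> f i) I"
      using insert assms(1) by (intro M.finsum_insert) auto
    ultimately show ?case
      using insert assms(1) by (simp add: smult_r_distr Pi_iff)
  qed (use assms in simp)
next
  case False
  then show ?thesis
    using assms by (simp add: M.finsum_infinite)
qed

end

text \<open>Every axiom can be checked on preimages, so nothing has to be known about
  \<open>N\<close> beforehand. This makes quotients and transported copies into modules.\<close>

lemma left_module_image: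
  fixes M :: "('r, 'm) module" and N :: "('r, 'n) module"
  assumes "left_module R M"
    and im: "\<phi> ` carrier M = carrier N"
    and add: "\<And>x y. \<lbrakk>x \<in> carrier M; y \<in> carrier M\<rbrakk> \<Longrightarrow> \<phi> (x \<oplus>\<^bsub>M\<^esub> y) = \<phi> x \<oplus>\<^bsub>N\<^esub> \<phi> y"
    and smult: "\<And>a x. \<lbrakk>a \<in> carrier R; x \<in> carrier M\<rbrakk> \<Longrightarrow> \<phi> (a \<odot>\<^bsub>M\<^esub> x) = a \<odot>\<^bsub>N\<^esub> \<phi> x"
    and zero: "\<phi> \<zero>\<^bsub>M\<^esub> = \<zero>\<^bsub>N\<^esub>"
  shows "left_module R N"
proof -
  interpret left_module R M by fact
  have pull: "\<exists>x\<in>carrier M. y = \<phi> x" if "y \<in> carrier N" for y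
    using im that by blast
  have push: "\<phi> x \<in> carrier N" if "x \<in> carrier M" for x
    using im that by blast
  have "abelian_group N"
  proof (rule abelian_groupI)
    fix x y assume xy: "x \<in> carrier N" "y \<in> carrier N"
    then obtain x' y' where [simp]: "x = \<phi> x'" "y = \<phi> y'" and c: "x' \<in> carrier M" "y' \<in> carrier M"
      using pull by metis
    show "x \<oplus>\<^bsub>N\<^esub> y \<in> carrier N"
      using c push by (simp flip: add)
    show "x \<oplus>\<^bsub>N\<^esub> y = y \<oplus>\<^bsub>N\<^esub> x"
      using c by (simp add: M.a_comm flip: add)
    fix z assume "z \<in> carrier N"
    then obtain z' where [simp]: "z = \<phi> z'" and "z' \<in> carrier M"
      using pull by metis
    then show "x \<oplus>\<^bsub>N\<^esub> y \<oplus>\<^bsub>N\<^esub> z = x \<oplus>\<^bsub>N\<^esub> (y \<oplus>\<^bsub>N\<^esub> z)"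
      using c by (simp add: M.a_assoc flip: add)
  next
    show "\<zero>\<^bsub>N\<^esub> \<in> carrier N"
      using push zero by (metis M.zero_closed)
    fix x assume "x \<in> carrier N"
    then obtain x' where [simp]: "x = \<phi> x'" and c: "x' \<in> carrier M"
      using pull by metis
    show "\<zero>\<^bsub>N\<^esub> \<oplus>\<^bsub>N\<^esub> x = x"
      using c by (simp flip: add zero)
    show "\<exists>y\<in>carrier N. y \<oplus>\<^bsub>N\<^esub> x = \<zero>\<^bsub>N\<^esub>"
      using c push by (intro bexI[of _ "\<phi> (\<ominus>\<^bsub>M\<^esub> x')"]) (simp_all add: M.l_neg flip: add zero)
  qed
  moreover have "left_module_axioms R N"
  proof
    fix a x assume a: "a \<in> carrier R" "x \<in> carrier N"
    then obtain x' where [simp]: "x = \<phi> x'" and c: "x' \<in> carrier M"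
      using pull by metis
    show "a \<odot>\<^bsub>N\<^esub> x \<in> carrier N"
      using a c push by (simp flip: smult)
    fix b assume b: "b \<in> carrier R"
    show "(a \<oplus>\<^bsub>R\<^esub> b) \<odot>\<^bsub>N\<^esub> x = a \<odot>\<^bsub>N\<^esub> x \<oplus>\<^bsub>N\<^esub> b \<odot>\<^bsub>N\<^esub> x"
      using a(1) b c by (simp add: smult_l_distr flip: add smult)
    show "(a \<otimes>\<^bsub>R\<^esub> b) \<odot>\<^bsub>N\<^esub> x = a \<odot>\<^bsub>N\<^esub> (b \<odot>\<^bsub>N\<^esub> x)"
      using a(1) b c by (simp add: smult_assoc1 flip: smult)
  next
    fix a x y assume a: "a \<in> carrier R" "x \<in> carrier N" "y \<in> carrier N"
    then obtain x' y' where [simp]: "x = \<phi> x'" "y = \<phi> y'" and c: "x' \<in> carrier M" "y' \<in> carrier M"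
      using pull by metis
    show "a \<odot>\<^bsub>N\<^esub> (x \<oplus>\<^bsub>N\<^esub> y) = a \<odot>\<^bsub>N\<^esub> x \<oplus>\<^bsub>N\<^esub> a \<odot>\<^bsub>N\<^esub> y"
      using a(1) c by (simp add: smult_r_distr flip: add smult)
  next
    fix x assume "x \<in> carrier N"
    then obtain x' where [simp]: "x = \<phi> x'" and c: "x' \<in> carrier M"
      using pull by metis
    show "\<one>\<^bsub>R\<^esub> \<odot>\<^bsub>N\<^esub> x = x"
      using c by (simp flip: smult)
  qed
  ultimately show ?thesis
    by (intro left_module.intro R.ring_axioms)
qed

lemma (in left_module) left_module_submodule:
  assumes "submodule H R M"
  shows "left_module R (M\<lparr>carrier := H\<rparr>)"
proof -
  note H = submoduleD[OF assms]
  have "abelian_group (M\<lparr>carrier := H\<rparr>)"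
    by (rule abelian_groupI)
      (use H in \<open>auto simp: M.a_ac intro!: bexI[of _ "\<ominus>\<^bsub>M\<^esub> _"] M.r_neg\<close>)
  moreover have "left_module_axioms R (M\<lparr>carrier := H\<rparr>)"
    by unfold_locales
      (use H in \<open>auto simp: smult_l_distr smult_r_distr smult_assoc1\<close>)
  ultimately show ?thesis
    by (intro left_module.intro R.ring_axioms)
qed

section \<open>Homomorphisms: kernels, composition, change of domain and codomain\<close>

lemma lmod_homI:
  assumes "f \<in> carrier M \<rightarrow>\<^sub>E carrier N"
    "\<And>x y. \<lbrakk>x \<in> carrier M; y \<in> carrier M\<rbrakk> \<Longrightarrow> f (x \<oplus>\<^bsub>M\<^esub> y) = f x \<oplus>\<^bsub>N\<^esub> f y"
    "\<And>a x. \<lbrakk>a \<in> carrier R; x \<in> carrier M\<rbrakk> \<Longrightarrow> f (a \<odot>\<^bsub>M\<^esub> x) = a \<odot>\<^bsub>N\<^esub> f x"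
  shows "f \<in> lmod_hom R M N"
  using assms by (auto simp: lmod_hom_def)

lemma lmod_homD:
  assumes "f \<in> lmod_hom R M N"
  shows "f \<in> extensional (carrier M)" "f \<in> carrier M \<rightarrow>\<^sub>E carrier N"
    "\<And>x. x \<in> carrier M \<Longrightarrow> f x \<in> carrier N"
    "\<And>x y. \<lbrakk>x \<in> carrier M; y \<in> carrier M\<rbrakk> \<Longrightarrow> f (x \<oplus>\<^bsub>M\<^esub> y) = f x \<oplus>\<^bsub>N\<^esub> f y"
    "\<And>a x. \<lbrakk>a \<in> carrier R; x \<in> carrier M\<rbrakk> \<Longrightarrow> f (a \<odot>\<^bsub>M\<^esub> x) = a \<odot>\<^bsub>N\<^esub> f x"
  using assms by (auto simp: lmod_hom_def PiE_def)

lemma lmod_hom_zero: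
  assumes "left_module R M" "left_module R N" "f \<in> lmod_hom R M N"
  shows "f \<zero>\<^bsub>M\<^esub> = \<zero>\<^bsub>N\<^esub>"
proof -
  interpret M: left_module R M by fact
  interpret N: left_module R N by fact
  note f = lmod_homD[OF assms(3)]
  have "f (\<zero>\<^bsub>R\<^esub> \<odot>\<^bsub>M\<^esub> \<zero>\<^bsub>M\<^esub>) = \<zero>\<^bsub>R\<^esub> \<odot>\<^bsub>N\<^esub> f \<zero>\<^bsub>M\<^esub>"
    using f by (intro f(5)) auto
  then show ?thesis
    using f(3)[of "\<zero>\<^bsub>M\<^esub>"] by simp
qed

lemma lmod_hom_minus:
  assumes "left_module R M" "left_module R N" "f \<in> lmod_hom R M N"
    and "x \<in> carrier M" "y \<in> carrier M"
  shows "f (x \<ominus>\<^bsub>M\<^esub> y) = f x \<ominus>\<^bsub>N\<^esub> f y"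
proof -
  interpret M: left_module R M by fact
  interpret N: left_module R N by fact
  note f = lmod_homD[OF assms(3)]
  have "f (\<ominus>\<^bsub>M\<^esub> y) = f ((\<ominus>\<^bsub>R\<^esub> \<one>\<^bsub>R\<^esub>) \<odot>\<^bsub>M\<^esub> y)"
    using assms by (simp add: M.smult_neg_one)
  also have "\<dots> = (\<ominus>\<^bsub>R\<^esub> \<one>\<^bsub>R\<^esub>) \<odot>\<^bsub>N\<^esub> f y"
    using assms by (intro f(5)) auto
  finally have "f (\<ominus>\<^bsub>M\<^esub> y) = \<ominus>\<^bsub>N\<^esub> f y"
    using assms f(3) by (simp add: N.smult_neg_one)
  then show ?thesis
    using assms f(4) by (simp add: M.M.minus_eq N.M.minus_eq)
qed

lemma inj_on_lmod_hom_iff: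
  assumes "left_module R M" "left_module R N" "f \<in> lmod_hom R M N"
  shows "inj_on f (carrier M) \<longleftrightarrow> (\<forall>x\<in>carrier M. f x = \<zero>\<^bsub>N\<^esub> \<longrightarrow> x = \<zero>\<^bsub>M\<^esub>)"
proof -
  interpret M: left_module R M by fact
  interpret N: left_module R N by fact
  note f = lmod_homD[OF assms(3)]
  show ?thesis
  proof safe
    fix x assume "inj_on f (carrier M)" "x \<in> carrier M" "f x = \<zero>\<^bsub>N\<^esub>"
    then show "x = \<zero>\<^bsub>M\<^esub>"
      using lmod_hom_zero[OF assms] by (metis M.M.zero_closed inj_onD)
  next
    assume z: "\<forall>x\<in>carrier M. f x = \<zero>\<^bsub>N\<^esub> \<longrightarrow> x = \<zero>\<^bsub>M\<^esub>"
    show "inj_on f (carrier M)"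
    proof (rule inj_onI)
      fix x y assume xy: "x \<in> carrier M" "y \<in> carrier M" "f x = f y"
      then have "f (x \<ominus>\<^bsub>M\<^esub> y) = \<zero>\<^bsub>N\<^esub>"
        using f(3) by (simp add: lmod_hom_minus[OF assms] N.minus_eq_zero_iff)
      then show "x = y"
        using z xy(1,2) M.minus_eq_zero_iff[of x y] M.M.minus_closed[of x y] by blast
    qed
  qed
qed

lemma compose_lmod_hom:
  assumes "left_module R L" "f \<in> lmod_hom R L M" "g \<in> lmod_hom R M N"
  shows "compose (carrier L) g f \<in> lmod_hom R L N"
proof -
  interpret left_module R L by fact
  show ?thesis
    using lmod_homD[OF assms(2)] lmod_homD[OF assms(3)]
    by (intro lmod_homI) (auto simp: compose_def)
qed

text \<open>Extensionality refers to the domain alone, so the same function serves for both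
  codomains and corestriction needs no new map.\<close>

lemma lmod_hom_carrier_update:
  assumes "K \<subseteq> carrier N"
  shows "f \<in> lmod_hom R M (N\<lparr>carrier := K\<rparr>) \<longleftrightarrow> f \<in> lmod_hom R M N \<and> f ` carrier M \<subseteq> K"
  using assms by (auto simp: lmod_hom_def PiE_iff subset_iff)

lemma restrict_lmod_hom:
  assumes "left_module R M" "submodule H R M" "f \<in> lmod_hom R M N"
  shows "restrict f H \<in> lmod_hom R (M\<lparr>carrier := H\<rparr>) N"
proof -
  interpret left_module R M by fact
  show ?thesis
    using lmod_homD[OF assms(3)] submoduleD[OF assms(2)] by (intro lmod_homI) auto
qed

lemma submodule_image:
  assumes "left_module R M" "left_module R N" "submodule H R M" "f \<in> lmod_hom R M N"
  shows "submodule (f ` H) R N"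
proof -
  interpret M: left_module R M by fact
  interpret N: left_module R N by fact
  note f = lmod_homD[OF assms(4)] and H = M.submoduleD[OF assms(3)]
  show ?thesis
  proof (rule N.submoduleI)
    show "f ` H \<subseteq> carrier N"
      using f H by auto
    show "\<zero>\<^bsub>N\<^esub> \<in> f ` H"
      using lmod_hom_zero[OF assms(1,2,4)] H by (metis imageI)
    show "x \<oplus>\<^bsub>N\<^esub> y \<in> f ` H" if "x \<in> f ` H" "y \<in> f ` H" for x y
      using that f H by (auto simp flip: f(4))
    show "a \<odot>\<^bsub>N\<^esub> x \<in> f ` H" if "a \<in> carrier R" "x \<in> f ` H" for a x
      using that f H by (auto simp flip: f(5))
  qed
qed

lemma submodule_vimage:
  assumes "left_module R M" "left_module R N" "submodule H R N" "f \<in> lmod_hom R M N"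
  shows "submodule {x \<in> carrier M. f x \<in> H} R M"
proof -
  interpret M: left_module R M by fact
  interpret N: left_module R N by fact
  note f = lmod_homD[OF assms(4)] and H = N.submoduleD[OF assms(3)]
  show ?thesis
    by (rule M.submoduleI) (use f H lmod_hom_zero[OF assms(1,2,4)] in auto)
qed

abbreviation cyclic_submodule :: "('r, 'x) ring_scheme \<Rightarrow> ('r, 'm) module \<Rightarrow> 'm \<Rightarrow> 'm set"
  where "cyclic_submodule R M x \<equiv> (\<lambda>a. a \<odot>\<^bsub>M\<^esub> x) ` carrier R"

context left_module
begin

lemma submodule_cyclic: "x \<in> carrier M \<Longrightarrow> submodule (cyclic_submodule R M x) R M"
proof (rule submoduleI)
  assume x: "x \<in> carrier M"
  show "cyclic_submodule R M x \<subseteq> carrier M"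
    using x by auto
  show "\<zero>\<^bsub>M\<^esub> \<in> cyclic_submodule R M x"
    using x by (intro image_eqI[of _ _ "\<zero>\<^bsub>R\<^esub>"]) auto
  show "y \<oplus>\<^bsub>M\<^esub> z \<in> cyclic_submodule R M x"
    if "y \<in> cyclic_submodule R M x" "z \<in> cyclic_submodule R M x" for y z
    using that x by (auto simp flip: smult_l_distr)
  show "a \<odot>\<^bsub>M\<^esub> y \<in> cyclic_submodule R M x" if "a \<in> carrier R" "y \<in> cyclic_submodule R M x" for a y
    using that x by (auto simp flip: smult_assoc1)
qed

lemma mem_cyclic: "x \<in> carrier M \<Longrightarrow> x \<in> cyclic_submodule R M x"
  by (intro image_eqI[of _ _ "\<one>\<^bsub>R\<^esub>"]) auto

end

section \<open>Quotients, copowers and subgenerated modules\<close>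

context left_module
begin

lemma abelian_subgroup_submodule: "submodule K R M \<Longrightarrow> abelian_subgroup K M"
  by (intro abelian_subgroupI3 additive_subgroup.intro M.abelian_group_axioms)
    (auto simp: submodule_def)

lemma coset_eq_iff:
  assumes "submodule K R M" "x \<in> carrier M" "y \<in> carrier M"
  shows "K +>\<^bsub>M\<^esub> x = K +>\<^bsub>M\<^esub> y \<longleftrightarrow> x \<ominus>\<^bsub>M\<^esub> y \<in> K"
proof -
  interpret K: abelian_subgroup K M by (rule abelian_subgroup_submodule) fact
  have "x \<in> K +>\<^bsub>M\<^esub> y \<longleftrightarrow> x \<ominus>\<^bsub>M\<^esub> y \<in> K"
    using assms K.a_rcos_module[of y x] by (simp add: M.minus_eq)
  then show ?thesis
    using assms K.a_rcos_self[of x] K.a_repr_independence'[of x y] by auto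
qed

lemma coset_eq_self_iff:
  assumes "submodule K R M" "x \<in> carrier M"
  shows "K +>\<^bsub>M\<^esub> x = K \<longleftrightarrow> x \<in> K"
proof -
  have "x \<ominus>\<^bsub>M\<^esub> \<zero>\<^bsub>M\<^esub> = x"
    unfolding M.minus_eq using assms(2) by (metis M.minus_equality M.r_zero M.zero_closed)
  then show ?thesis
    using coset_eq_iff[OF assms M.zero_closed] submoduleD(1)[OF assms(1)] by simp
qed

lemma quotient_module_simps:
  assumes K: "submodule K R M"
  shows "carrier (quotient_module M K) = (\<lambda>x. K +>\<^bsub>M\<^esub> x) ` carrier M"
    and "\<zero>\<^bsub>quotient_module M K\<^esub> = K"
    and "\<lbrakk>x \<in> carrier M; y \<in> carrier M\<rbrakk> \<Longrightarrow>
      (K +>\<^bsub>M\<^esub> x) \<oplus>\<^bsub>quotient_module M K\<^esub> (K +>\<^bsub>M\<^esub> y) = K +>\<^bsub>M\<^esub> (x \<oplus>\<^bsub>M\<^esub> y)"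
    and "\<lbrakk>a \<in> carrier R; x \<in> carrier M\<rbrakk> \<Longrightarrow>
      a \<odot>\<^bsub>quotient_module M K\<^esub> (K +>\<^bsub>M\<^esub> x) = K +>\<^bsub>M\<^esub> (a \<odot>\<^bsub>M\<^esub> x)"
proof -
  interpret K: abelian_subgroup K M by (rule abelian_subgroup_submodule) fact
  show "carrier (quotient_module M K) = (\<lambda>x. K +>\<^bsub>M\<^esub> x) ` carrier M"
    by (auto simp: quotient_module_def A_RCOSETS_def')
  show "\<zero>\<^bsub>quotient_module M K\<^esub> = K"
    by (simp add: quotient_module_def)
  show "\<lbrakk>x \<in> carrier M; y \<in> carrier M\<rbrakk> \<Longrightarrow>
      (K +>\<^bsub>M\<^esub> x) \<oplus>\<^bsub>quotient_module M K\<^esub> (K +>\<^bsub>M\<^esub> y) = K +>\<^bsub>M\<^esub> (x \<oplus>\<^bsub>M\<^esub> y)"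
    using K.a_rcos_sum[of x y] by (simp add: quotient_module_def)
  assume ax: "a \<in> carrier R" "x \<in> carrier M"
  \<comment> \<open>Scalar multiplication in the quotient is a union over all representatives. The
    union collapses because they all yield the same coset and at least one exists.\<close>
  have "K +>\<^bsub>M\<^esub> (a \<odot>\<^bsub>M\<^esub> y) = K +>\<^bsub>M\<^esub> (a \<odot>\<^bsub>M\<^esub> x)" if y: "y \<in> K +>\<^bsub>M\<^esub> x" for y
  proof -
    obtain k where k: "k \<in> K" "y = k \<oplus>\<^bsub>M\<^esub> x"
      using y unfolding a_r_coset_def' by blast
    then have "k \<in> carrier M" "a \<odot>\<^bsub>M\<^esub> k \<in> K"
      using submoduleD[OF K] ax by auto
    then show ?thesis
      using ax k by (simp add: coset_eq_iff[OF K] smult_r_distr M.minus_eq M.a_assoc M.r_neg)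
  qed
  moreover have "K +>\<^bsub>M\<^esub> x \<noteq> {}"
    using K.a_rcos_self[of x] ax by auto
  ultimately show "a \<odot>\<^bsub>quotient_module M K\<^esub> (K +>\<^bsub>M\<^esub> x) = K +>\<^bsub>M\<^esub> (a \<odot>\<^bsub>M\<^esub> x)"
    by (simp add: quotient_module_def)
qed

lemma left_module_quotient:
  assumes K: "submodule K R M"
  shows "left_module R (quotient_module M K)"
  by (rule left_module_image[where \<phi> = "\<lambda>x. K +>\<^bsub>M\<^esub> x" and M = M])
    (use quotient_module_simps[OF K] in
      \<open>auto simp: coset_eq_self_iff[OF K] submoduleD(3)[OF K] left_module_axioms\<close>)

end

text \<open>\<^const>\<open>finsum\<close> is \<open>\<zero>\<close> on infinite index sets, hence the restriction to the support.\<close>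

definition fsum :: "('r, 'm) module \<Rightarrow> 'i set \<Rightarrow> ('i \<Rightarrow> 'm) \<Rightarrow> 'm"
  where "fsum M I f = finsum M f {i \<in> I. f i \<noteq> \<zero>\<^bsub>M\<^esub>}"

section \<open>Finitely supported sums and copowers\<close>

context left_module
begin

text \<open>Families with different supports are added by passing to a common finite index set,
  where the additional summands vanish.\<close>

lemma fsum_eq_finsum:
  assumes "finite S" "{i \<in> I. f i \<noteq> \<zero>\<^bsub>M\<^esub>} \<subseteq> S" "S \<subseteq> I" "f \<in> S \<rightarrow> carrier M"
  shows "fsum M I f = finsum M f S"
  unfolding fsum_def using assms by (intro M.add.finprod_mono_neutral_cong_left) auto

lemma fsum_cong: "(\<And>i. i \<in> I \<Longrightarrow> f i = g i) \<Longrightarrow> g \<in> I \<rightarrow> carrier M \<Longrightarrow> fsum M I f = fsum M I g"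
  unfolding fsum_def by (rule M.finsum_cong') auto

lemma fsum_submodule:
  assumes "submodule H R M" "\<And>i. i \<in> I \<Longrightarrow> f i \<in> H"
  shows "fsum M I f \<in> H"
  unfolding fsum_def using assms by (intro submodule_finsum) auto

lemma fsum_closed: "f \<in> I \<rightarrow> carrier M \<Longrightarrow> fsum M I f \<in> carrier M"
  by (rule fsum_submodule[OF submodule_carrier]) auto

lemma fsum_add:
  assumes "f \<in> I \<rightarrow> carrier M" "g \<in> I \<rightarrow> carrier M"
    and "finite {i \<in> I. f i \<noteq> \<zero>\<^bsub>M\<^esub>}" "finite {i \<in> I. g i \<noteq> \<zero>\<^bsub>M\<^esub>}"
  shows "fsum M I (\<lambda>i. f i \<oplus>\<^bsub>M\<^esub> g i) = fsum M I f \<oplus>\<^bsub>M\<^esub> fsum M I g"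
proof -
  let ?S = "{i \<in> I. f i \<noteq> \<zero>\<^bsub>M\<^esub>} \<union> {i \<in> I. g i \<noteq> \<zero>\<^bsub>M\<^esub>}"
  have "fsum M I (\<lambda>i. f i \<oplus>\<^bsub>M\<^esub> g i) = finsum M (\<lambda>i. f i \<oplus>\<^bsub>M\<^esub> g i) ?S"
    using assms by (intro fsum_eq_finsum) auto
  also have "\<dots> = finsum M f ?S \<oplus>\<^bsub>M\<^esub> finsum M g ?S"
    using assms by (intro M.finsum_addf) auto
  also have "finsum M f ?S = fsum M I f"
    using assms by (intro fsum_eq_finsum[symmetric]) auto
  also have "finsum M g ?S = fsum M I g"
    using assms by (intro fsum_eq_finsum[symmetric]) auto
  finally show ?thesis .
qed

lemma fsum_smult:
  assumes "f \<in> I \<rightarrow> carrier M" "finite {i \<in> I. f i \<noteq> \<zero>\<^bsub>M\<^esub>}" "a \<in> carrier R"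
  shows "fsum M I (\<lambda>i. a \<odot>\<^bsub>M\<^esub> f i) = a \<odot>\<^bsub>M\<^esub> fsum M I f"
proof -
  have "fsum M I (\<lambda>i. a \<odot>\<^bsub>M\<^esub> f i) = finsum M (\<lambda>i. a \<odot>\<^bsub>M\<^esub> f i) {i \<in> I. f i \<noteq> \<zero>\<^bsub>M\<^esub>}"
    using assms by (intro fsum_eq_finsum) auto
  also have "\<dots> = a \<odot>\<^bsub>M\<^esub> fsum M I f"
    unfolding fsum_def using assms by (intro smult_finsum[symmetric]) auto
  finally show ?thesis .
qed

lemma fsum_single:
  assumes "i \<in> I" "x \<in> carrier M"
  shows "fsum M I (\<lambda>j. if j = i then x else \<zero>\<^bsub>M\<^esub>) = x"
proof -
  have "fsum M I (\<lambda>j. if j = i then x else \<zero>\<^bsub>M\<^esub>) = finsum M (\<lambda>j. if j = i then x else \<zero>\<^bsub>M\<^esub>) {i}"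
    using assms by (intro fsum_eq_finsum) auto
  then show ?thesis
    using assms by simp
qed

lemma copower_module_simps [simp]:
  "carrier (copower_module I M) = {v \<in> I \<rightarrow>\<^sub>E carrier M. finite {i \<in> I. v i \<noteq> \<zero>\<^bsub>M\<^esub>}}"
  "\<zero>\<^bsub>copower_module I M\<^esub> = (\<lambda>i\<in>I. \<zero>\<^bsub>M\<^esub>)"
  "v \<oplus>\<^bsub>copower_module I M\<^esub> w = (\<lambda>i\<in>I. v i \<oplus>\<^bsub>M\<^esub> w i)"
  "a \<odot>\<^bsub>copower_module I M\<^esub> v = (\<lambda>i\<in>I. a \<odot>\<^bsub>M\<^esub> v i)"
  by (simp_all add: copower_module_def)

lemma left_module_copower: "left_module R (copower_module I M)"
proof -
  let ?V = "copower_module I M"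
  have fin_add: "finite {i \<in> I. v i \<oplus>\<^bsub>M\<^esub> w i \<noteq> \<zero>\<^bsub>M\<^esub>}"
    if "finite {i \<in> I. v i \<noteq> \<zero>\<^bsub>M\<^esub>}" "finite {i \<in> I. w i \<noteq> \<zero>\<^bsub>M\<^esub>}" for v w
    by (rule finite_subset[OF _ finite_UnI[OF that]]) auto
  have fin_smult: "finite {i \<in> I. a \<odot>\<^bsub>M\<^esub> v i \<noteq> \<zero>\<^bsub>M\<^esub>}"
    if "finite {i \<in> I. v i \<noteq> \<zero>\<^bsub>M\<^esub>}" "a \<in> carrier R" for a v
    by (rule finite_subset[OF _ that(1)]) (use that in auto)
  have add: "(\<lambda>i\<in>I. v i \<oplus>\<^bsub>M\<^esub> w i) \<in> carrier ?V" if "v \<in> carrier ?V" "w \<in> carrier ?V" for v w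
    using that fin_add[of v w] by (auto cong: conj_cong)
  have smult: "(\<lambda>i\<in>I. a \<odot>\<^bsub>M\<^esub> v i) \<in> carrier ?V" if "v \<in> carrier ?V" "a \<in> carrier R" for v a
    using that fin_smult[of v a] by (auto cong: conj_cong)
  have "abelian_group ?V"
  proof (rule abelian_groupI)
    fix v assume v: "v \<in> carrier ?V"
    show "\<exists>w\<in>carrier ?V. w \<oplus>\<^bsub>?V\<^esub> v = \<zero>\<^bsub>?V\<^esub>"
    proof
      show "(\<lambda>i\<in>I. (\<ominus>\<^bsub>R\<^esub> \<one>\<^bsub>R\<^esub>) \<odot>\<^bsub>M\<^esub> v i) \<in> carrier ?V"
        using v by (intro smult) auto
      show "(\<lambda>i\<in>I. (\<ominus>\<^bsub>R\<^esub> \<one>\<^bsub>R\<^esub>) \<odot>\<^bsub>M\<^esub> v i) \<oplus>\<^bsub>?V\<^esub> v = \<zero>\<^bsub>?V\<^esub>"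
        using v smult_neg_one M.l_neg by (auto simp: PiE_iff intro!: restrict_ext)
    qed
    show "\<zero>\<^bsub>?V\<^esub> \<oplus>\<^bsub>?V\<^esub> v = v"
      using v by (auto simp: PiE_iff extensional_def fun_eq_iff)
  next
    fix v w u assume "v \<in> carrier ?V" "w \<in> carrier ?V" "u \<in> carrier ?V"
    then show "v \<oplus>\<^bsub>?V\<^esub> w \<oplus>\<^bsub>?V\<^esub> u = v \<oplus>\<^bsub>?V\<^esub> (w \<oplus>\<^bsub>?V\<^esub> u)"
      by (auto simp: PiE_iff M.a_assoc intro!: restrict_ext)
  next
    fix v w assume "v \<in> carrier ?V" "w \<in> carrier ?V"
    then show "v \<oplus>\<^bsub>?V\<^esub> w = w \<oplus>\<^bsub>?V\<^esub> v"
      by (auto simp: PiE_iff M.a_comm intro!: restrict_ext)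
  qed (use add in auto)
  moreover have "left_module_axioms R ?V"
  proof
    fix v assume v: "v \<in> carrier ?V"
    show "\<one>\<^bsub>R\<^esub> \<odot>\<^bsub>?V\<^esub> v = v"
      using v by (auto simp: PiE_iff extensional_def fun_eq_iff)
  next
    fix v a b assume v: "a \<in> carrier R" "b \<in> carrier R" "v \<in> carrier ?V"
    show "(a \<oplus>\<^bsub>R\<^esub> b) \<odot>\<^bsub>?V\<^esub> v = a \<odot>\<^bsub>?V\<^esub> v \<oplus>\<^bsub>?V\<^esub> b \<odot>\<^bsub>?V\<^esub> v"
      using v by (auto simp: PiE_iff smult_l_distr intro!: restrict_ext)
    show "(a \<otimes>\<^bsub>R\<^esub> b) \<odot>\<^bsub>?V\<^esub> v = a \<odot>\<^bsub>?V\<^esub> (b \<odot>\<^bsub>?V\<^esub> v)"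
      using v by (auto simp: PiE_iff smult_assoc1 intro!: restrict_ext)
  next
    fix v w a assume "a \<in> carrier R" "v \<in> carrier ?V" "w \<in> carrier ?V"
    then show "a \<odot>\<^bsub>?V\<^esub> (v \<oplus>\<^bsub>?V\<^esub> w) = a \<odot>\<^bsub>?V\<^esub> v \<oplus>\<^bsub>?V\<^esub> a \<odot>\<^bsub>?V\<^esub> w"
      by (auto simp: PiE_iff smult_r_distr intro!: restrict_ext)
  qed (use smult in auto)
  ultimately show ?thesis
    by (intro left_module.intro R.ring_axioms)
qed

end

section \<open>Membership in \<sigma>[M] through annihilators\<close>

text \<open>With \<open>F\<close> listed as a tuple in a finite power of \<open>M\<close>, the
  condition says that the cyclic submodule generated by this tuple maps onto Rx, the tuple going to
  x. In contrast to \<open>in_sigma\<close>, no index set and no quotient of a copower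
  enters.\<close>

definition subgenerated :: "('r, 'x) ring_scheme \<Rightarrow> ('r, 'm) module \<Rightarrow> ('r, 'n) module \<Rightarrow> bool"
  where "subgenerated R M N \<longleftrightarrow> left_module R N \<and>
    (\<forall>x\<in>carrier N. \<exists>F. finite F \<and> F \<subseteq> carrier M \<and>
       (\<forall>a\<in>carrier R. (\<forall>m\<in>F. a \<odot>\<^bsub>M\<^esub> m = \<zero>\<^bsub>M\<^esub>) \<longrightarrow> a \<odot>\<^bsub>N\<^esub> x = \<zero>\<^bsub>N\<^esub>))"

lemma subgenerated_left_module: "subgenerated R M N \<Longrightarrow> left_module R N"
  by (simp add: subgenerated_def)

text \<open>Only annihilators matter, so the property passes to every module whose elements are
  killed by whatever kills a suitable element of \<open>N\<close>. Submodules and homomorphic images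
  are the main instances.\<close>

lemma subgenerated_ann:
  assumes "subgenerated R M N" "left_module R N'"
    and "\<And>y. y \<in> carrier N' \<Longrightarrow>
      \<exists>x\<in>carrier N. \<forall>a\<in>carrier R. a \<odot>\<^bsub>N\<^esub> x = \<zero>\<^bsub>N\<^esub> \<longrightarrow> a \<odot>\<^bsub>N'\<^esub> y = \<zero>\<^bsub>N'\<^esub>"
  shows "subgenerated R M N'"
  using assms unfolding subgenerated_def by meson

lemma subgenerated_self: "left_module R M \<Longrightarrow> subgenerated R M M"
  unfolding subgenerated_def by (auto intro!: exI[of _ "{_}"])

text \<open>A finite subset of \<open>K\<close> needs a finite subset of \<open>M\<close> for each
  of its elements, and the union of these is again finite. In terms of categories, \<sigma>[K] lies
  in \<sigma>[M] if K does.\<close>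

lemma subgenerated_trans:
  assumes "subgenerated R M K" "subgenerated R K N"
  shows "subgenerated R M N"
  unfolding subgenerated_def
proof (intro conjI ballI)
  show "left_module R N"
    using assms(2) by (rule subgenerated_left_module)
  fix x assume "x \<in> carrier N"
  then obtain F where F: "finite F" "F \<subseteq> carrier K"
    "\<And>a. \<lbrakk>a \<in> carrier R; \<forall>m\<in>F. a \<odot>\<^bsub>K\<^esub> m = \<zero>\<^bsub>K\<^esub>\<rbrakk> \<Longrightarrow> a \<odot>\<^bsub>N\<^esub> x = \<zero>\<^bsub>N\<^esub>"
    using assms(2) unfolding subgenerated_def by meson
  have "\<forall>y\<in>F. \<exists>G. finite G \<and> G \<subseteq> carrier M \<and>
       (\<forall>a\<in>carrier R. (\<forall>m\<in>G. a \<odot>\<^bsub>M\<^esub> m = \<zero>\<^bsub>M\<^esub>) \<longrightarrow> a \<odot>\<^bsub>K\<^esub> y = \<zero>\<^bsub>K\<^esub>)"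
    using assms(1) F(2) unfolding subgenerated_def by blast
  then obtain G where G: "\<forall>y\<in>F. finite (G y) \<and> G y \<subseteq> carrier M \<and>
       (\<forall>a\<in>carrier R. (\<forall>m\<in>G y. a \<odot>\<^bsub>M\<^esub> m = \<zero>\<^bsub>M\<^esub>) \<longrightarrow> a \<odot>\<^bsub>K\<^esub> y = \<zero>\<^bsub>K\<^esub>)"
    by metis
  show "\<exists>F. finite F \<and> F \<subseteq> carrier M \<and>
       (\<forall>a\<in>carrier R. (\<forall>m\<in>F. a \<odot>\<^bsub>M\<^esub> m = \<zero>\<^bsub>M\<^esub>) \<longrightarrow> a \<odot>\<^bsub>N\<^esub> x = \<zero>\<^bsub>N\<^esub>)"
    by (rule exI[of _ "\<Union>(G ` F)"]) (use F G in auto)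
qed

lemma subgenerated_submodule:
  assumes "subgenerated R M N" "submodule H R N"
  shows "subgenerated R M (N\<lparr>carrier := H\<rparr>)"
proof -
  interpret left_module R N using assms(1) by (rule subgenerated_left_module)
  show ?thesis
    using submoduleD(1)[OF assms(2)]
    by (intro subgenerated_ann[OF assms(1) left_module_submodule[OF assms(2)]]) auto
qed

lemma subgenerated_image:
  assumes "subgenerated R M N" "left_module R N'" "f \<in> lmod_hom R N N'" "f ` carrier N = carrier N'"
  shows "subgenerated R M N'"
proof (rule subgenerated_ann[OF assms(1,2)])
  have N: "left_module R N" using assms(1) by (rule subgenerated_left_module)
  fix y assume "y \<in> carrier N'"
  then obtain x where x: "x \<in> carrier N" "y = f x"
    using assms(4) by blast
  then show "\<exists>x\<in>carrier N. \<forall>a\<in>carrier R. a \<odot>\<^bsub>N\<^esub> x = \<zero>\<^bsub>N\<^esub> \<longrightarrow> a \<odot>\<^bsub>N'\<^esub> y = \<zero>\<^bsub>N'\<^esub>"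
    using lmod_homD(5)[OF assms(3)] lmod_hom_zero[OF N assms(2,3)] by (intro bexI[of _ x]) metis+
qed

text \<open>By transitivity it suffices to work in \<sigma>[N], where the finitely many nonzero
  coordinates of a vector form the required finite set.\<close>

lemma subgenerated_copower:
  assumes "subgenerated R M N"
  shows "subgenerated R M (copower_module I N)"
proof (rule subgenerated_trans[OF assms])
  interpret left_module R N using assms by (rule subgenerated_left_module)
  show "subgenerated R N (copower_module I N)"
    unfolding subgenerated_def
  proof (intro conjI ballI left_module_copower)
    fix v assume v: "v \<in> carrier (copower_module I N)"
    show "\<exists>F. finite F \<and> F \<subseteq> carrier N \<and> (\<forall>a\<in>carrier R. (\<forall>m\<in>F. a \<odot>\<^bsub>N\<^esub> m = \<zero>\<^bsub>N\<^esub>) \<longrightarrow>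
      a \<odot>\<^bsub>copower_module I N\<^esub> v = \<zero>\<^bsub>copower_module I N\<^esub>)"
    proof (intro exI[of _ "v ` {i \<in> I. v i \<noteq> \<zero>\<^bsub>N\<^esub>}"] conjI ballI impI)
      fix a assume "a \<in> carrier R" "\<forall>m\<in>v ` {i \<in> I. v i \<noteq> \<zero>\<^bsub>N\<^esub>}. a \<odot>\<^bsub>N\<^esub> m = \<zero>\<^bsub>N\<^esub>"
      then have "a \<odot>\<^bsub>N\<^esub> v i = \<zero>\<^bsub>N\<^esub>" if "i \<in> I" for i
        using that by (cases "v i = \<zero>\<^bsub>N\<^esub>") auto
      then show "a \<odot>\<^bsub>copower_module I N\<^esub> v = \<zero>\<^bsub>copower_module I N\<^esub>"
        by (auto intro!: restrict_ext)
    qed (use v in auto)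
  qed
qed

text \<open>Each x in \<open>N\<close> is the image of a tuple \<open>e x\<close> from a finite
  power of \<open>M\<close>, so \<open>N\<close> is a quotient of the direct sum of the cyclic
  modules generated by these tuples. That sum is a submodule of a copower of \<open>M\<close>;
  dividing the copower by the kernel of the map onto \<open>N\<close> embeds
  \<open>N\<close>.\<close>

lemma subgenerated_imp_in_sigma:
  fixes N :: "('r, 'n) module"
  assumes "left_module R M" and "subgenerated R M N"
  shows "in_sigma R M N"
proof -
  interpret M: left_module R M by fact
  interpret N: left_module R N using assms(2) by (rule subgenerated_left_module)
  \<comment> \<open>Lists replace finite sets, so that a pair of an element and a position indexes a
    summand. This is the type of index sets in \<open>in_sigma\<close>.\<close>
  have "\<forall>x\<in>carrier N. \<exists>xs. set xs \<subseteq> carrier M \<and>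
      (\<forall>a\<in>carrier R. (\<forall>m\<in>set xs. a \<odot>\<^bsub>M\<^esub> m = \<zero>\<^bsub>M\<^esub>) \<longrightarrow> a \<odot>\<^bsub>N\<^esub> x = \<zero>\<^bsub>N\<^esub>)"
    using assms(2) unfolding subgenerated_def by (metis finite_list)
  then obtain e where e: "\<And>x. x \<in> carrier N \<Longrightarrow> set (e x) \<subseteq> carrier M"
    and ann: "\<And>x a. \<lbrakk>x \<in> carrier N; a \<in> carrier R; \<forall>m\<in>set (e x). a \<odot>\<^bsub>M\<^esub> m = \<zero>\<^bsub>M\<^esub>\<rbrakk> \<Longrightarrow> a \<odot>\<^bsub>N\<^esub> x = \<zero>\<^bsub>N\<^esub>"
    by metis
  define I where "I = {(x, i). x \<in> carrier N \<and> i < length (e x)}"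
  define V where "V = copower_module I M"
  \<comment> \<open>A family \<open>r\<close> of coefficients gives the combination
    \<open>vec r\<close> of the tuples \<open>e x\<close> and the combination \<open>val r\<close>
    of the elements x themselves. \<open>K\<close> collects the vectors whose combination in
    \<open>N\<close> vanishes.\<close>
  define vec where "vec r = (\<lambda>(x, i)\<in>I. r x \<odot>\<^bsub>M\<^esub> (e x ! i))" for r
  define coords where "coords = {r \<in> carrier N \<rightarrow> carrier R. finite {x \<in> carrier N. r x \<noteq> \<zero>\<^bsub>R\<^esub>}}"
  define val where "val r = fsum N (carrier N) (\<lambda>x. r x \<odot>\<^bsub>N\<^esub> x)" for r
  define K where "K = vec ` {r \<in> coords. val r = \<zero>\<^bsub>N\<^esub>}"
  interpret V: left_module R V
    unfolding V_def by (rule M.left_module_copower)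
  have e_mem: "e x ! i \<in> carrier M" if "(x, i) \<in> I" for x i
    using that e nth_mem unfolding I_def by blast
  have N_of_I: "x \<in> carrier N" if "(x, i) \<in> I" for x i
    using that unfolding I_def by blast
  have coordsD: "r x \<in> carrier R" if "r \<in> coords" "x \<in> carrier N" for r x
    using that unfolding coords_def by auto
  have vec_V: "vec r \<in> carrier V" if r: "r \<in> coords" for r
  proof -
    have "{p \<in> I. vec r p \<noteq> \<zero>\<^bsub>M\<^esub>} \<subseteq> Sigma {x \<in> carrier N. r x \<noteq> \<zero>\<^bsub>R\<^esub>} (\<lambda>x. {..<length (e x)})"
      using e_mem by (auto simp: I_def vec_def split: if_splits)
    moreover have "finite (Sigma {x \<in> carrier N. r x \<noteq> \<zero>\<^bsub>R\<^esub>} (\<lambda>x. {..<length (e x)}))"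
      using r unfolding coords_def by (intro finite_SigmaI) auto
    ultimately have "finite {p \<in> I. vec r p \<noteq> \<zero>\<^bsub>M\<^esub>}"
      by (rule finite_subset)
    moreover have "vec r \<in> I \<rightarrow>\<^sub>E carrier M"
      using coordsD[OF r] e_mem N_of_I by (auto simp: vec_def)
    ultimately show ?thesis
      by (simp add: V_def)
  qed
  have fin_val: "finite {x \<in> carrier N. r x \<odot>\<^bsub>N\<^esub> x \<noteq> \<zero>\<^bsub>N\<^esub>}" if "r \<in> coords" for r
    by (rule finite_subset[of _ "{x \<in> carrier N. r x \<noteq> \<zero>\<^bsub>R\<^esub>}"]) (use that in \<open>auto simp: coords_def\<close>)
  have add_coords: "(\<lambda>x. r x \<oplus>\<^bsub>R\<^esub> s x) \<in> coords" if "r \<in> coords" "s \<in> coords" for r s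
  proof -
    have "finite {x \<in> carrier N. r x \<oplus>\<^bsub>R\<^esub> s x \<noteq> \<zero>\<^bsub>R\<^esub>}"
      by (rule finite_subset[of _ "{x \<in> carrier N. r x \<noteq> \<zero>\<^bsub>R\<^esub>} \<union> {x \<in> carrier N. s x \<noteq> \<zero>\<^bsub>R\<^esub>}"])
        (use that in \<open>auto simp: coords_def\<close>)
    then show ?thesis using that by (auto simp: coords_def)
  qed
  have smult_coords: "(\<lambda>x. a \<otimes>\<^bsub>R\<^esub> r x) \<in> coords" if "r \<in> coords" "a \<in> carrier R" for r a
  proof -
    have "finite {x \<in> carrier N. a \<otimes>\<^bsub>R\<^esub> r x \<noteq> \<zero>\<^bsub>R\<^esub>}"
      by (rule finite_subset[of _ "{x \<in> carrier N. r x \<noteq> \<zero>\<^bsub>R\<^esub>}"])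
        (use that in \<open>auto simp: coords_def\<close>)
    then show ?thesis using that by (auto simp: coords_def)
  qed
  have val_add: "val (\<lambda>x. r x \<oplus>\<^bsub>R\<^esub> s x) = val r \<oplus>\<^bsub>N\<^esub> val s" if "r \<in> coords" "s \<in> coords" for r s
  proof -
    have "val (\<lambda>x. r x \<oplus>\<^bsub>R\<^esub> s x) = fsum N (carrier N) (\<lambda>x. r x \<odot>\<^bsub>N\<^esub> x \<oplus>\<^bsub>N\<^esub> s x \<odot>\<^bsub>N\<^esub> x)"
      unfolding val_def using that coordsD by (intro N.fsum_cong) (auto simp: N.smult_l_distr)
    also have "\<dots> = val r \<oplus>\<^bsub>N\<^esub> val s"
      unfolding val_def using that coordsD fin_val by (intro N.fsum_add) auto
    finally show ?thesis .
  qed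
  have val_smult: "val (\<lambda>x. a \<otimes>\<^bsub>R\<^esub> r x) = a \<odot>\<^bsub>N\<^esub> val r" if "r \<in> coords" "a \<in> carrier R" for r a
  proof -
    have "val (\<lambda>x. a \<otimes>\<^bsub>R\<^esub> r x) = fsum N (carrier N) (\<lambda>x. a \<odot>\<^bsub>N\<^esub> (r x \<odot>\<^bsub>N\<^esub> x))"
      unfolding val_def using that coordsD by (intro N.fsum_cong) (auto simp: N.smult_assoc1)
    also have "\<dots> = a \<odot>\<^bsub>N\<^esub> val r"
      unfolding val_def using that coordsD fin_val by (intro N.fsum_smult) auto
    finally show ?thesis .
  qed
  have val_closed: "val r \<in> carrier N" if "r \<in> coords" for r
    unfolding val_def using that coordsD by (intro N.fsum_closed) auto
  have vec_add: "vec (\<lambda>x. r x \<oplus>\<^bsub>R\<^esub> s x) = vec r \<oplus>\<^bsub>V\<^esub> vec s" if "r \<in> coords" "s \<in> coords" for r s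
    using coordsD[OF that(1)] coordsD[OF that(2)] e_mem N_of_I
    by (auto simp: vec_def V_def M.smult_l_distr intro!: restrict_ext)
  have vec_smult: "vec (\<lambda>x. a \<otimes>\<^bsub>R\<^esub> r x) = a \<odot>\<^bsub>V\<^esub> vec r" if "r \<in> coords" "a \<in> carrier R" for r a
    using coordsD[OF that(1)] that(2) e_mem N_of_I
    by (auto simp: vec_def V_def M.smult_assoc1 intro!: restrict_ext)
  \<comment> \<open>If two families give the same vector, their coefficients at x differ by a scalar
    that kills all entries of \<open>e x\<close>, and hence x. So \<open>val\<close> factors through
    \<open>vec\<close>.\<close>
  have well_defined: "val r = val s" if rs: "r \<in> coords" "s \<in> coords" "vec r = vec s" for r s
  proof -
    have "r x \<odot>\<^bsub>N\<^esub> x = s x \<odot>\<^bsub>N\<^esub> x" if x: "x \<in> carrier N" for x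
    proof -
      have R: "r x \<in> carrier R" "s x \<in> carrier R"
        using coordsD rs x by auto
      have "(r x \<ominus>\<^bsub>R\<^esub> s x) \<odot>\<^bsub>M\<^esub> m = \<zero>\<^bsub>M\<^esub>" if m: "m \<in> set (e x)" for m
      proof -
        obtain i where i: "i < length (e x)" "m = e x ! i"
          using m by (auto simp: in_set_conv_nth)
        then have xi: "(x, i) \<in> I"
          using x by (simp add: I_def)
        then have "r x \<odot>\<^bsub>M\<^esub> m = s x \<odot>\<^bsub>M\<^esub> m"
          using fun_cong[OF rs(3), of "(x, i)"] i by (simp add: vec_def)
        then show ?thesis
          using e_mem[OF xi] i R by (simp add: M.smult_l_minus_eq_zero_iff)
      qed
      then have "(r x \<ominus>\<^bsub>R\<^esub> s x) \<odot>\<^bsub>N\<^esub> x = \<zero>\<^bsub>N\<^esub>"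
        using R x by (intro ann) auto
      then show ?thesis
        using R x by (simp add: N.smult_l_minus_eq_zero_iff)
    qed
    then show ?thesis
      unfolding val_def using rs coordsD by (intro N.fsum_cong) auto
  qed
  have K: "submodule K R V"
  proof (rule V.submoduleI)
    have "(\<lambda>x. \<zero>\<^bsub>R\<^esub>) \<in> coords"
      by (auto simp: coords_def)
    moreover have "val (\<lambda>x. \<zero>\<^bsub>R\<^esub>) = \<zero>\<^bsub>N\<^esub>"
      using N.fsum_single by (simp add: val_def fsum_def cong: conj_cong)
    moreover have "vec (\<lambda>x. \<zero>\<^bsub>R\<^esub>) = \<zero>\<^bsub>V\<^esub>"
      using e_mem by (auto simp: vec_def V_def intro!: restrict_ext)
    ultimately show "\<zero>\<^bsub>V\<^esub> \<in> K"
      unfolding K_def by (intro image_eqI[of _ _ "\<lambda>x. \<zero>\<^bsub>R\<^esub>"]) auto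
    show "K \<subseteq> carrier V"
      using vec_V by (auto simp: K_def)
    fix v w assume "v \<in> K" "w \<in> K"
    then obtain r s where rs: "r \<in> coords" "s \<in> coords" "val r = \<zero>\<^bsub>N\<^esub>" "val s = \<zero>\<^bsub>N\<^esub>"
      "v = vec r" "w = vec s"
      unfolding K_def by blast
    then show "v \<oplus>\<^bsub>V\<^esub> w \<in> K"
      unfolding K_def
      by (intro image_eqI[of _ _ "\<lambda>x. r x \<oplus>\<^bsub>R\<^esub> s x"]) (simp_all add: vec_add add_coords val_add)
  next
    fix a v assume a: "a \<in> carrier R" "v \<in> K"
    then obtain r where r: "r \<in> coords" "val r = \<zero>\<^bsub>N\<^esub>" "v = vec r"
      unfolding K_def by blast
    then show "a \<odot>\<^bsub>V\<^esub> v \<in> K"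
      unfolding K_def using a
      by (intro image_eqI[of _ _ "\<lambda>x. a \<otimes>\<^bsub>R\<^esub> r x"]) (simp_all add: vec_smult smult_coords val_smult)
  qed
  have coset_eq: "K +>\<^bsub>V\<^esub> vec r = K +>\<^bsub>V\<^esub> vec s \<longleftrightarrow> val r = val s"
    if rs: "r \<in> coords" "s \<in> coords" for r s
  proof -
    \<comment> \<open>The difference of \<open>r\<close> and \<open>s\<close>, written with the
      scalar -1 so that closure under sums and multiples suffices.\<close>
    define d where "d = (\<lambda>x. r x \<oplus>\<^bsub>R\<^esub> (\<ominus>\<^bsub>R\<^esub> \<one>\<^bsub>R\<^esub>) \<otimes>\<^bsub>R\<^esub> s x)"
    have m1: "\<ominus>\<^bsub>R\<^esub> \<one>\<^bsub>R\<^esub> \<in> carrier R"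
      by simp
    have d: "d \<in> coords"
      unfolding d_def using rs by (intro add_coords smult_coords) auto
    have "val d = val r \<ominus>\<^bsub>N\<^esub> val s"
      using val_add[OF rs(1) smult_coords[OF rs(2) m1]] val_smult[OF rs(2) m1]
        N.smult_neg_one[OF val_closed[OF rs(2)]] by (simp only: d_def N.M.minus_eq)
    moreover have "vec d = vec r \<ominus>\<^bsub>V\<^esub> vec s"
      using vec_add[OF rs(1) smult_coords[OF rs(2) m1]] vec_smult[OF rs(2) m1]
        V.smult_neg_one[OF vec_V[OF rs(2)]] by (simp only: d_def V.M.minus_eq)
    moreover have "vec d \<in> K \<longleftrightarrow> val d = \<zero>\<^bsub>N\<^esub>"
    proof
      assume "vec d \<in> K"
      then obtain s where "s \<in> coords" "val s = \<zero>\<^bsub>N\<^esub>" "vec d = vec s"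
        unfolding K_def by blast
      then show "val d = \<zero>\<^bsub>N\<^esub>"
        using well_defined[OF d] by simp
    qed (use d in \<open>simp add: K_def\<close>)
    ultimately show ?thesis
      using rs by (simp add: V.coset_eq_iff[OF K] vec_V N.minus_eq_zero_iff val_closed)
  qed
  \<comment> \<open>The unit family at x: \<open>vec\<close> turns it into the tuple
    \<open>e x\<close> and \<open>val\<close> into x, so \<open>h\<close> sends x to the coset of
    its tuple.\<close>
  define \<delta> where "\<delta> x = (\<lambda>y. if y = x then \<one>\<^bsub>R\<^esub> else \<zero>\<^bsub>R\<^esub>)" for x :: 'n
  have \<delta>: "\<delta> x \<in> coords" for x
    by (auto simp: \<delta>_def coords_def)
  have val_\<delta>: "val (\<delta> x) = x" if x: "x \<in> carrier N" for x
  proof -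
    have "val (\<delta> x) = fsum N (carrier N) (\<lambda>y. if y = x then x else \<zero>\<^bsub>N\<^esub>)"
      unfolding val_def using x by (intro N.fsum_cong) (auto simp: \<delta>_def)
    then show ?thesis
      using x by (simp add: N.fsum_single)
  qed
  let ?Q = "quotient_module V K"
  note Q = V.quotient_module_simps[OF K]
  define h where "h = (\<lambda>x\<in>carrier N. K +>\<^bsub>V\<^esub> vec (\<delta> x))"
  have "h \<in> lmod_hom R N ?Q"
  proof (rule lmod_homI)
    show "h \<in> carrier N \<rightarrow>\<^sub>E carrier ?Q"
      using vec_V \<delta> by (auto simp: h_def Q(1))
    fix x y assume xy: "x \<in> carrier N" "y \<in> carrier N"
    then have "K +>\<^bsub>V\<^esub> vec (\<delta> (x \<oplus>\<^bsub>N\<^esub> y)) = K +>\<^bsub>V\<^esub> vec (\<lambda>z. \<delta> x z \<oplus>\<^bsub>R\<^esub> \<delta> y z)"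
      by (subst coset_eq) (simp_all add: \<delta> add_coords val_add val_\<delta>)
    then show "h (x \<oplus>\<^bsub>N\<^esub> y) = h x \<oplus>\<^bsub>?Q\<^esub> h y"
      using xy \<delta> by (simp add: h_def vec_add Q(3) vec_V)
  next
    fix a x assume ax: "a \<in> carrier R" "x \<in> carrier N"
    then have "K +>\<^bsub>V\<^esub> vec (\<delta> (a \<odot>\<^bsub>N\<^esub> x)) = K +>\<^bsub>V\<^esub> vec (\<lambda>z. a \<otimes>\<^bsub>R\<^esub> \<delta> x z)"
      by (subst coset_eq) (simp_all add: \<delta> smult_coords val_smult val_\<delta>)
    then show "h (a \<odot>\<^bsub>N\<^esub> x) = a \<odot>\<^bsub>?Q\<^esub> h x"
      using ax \<delta> by (simp add: h_def vec_smult Q(4) vec_V)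
  qed
  moreover have "inj_on h (carrier N)"
    by (rule inj_onI) (simp add: h_def coset_eq \<delta> val_\<delta>)
  ultimately show ?thesis
    unfolding in_sigma_def using K N.left_module_axioms V_def by blast
qed

text \<open>\<open>M\<close> satisfies the annihilator condition, and copowers and quotients inherit
  it. The embedding carries it back to \<open>N\<close>, because a scalar that kills the image of an
  element kills the element.\<close>

lemma in_sigma_imp_subgenerated:
  fixes N :: "('r, 'n) module"
  assumes "left_module R M" and "in_sigma R M N"
  shows "subgenerated R M N"
proof -
  interpret M: left_module R M by fact
  obtain I :: "('n \<times> nat) set" and K h where N: "left_module R N"
    and K: "submodule K R (copower_module I M)"
    and h: "h \<in> lmod_hom R N (quotient_module (copower_module I M) K)" "inj_on h (carrier N)"
    using assms(2) unfolding in_sigma_def by blast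
  let ?V = "copower_module I M"
  interpret V: left_module R ?V by (rule M.left_module_copower)
  let ?Q = "quotient_module ?V K"
  note Q = V.quotient_module_simps[OF K] and LQ = V.left_module_quotient[OF K]
  have "subgenerated R M ?V"
    using assms(1) by (intro subgenerated_copower subgenerated_self)
  moreover have "restrict (\<lambda>v. K +>\<^bsub>?V\<^esub> v) (carrier ?V) \<in> lmod_hom R ?V ?Q"
    by (rule lmod_homI) (use Q in \<open>auto simp del: M.copower_module_simps\<close>)
  ultimately have sg: "subgenerated R M ?Q"
    by (rule subgenerated_image[OF _ LQ]) (simp only: Q(1) image_restrict_eq)
  show ?thesis
  proof (rule subgenerated_ann[OF sg N])
    fix x assume x: "x \<in> carrier N"
    interpret N: left_module R N by fact
    show "\<exists>q\<in>carrier ?Q. \<forall>a\<in>carrier R. a \<odot>\<^bsub>?Q\<^esub> q = \<zero>\<^bsub>?Q\<^esub> \<longrightarrow> a \<odot>\<^bsub>N\<^esub> x = \<zero>\<^bsub>N\<^esub>"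
    proof (intro bexI ballI impI)
      fix a assume a: "a \<in> carrier R" "a \<odot>\<^bsub>?Q\<^esub> h x = \<zero>\<^bsub>?Q\<^esub>"
      then have "h (a \<odot>\<^bsub>N\<^esub> x) = \<zero>\<^bsub>?Q\<^esub>"
        using x lmod_homD(5)[OF h(1)] by metis
      then show "a \<odot>\<^bsub>N\<^esub> x = \<zero>\<^bsub>N\<^esub>"
        using h(2) a x inj_on_lmod_hom_iff[OF N LQ h(1)] by auto
    qed (use lmod_homD(3)[OF h(1) x] in auto)
  qed
qed

lemma in_sigma_iff_subgenerated:
  "left_module R M \<Longrightarrow> in_sigma R M N \<longleftrightarrow> subgenerated R M N"
  using in_sigma_imp_subgenerated subgenerated_imp_in_sigma by blast

section \<open>Lifting homomorphisms along epimorphisms\<close>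

lemma infinite_UNIV_times_lepoll:
  assumes "infinite (UNIV :: 'u set)"
  shows "(UNIV :: ('u \<times> 'u) set) \<lesssim> (UNIV :: 'u set)"
proof -
  obtain f where "bij_betw f (UNIV \<times> UNIV :: ('u \<times> 'u) set) (UNIV :: 'u set)"
    using card_of_Times_same_infinite[OF assms] card_of_ordIso by metis
  then show ?thesis
    unfolding lepoll_def by (auto simp: bij_betw_def)
qed

text \<open>A list is coded by its length paired with the fold of its entries under a pairing
  function. The length is included because the fold is shown to be injective only among lists of
  equal length.\<close>

lemma infinite_UNIV_list_lepoll:
  assumes "infinite (UNIV :: 'u set)"
  shows "(UNIV :: 'u list set) \<lesssim> (UNIV :: 'u set)"
proof -
  obtain p :: "'u \<times> 'u \<Rightarrow> 'u" where p: "inj p"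
    using infinite_UNIV_times_lepoll[OF assms] unfolding lepoll_def by auto
  obtain e :: "nat \<Rightarrow> 'u" where e: "inj e"
    using assms infinite_countable_subset by blast
  define c where "c xs = foldr (\<lambda>x y. p (x, y)) xs (e 0)" for xs
  have "xs = ys" if "length xs = length ys" "c xs = c ys" for xs ys
    using that by (induction xs ys rule: list_induct2) (auto simp: c_def dest: injD[OF p])
  then have "inj (\<lambda>xs. p (e (length xs), c xs))"
    by (intro injI) (auto dest!: injD[OF p] injD[OF e])
  then show ?thesis
    unfolding lepoll_def by blast
qed

lemma Fpow_lepoll:
  assumes "infinite (UNIV :: 'u set)" "A \<lesssim> (UNIV :: 'u set)"
  shows "Fpow A \<lesssim> (UNIV :: 'u set)"
proof -
  have "inj_on (\<lambda>S. SOME xs. set xs = S) (Fpow A)"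
  proof (rule inj_on_inverseI)
    fix S assume "S \<in> Fpow A"
    then have "\<exists>xs. set xs = S"
      unfolding Fpow_def by (auto intro: finite_list)
    then show "set (SOME xs. set xs = S) = S"
      by (rule someI_ex)
  qed
  moreover have "(SOME xs. set xs = S) \<in> lists A" if "S \<in> Fpow A" for S
    using that someI_ex[of "\<lambda>xs. set xs = S"] finite_list[of S] unfolding Fpow_def by auto
  ultimately have "Fpow A \<lesssim> lists A"
    unfolding lepoll_def by (intro exI conjI) auto
  also have "\<dots> \<lesssim> lists (UNIV :: 'u set)"
    by (rule lists_lepoll_mono) fact
  also have "\<dots> \<lesssim> (UNIV :: 'u set)"
    using infinite_UNIV_list_lepoll[OF assms(1)] by simp
  finally show ?thesis .
qed

text \<open>A finitely supported family is determined by its graph over the support, a finite subset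
  of the product of \<open>I\<close> and \<open>carrier M\<close>.\<close>

lemma copower_lepoll:
  assumes "infinite (UNIV :: 'u set)" "I \<lesssim> (UNIV :: 'u set)" "carrier M \<lesssim> (UNIV :: 'u set)"
  shows "carrier (copower_module I M) \<lesssim> (UNIV :: 'u set)"
proof -
  have "I \<times> carrier M \<lesssim> (UNIV :: 'u set)"
    using times_lepoll_mono[OF assms(2,3)] infinite_UNIV_times_lepoll[OF assms(1)]
    by (metis UNIV_Times_UNIV lepoll_trans)
  then have F: "Fpow (I \<times> carrier M) \<lesssim> (UNIV :: 'u set)"
    by (rule Fpow_lepoll[OF assms(1)])
  define G where "G v = (\<lambda>i. (i, v i)) ` {i \<in> I. v i \<noteq> \<zero>\<^bsub>M\<^esub>}" for v
  have "inj_on G (carrier (copower_module I M))"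
  proof (rule inj_onI)
    fix v w assume vw: "v \<in> carrier (copower_module I M)" "w \<in> carrier (copower_module I M)" "G v = G w"
    have G_iff: "(i, x) \<in> G u \<longleftrightarrow> i \<in> I \<and> u i = x \<and> x \<noteq> \<zero>\<^bsub>M\<^esub>" for u i x
      by (auto simp: G_def)
    have eq: "v i = w i" if "i \<in> I" for i
      using G_iff[of i "v i" v] G_iff[of i "w i" w] G_iff[of i "v i" w] G_iff[of i "w i" v] that vw(3)
      by metis
    show "v = w"
      by (rule extensionalityI[of v I w])
        (use vw eq in \<open>auto simp: copower_module_def PiE_def\<close>)
  qed
  moreover have "G ` carrier (copower_module I M) \<subseteq> Fpow (I \<times> carrier M)"
    by (auto simp: G_def Fpow_def copower_module_def)
  ultimately have "carrier (copower_module I M) \<lesssim> Fpow (I \<times> carrier M)"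
    unfolding lepoll_def by blast
  then show ?thesis
    using F by (rule lepoll_trans)
qed

text \<open>This serves both to transport a module into the universe type and to realise a quotient on
  a set of representatives.\<close>

definition push_module :: "('n \<Rightarrow> 'k) \<Rightarrow> ('r, 'n) module \<Rightarrow> ('r, 'k) module"
  where "push_module \<phi> N = (let \<psi> = inv_into (carrier N) \<phi> in
    \<lparr>carrier = \<phi> ` carrier N, mult = undefined, one = undefined, zero = \<phi> \<zero>\<^bsub>N\<^esub>,
     add = (\<lambda>x y. \<phi> (\<psi> x \<oplus>\<^bsub>N\<^esub> \<psi> y)), smult = (\<lambda>a x. \<phi> (a \<odot>\<^bsub>N\<^esub> \<psi> x))\<rparr>)"

text \<open>\<open>\<phi>\<close> may fail to be injective: its fibres only have to be compatible
  with the operations, which makes the preimages chosen by \<open>inv_into\<close>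
  immaterial.\<close>

lemma push_module:
  assumes N: "left_module R N"
    and add: "\<And>x x' y y'. \<lbrakk>x \<in> carrier N; x' \<in> carrier N; y \<in> carrier N; y' \<in> carrier N;
      \<phi> x = \<phi> x'; \<phi> y = \<phi> y'\<rbrakk> \<Longrightarrow> \<phi> (x \<oplus>\<^bsub>N\<^esub> y) = \<phi> (x' \<oplus>\<^bsub>N\<^esub> y')"
    and smult: "\<And>a x x'. \<lbrakk>a \<in> carrier R; x \<in> carrier N; x' \<in> carrier N; \<phi> x = \<phi> x'\<rbrakk> \<Longrightarrow>
      \<phi> (a \<odot>\<^bsub>N\<^esub> x) = \<phi> (a \<odot>\<^bsub>N\<^esub> x')"
  shows "carrier (push_module \<phi> N) = \<phi> ` carrier N"
    and "\<zero>\<^bsub>push_module \<phi> N\<^esub> = \<phi> \<zero>\<^bsub>N\<^esub>"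
    and "left_module R (push_module \<phi> N)"
    and "restrict \<phi> (carrier N) \<in> lmod_hom R N (push_module \<phi> N)"
proof -
  interpret left_module R N by fact
  let ?Q = "push_module \<phi> N"
  let ?\<psi> = "inv_into (carrier N) \<phi>"
  have \<psi>: "?\<psi> (\<phi> x) \<in> carrier N" "\<phi> (?\<psi> (\<phi> x)) = \<phi> x" if "x \<in> carrier N" for x
    using that by (auto intro: inv_into_into f_inv_into_f)
  show c: "carrier ?Q = \<phi> ` carrier N" and z: "\<zero>\<^bsub>?Q\<^esub> = \<phi> \<zero>\<^bsub>N\<^esub>"
    by (simp_all add: push_module_def Let_def)
  have a: "\<phi> (x \<oplus>\<^bsub>N\<^esub> y) = \<phi> x \<oplus>\<^bsub>?Q\<^esub> \<phi> y" if "x \<in> carrier N" "y \<in> carrier N" for x y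
    using that add[of x "?\<psi> (\<phi> x)" y "?\<psi> (\<phi> y)"] \<psi> by (simp add: push_module_def Let_def)
  have s: "\<phi> (a \<odot>\<^bsub>N\<^esub> x) = a \<odot>\<^bsub>?Q\<^esub> \<phi> x" if "a \<in> carrier R" "x \<in> carrier N" for a x
    using that smult[of a x "?\<psi> (\<phi> x)"] \<psi> by (simp add: push_module_def Let_def)
  show "left_module R ?Q"
    by (rule left_module_image[OF N, of \<phi>]) (use a s c z in auto)
  show "restrict \<phi> (carrier N) \<in> lmod_hom R N ?Q"
    by (rule lmod_homI) (use a s c in auto)
qed

lemma push_module_inj:
  assumes N: "left_module R N" and inj: "inj_on \<phi> (carrier N)"
  shows "carrier (push_module \<phi> N) = \<phi> ` carrier N"
    and "\<zero>\<^bsub>push_module \<phi> N\<^esub> = \<phi> \<zero>\<^bsub>N\<^esub>"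
    and "left_module R (push_module \<phi> N)"
    and "restrict \<phi> (carrier N) \<in> lmod_hom R N (push_module \<phi> N)"
proof -
  interpret left_module R N by fact
  note * = push_module[OF N, of \<phi>]
  show "carrier (push_module \<phi> N) = \<phi> ` carrier N" "\<zero>\<^bsub>push_module \<phi> N\<^esub> = \<phi> \<zero>\<^bsub>N\<^esub>"
    "left_module R (push_module \<phi> N)" "restrict \<phi> (carrier N) \<in> lmod_hom R N (push_module \<phi> N)"
    by (rule *; use inj_onD[OF inj] in blast)+
qed

lemma inv_lmod_hom:
  assumes N: "left_module R N" and f: "f \<in> lmod_hom R N N'" "inj_on f (carrier N)"
    "f ` carrier N = carrier N'"
  shows "restrict (inv_into (carrier N) f) (carrier N') \<in> lmod_hom R N' N"
proof -
  interpret left_module R N by fact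
  note F = lmod_homD[OF f(1)]
  show ?thesis
  proof (rule lmod_homI)
    fix x y assume "x \<in> carrier N'" "y \<in> carrier N'"
    then obtain x' y' where "x' \<in> carrier N" "y' \<in> carrier N" "x = f x'" "y = f y'"
      using f(3) by (metis imageE)
    then show "restrict (inv_into (carrier N) f) (carrier N') (x \<oplus>\<^bsub>N'\<^esub> y) =
        restrict (inv_into (carrier N) f) (carrier N') x \<oplus>\<^bsub>N\<^esub> restrict (inv_into (carrier N) f) (carrier N') y"
      using F f(2) by (simp flip: F(4))
  next
    fix a y assume "a \<in> carrier R" "y \<in> carrier N'"
    then obtain y' where "y' \<in> carrier N" "y = f y'" "a \<in> carrier R"
      using f(3) by (metis imageE)
    then show "restrict (inv_into (carrier N) f) (carrier N') (a \<odot>\<^bsub>N'\<^esub> y) =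
        a \<odot>\<^bsub>N\<^esub> restrict (inv_into (carrier N) f) (carrier N') y"
      using F f(2) by (simp flip: F(5))
  qed (use f in \<open>auto intro: inv_into_into\<close>)
qed

text \<open>Two scalars with the same effect on \<open>u\<close> differ by one that annihilates
  \<open>u\<close>, hence also \<open>z\<close>, so sending a u to a z is well defined.\<close>

lemma cyclic_hom:
  assumes Y: "left_module R Y" "u \<in> carrier Y" and X: "left_module R X" "z \<in> carrier X"
    and ann: "\<And>a. \<lbrakk>a \<in> carrier R; a \<odot>\<^bsub>Y\<^esub> u = \<zero>\<^bsub>Y\<^esub>\<rbrakk> \<Longrightarrow> a \<odot>\<^bsub>X\<^esub> z = \<zero>\<^bsub>X\<^esub>"
  shows "\<exists>f\<in>lmod_hom R (Y\<lparr>carrier := cyclic_submodule R Y u\<rparr>) (X\<lparr>carrier := cyclic_submodule R X z\<rparr>).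
    \<forall>a\<in>carrier R. f (a \<odot>\<^bsub>Y\<^esub> u) = a \<odot>\<^bsub>X\<^esub> z"
proof -
  interpret Y: left_module R Y by fact
  interpret X: left_module R X by fact
  let ?Ru = "cyclic_submodule R Y u" and ?Rz = "cyclic_submodule R X z"
  have ann2: "a \<odot>\<^bsub>X\<^esub> z = b \<odot>\<^bsub>X\<^esub> z"
    if "a \<in> carrier R" "b \<in> carrier R" "a \<odot>\<^bsub>Y\<^esub> u = b \<odot>\<^bsub>Y\<^esub> u" for a b
    using that ann[of "a \<ominus>\<^bsub>R\<^esub> b"] Y(2) X(2)
    by (simp add: Y.smult_l_minus_eq_zero_iff X.smult_l_minus_eq_zero_iff)
  define f where "f = (\<lambda>y\<in>?Ru. (SOME a. a \<in> carrier R \<and> y = a \<odot>\<^bsub>Y\<^esub> u) \<odot>\<^bsub>X\<^esub> z)"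
  have f: "f (a \<odot>\<^bsub>Y\<^esub> u) = a \<odot>\<^bsub>X\<^esub> z" if a: "a \<in> carrier R" for a
  proof -
    let ?b = "SOME b. b \<in> carrier R \<and> a \<odot>\<^bsub>Y\<^esub> u = b \<odot>\<^bsub>Y\<^esub> u"
    have "?b \<in> carrier R \<and> a \<odot>\<^bsub>Y\<^esub> u = ?b \<odot>\<^bsub>Y\<^esub> u"
      by (rule someI[of _ a]) (use a in simp)
    then have "a \<odot>\<^bsub>X\<^esub> z = ?b \<odot>\<^bsub>X\<^esub> z"
      using a by (intro ann2) auto
    then show ?thesis
      using a by (auto simp: f_def)
  qed
  have f_hom: "f \<in> lmod_hom R (Y\<lparr>carrier := ?Ru\<rparr>) (X\<lparr>carrier := ?Rz\<rparr>)"
  proof (rule lmod_homI)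
    show "f \<in> carrier (Y\<lparr>carrier := ?Ru\<rparr>) \<rightarrow>\<^sub>E carrier (X\<lparr>carrier := ?Rz\<rparr>)"
      using f by (auto simp: f_def)
  next
    fix x y assume "x \<in> carrier (Y\<lparr>carrier := ?Ru\<rparr>)" "y \<in> carrier (Y\<lparr>carrier := ?Ru\<rparr>)"
    then obtain a b where "a \<in> carrier R" "b \<in> carrier R" "x = a \<odot>\<^bsub>Y\<^esub> u" "y = b \<odot>\<^bsub>Y\<^esub> u"
      by auto
    then show "f (x \<oplus>\<^bsub>Y\<lparr>carrier := ?Ru\<rparr>\<^esub> y) = f x \<oplus>\<^bsub>X\<lparr>carrier := ?Rz\<rparr>\<^esub> f y"
      using f Y(2) X(2) by (simp flip: Y.smult_l_distr X.smult_l_distr)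
  next
    fix a x assume "a \<in> carrier R" "x \<in> carrier (Y\<lparr>carrier := ?Ru\<rparr>)"
    then obtain b where "a \<in> carrier R" "b \<in> carrier R" "x = b \<odot>\<^bsub>Y\<^esub> u"
      by auto
    then show "f (a \<odot>\<^bsub>Y\<lparr>carrier := ?Ru\<rparr>\<^esub> x) = a \<odot>\<^bsub>X\<lparr>carrier := ?Rz\<rparr>\<^esub> f x"
      using f Y(2) X(2) by (simp flip: Y.smult_assoc1 X.smult_assoc1)
  qed
  with f show ?thesis
    by blast
qed

text \<open>The cardinal bounds ensure that the cyclic modules and copowers to which projectivity
  and generation get applied have copies with carrier in \<open>'u\<close>.\<close>

locale projective_module = left_module R M
  for R :: "('r, 'x) ring_scheme" (structure) and M :: "('r, 'm) module" (structure) +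
  fixes U :: "'u itself"
  assumes infinite_U: "infinite (UNIV :: 'u set)"
    and R_lepoll: "carrier R \<lesssim> (UNIV :: 'u set)"
    and M_lepoll: "carrier M \<lesssim> (UNIV :: 'u set)"
    and projective: "projective_in_sigma U R M"
begin

text \<open>Projectivity speaks only of modules carried by \<open>'u\<close>, whereas
  \<open>B\<close> and \<open>C\<close> may have any type. Both are copied into \<open>'u\<close>,
  the map is lifted between the copies, and the lift is carried back.\<close>

lemma lift:
  assumes B: "subgenerated R M B" "carrier B \<lesssim> (UNIV :: 'u set)" and C: "left_module R C"
    and g: "g \<in> lmod_hom R B C" "g ` carrier B = carrier C" and h: "h \<in> lmod_hom R M C"
  shows "\<exists>k\<in>lmod_hom R M B. \<forall>m\<in>carrier M. g (k m) = h m"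
proof -
  have LB: "left_module R B"
    using B(1) by (rule subgenerated_left_module)
  obtain \<phi> :: "_ \<Rightarrow> 'u" where \<phi>: "inj_on \<phi> (carrier B)"
    using B(2) unfolding lepoll_def by blast
  have "carrier C \<lesssim> (UNIV :: 'u set)"
    using B(2) g(2) image_lepoll[of g "carrier B"] lepoll_trans by metis
  then obtain \<chi> :: "_ \<Rightarrow> 'u" where \<chi>: "inj_on \<chi> (carrier C)"
    unfolding lepoll_def by blast
  let ?B = "push_module \<phi> B" and ?C = "push_module \<chi> C"
  note pB = push_module_inj[OF LB \<phi>] and pC = push_module_inj[OF C \<chi>]
  define \<phi>i where "\<phi>i = restrict (inv_into (carrier B) (restrict \<phi> (carrier B))) (carrier ?B)"
  have \<phi>i: "\<phi>i \<in> lmod_hom R ?B B"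
    unfolding \<phi>i_def by (rule inv_lmod_hom[OF LB pB(4)]) (use \<phi> pB(1) in \<open>auto simp: inj_on_def\<close>)
  have \<phi>i_\<phi>: "\<phi>i (\<phi> b) = b" if "b \<in> carrier B" for b
  proof -
    have "inv_into (carrier B) (restrict \<phi> (carrier B)) (restrict \<phi> (carrier B) b) = b"
      using \<phi> that by (intro inv_into_f_f) (auto simp: inj_on_def)
    then show ?thesis
      using that by (simp add: \<phi>i_def pB(1))
  qed
  define g' where "g' = compose (carrier ?B) (compose (carrier B) (restrict \<chi> (carrier C)) g) \<phi>i"
  have g': "g' \<in> lmod_hom R ?B ?C"
    unfolding g'_def by (rule compose_lmod_hom[OF pB(3) \<phi>i compose_lmod_hom[OF LB g(1) pC(4)]])
  have g'_\<phi>: "g' (\<phi> b) = \<chi> (g b)" if "b \<in> carrier B" for b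
    using that \<phi>i_\<phi> pB(1) lmod_homD(3)[OF g(1)] by (simp add: g'_def compose_def)
  have sB: "subgenerated R M ?B"
    using pB by (intro subgenerated_image[OF B(1) _ pB(4)]) auto
  have im_g': "g' ` carrier ?B = carrier ?C"
  proof -
    have "g' ` carrier ?B = (\<lambda>b. g' (\<phi> b)) ` carrier B"
      by (simp add: pB(1) image_image)
    also have "\<dots> = \<chi> ` g ` carrier B"
      using g'_\<phi> by (simp add: image_image)
    finally show ?thesis
      by (simp add: g(2) pC(1))
  qed
  have sC: "subgenerated R M ?C"
    by (rule subgenerated_image[OF sB pC(3) g' im_g'])
  \<comment> \<open>The kernel completes the transported epimorphism to a short exact sequence, to
    which \<open>projective\<close> applies.\<close>
  define A where "A = {b \<in> carrier ?B. g' b = \<zero>\<^bsub>?C\<^esub>}"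
  interpret B': left_module R ?B by (rule pB(3))
  interpret C': left_module R ?C by (rule pC(3))
  have A: "submodule A R ?B"
    using submodule_vimage[OF pB(3) pC(3) C'.submodule_zero g'] by (simp add: A_def)
  let ?A = "?B\<lparr>carrier := A\<rparr>"
  have "restrict (\<lambda>x. x) A \<in> lmod_hom R ?A ?B"
    using B'.submoduleD[OF A] by (intro lmod_homI) auto
  then have "short_exact R ?A ?B ?C (restrict (\<lambda>x. x) A) g'"
    unfolding short_exact_def using g' im_g' by (auto simp: A_def inj_on_def)
  moreover have "subgenerated R M ?A"
    by (rule subgenerated_submodule[OF sB A])
  ultimately have *: "compose (carrier M) g' ` lmod_hom R M ?B = lmod_hom R M ?C"
    using projective sB sC unfolding projective_in_sigma_def
    by (simp add: in_sigma_iff_subgenerated[OF left_module_axioms])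
  have "compose (carrier M) (restrict \<chi> (carrier C)) h \<in> lmod_hom R M ?C"
    by (rule compose_lmod_hom[OF left_module_axioms h pC(4)])
  then obtain k where k: "k \<in> lmod_hom R M ?B"
    "compose (carrier M) (restrict \<chi> (carrier C)) h = compose (carrier M) g' k"
    using * by (metis (no_types, lifting) imageE)
  have "g (\<phi>i (k m)) = h m" if m: "m \<in> carrier M" for m
  proof -
    obtain b where b: "b \<in> carrier B" "k m = \<phi> b"
      using lmod_homD(3)[OF k(1) m] pB(1) by auto
    have "\<chi> (h m) = \<chi> (g b)"
      using fun_cong[OF k(2), of m] m b lmod_homD(3)[OF h m] by (simp add: compose_def g'_\<phi>)
    then have "h m = g b"
      using \<chi> lmod_homD(3)[OF h m] lmod_homD(3)[OF g(1) b(1)] by (auto dest: inj_onD)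
    then show ?thesis
      using b by (simp add: \<phi>i_\<phi>)
  qed
  moreover have "compose (carrier M) \<phi>i k \<in> lmod_hom R M B"
    by (rule compose_lmod_hom[OF left_module_axioms k(1) \<phi>i])
  ultimately show ?thesis
    by (intro bexI[of _ "compose (carrier M) \<phi>i k"]) (auto simp: compose_def)
qed

text \<open>The condition on annihilators gives an epimorphism from Ru onto Rz taking
  \<open>u\<close> to \<open>z\<close>, and \<open>h\<close> lifts through it. The last clause
  tracks coefficients: a scalar that expresses \<open>g m\<close> through \<open>u\<close> also
  expresses \<open>h m\<close> through \<open>z\<close>.\<close>

lemma lift_cyclic:
  assumes Y: "subgenerated R M Y" "u \<in> carrier Y" and X: "left_module R X" "z \<in> carrier X"
    and ann: "\<And>a. \<lbrakk>a \<in> carrier R; a \<odot>\<^bsub>Y\<^esub> u = \<zero>\<^bsub>Y\<^esub>\<rbrakk> \<Longrightarrow> a \<odot>\<^bsub>X\<^esub> z = \<zero>\<^bsub>X\<^esub>"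
    and h: "h \<in> lmod_hom R M X" "h ` carrier M \<subseteq> cyclic_submodule R X z"
  shows "\<exists>g\<in>lmod_hom R M Y. g ` carrier M \<subseteq> cyclic_submodule R Y u \<and>
    (\<forall>m\<in>carrier M. \<forall>a\<in>carrier R. g m = a \<odot>\<^bsub>Y\<^esub> u \<longrightarrow> h m = a \<odot>\<^bsub>X\<^esub> z)"
proof -
  interpret Y: left_module R Y using Y(1) by (rule subgenerated_left_module)
  interpret X: left_module R X by fact
  let ?Ru = "cyclic_submodule R Y u" and ?Rz = "cyclic_submodule R X z"
  note Ru = Y.submodule_cyclic[OF Y(2)] and Rz = X.submodule_cyclic[OF X(2)]
  obtain f where f_hom: "f \<in> lmod_hom R (Y\<lparr>carrier := ?Ru\<rparr>) (X\<lparr>carrier := ?Rz\<rparr>)"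
    and f: "\<And>a. a \<in> carrier R \<Longrightarrow> f (a \<odot>\<^bsub>Y\<^esub> u) = a \<odot>\<^bsub>X\<^esub> z"
    using cyclic_hom[OF Y.left_module_axioms Y(2) X ann] by blast
  have "f ` carrier (Y\<lparr>carrier := ?Ru\<rparr>) = carrier (X\<lparr>carrier := ?Rz\<rparr>)"
    using f by (simp add: image_image)
  moreover have "carrier (Y\<lparr>carrier := ?Ru\<rparr>) \<lesssim> (UNIV :: 'u set)"
    using R_lepoll image_lepoll lepoll_trans by fastforce
  moreover have "h \<in> lmod_hom R M (X\<lparr>carrier := ?Rz\<rparr>)"
    using h X.submoduleD(1)[OF Rz] by (simp add: lmod_hom_carrier_update)
  ultimately have "\<exists>g\<in>lmod_hom R M (Y\<lparr>carrier := ?Ru\<rparr>). \<forall>m\<in>carrier M. f (g m) = h m"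
    by (intro lift[OF subgenerated_submodule[OF Y(1) Ru] _ X.left_module_submodule[OF Rz] f_hom])
  then obtain g where g: "g \<in> lmod_hom R M (Y\<lparr>carrier := ?Ru\<rparr>)"
    "\<And>m. m \<in> carrier M \<Longrightarrow> f (g m) = h m"
    by blast
  have "g \<in> lmod_hom R M Y" "g ` carrier M \<subseteq> ?Ru"
    using g(1) unfolding lmod_hom_carrier_update[OF Y.submoduleD(1)[OF Ru]] by blast+
  moreover have "h m = a \<odot>\<^bsub>X\<^esub> z" if "m \<in> carrier M" "a \<in> carrier R" "g m = a \<odot>\<^bsub>Y\<^esub> u" for m a
    using g(2)[OF that(1)] f[OF that(2)] that(3) by simp
  ultimately show ?thesis
    by (intro bexI[of _ g] conjI ballI impI)
qed

end

section \<open>Prime submodules\<close>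

context left_module
begin

text \<open>A sum lies in the submodule \<open>Q\<close> as soon as its summands do, and every
  summand lies in the sum. Products are thereby replaced by conditions on single
  endomorphisms.\<close>

lemma submodule_prod_subset_iff:
  assumes "N \<subseteq> carrier M" "K \<subseteq> carrier M" "submodule Q R M"
  shows "submodule_prod R M N K \<subseteq> Q \<longleftrightarrow>
    (\<forall>f\<in>lmod_hom R M M. f ` carrier M \<subseteq> K \<longrightarrow> f ` N \<subseteq> Q)" (is "?L \<longleftrightarrow> ?R")
proof
  assume L: ?L
  show ?R
  proof (intro ballI impI subsetI)
    fix f y assume f: "f \<in> lmod_hom R M M" "f ` carrier M \<subseteq> K" and "y \<in> f ` N"
    then have "y \<in> carrier M"
      using assms by auto
    then have "y = finsum M (\<lambda>_. y) {f ` N}"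
      by simp
    then have "y \<in> submodule_prod R M N K"
      unfolding submodule_prod_def sum_of_submodules_def lmod_hom_carrier_update[OF assms(2)]
      using f \<open>y \<in> f ` N\<close> by (intro CollectI exI[of _ "{f ` N}"] exI[of _ "\<lambda>_. y"]) auto
    then show "y \<in> Q"
      using L by blast
  qed
next
  assume R: ?R
  show ?L
    unfolding submodule_prod_def sum_of_submodules_def lmod_hom_carrier_update[OF assms(2)]
  proof safe
    fix \<F> c
    assume "\<F> \<subseteq> {f ` N |f. f \<in> lmod_hom R M M \<and> f ` carrier M \<subseteq> K}" "\<forall>N\<in>\<F>. c N \<in> N"
    then have "c X \<in> Q" if "X \<in> \<F>" for X
      using R that by blast
    then show "finsum M c \<F> \<in> Q"
      by (rule submodule_finsum[OF assms(3)])
  qed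
qed

lemma zero_mem_submodule_prod: "\<zero>\<^bsub>M\<^esub> \<in> submodule_prod R M N K"
  unfolding submodule_prod_def sum_of_submodules_def
  by (intro CollectI exI[of _ "{}"] exI[of _ undefined]) simp

lemma fully_invariantD:
  assumes "fully_invariant R M N"
  shows "submodule N R M" "N \<subseteq> carrier M" "\<And>f x. \<lbrakk>f \<in> lmod_hom R M M; x \<in> N\<rbrakk> \<Longrightarrow> f x \<in> N"
  using assms submoduleD(1) unfolding fully_invariant_def by blast+

lemma prime_inD:
  assumes "prime_in R M P"
  shows "fully_invariant R M P" "P \<noteq> carrier M" "submodule P R M"
    and "\<And>N K. \<lbrakk>fully_invariant R M N; fully_invariant R M K;
      \<And>f x. \<lbrakk>f \<in> lmod_hom R M M; f ` carrier M \<subseteq> K; x \<in> N\<rbrakk> \<Longrightarrow> f x \<in> P\<rbrakk> \<Longrightarrow> N \<subseteq> P \<or> K \<subseteq> P"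
proof -
  show P: "fully_invariant R M P" "P \<noteq> carrier M" "submodule P R M"
    using assms unfolding prime_in_def fully_invariant_def by auto
  fix N K assume NK: "fully_invariant R M N" "fully_invariant R M K"
    "\<And>f x. \<lbrakk>f \<in> lmod_hom R M M; f ` carrier M \<subseteq> K; x \<in> N\<rbrakk> \<Longrightarrow> f x \<in> P"
  then have "submodule_prod R M N K \<subseteq> P"
    using submodule_prod_subset_iff[of N K P] P(3) fully_invariantD(2) by blast
  then show "N \<subseteq> P \<or> K \<subseteq> P"
    using assms NK(1,2) unfolding prime_in_def by blast
qed

lemma prime_inI:
  assumes P: "fully_invariant R M P" "P \<noteq> carrier M"
    and "\<And>N K. \<lbrakk>fully_invariant R M N; fully_invariant R M K;
      \<And>f x. \<lbrakk>f \<in> lmod_hom R M M; f ` carrier M \<subseteq> K; x \<in> N\<rbrakk> \<Longrightarrow> f x \<in> P\<rbrakk> \<Longrightarrow> N \<subseteq> P \<or> K \<subseteq> P"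
  shows "prime_in R M P"
  unfolding prime_in_def
proof (intro conjI allI impI)
  fix N K assume *: "fully_invariant R M N \<and> fully_invariant R M K \<and> submodule_prod R M N K \<subseteq> P"
  then have "\<forall>f\<in>lmod_hom R M M. f ` carrier M \<subseteq> K \<longrightarrow> f ` N \<subseteq> P"
    using submodule_prod_subset_iff[of N K P] P(1) fully_invariantD(1,2) by blast
  with * show "N \<subseteq> P \<or> K \<subseteq> P"
    by (intro assms(3)) auto
qed fact+

lemma fully_invariant_zero: "fully_invariant R M {\<zero>\<^bsub>M\<^esub>}"
  unfolding fully_invariant_def
  using submodule_zero lmod_hom_zero[OF left_module_axioms left_module_axioms] by auto

text \<open>Intersecting with \<open>carrier M\<close> makes the empty family yield \<open>M\<close>
  itself, as is wanted when there is only one minimal prime.\<close>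

lemma fully_invariant_Inter:
  assumes "\<And>N. N \<in> \<N> \<Longrightarrow> fully_invariant R M N"
  shows "fully_invariant R M (carrier M \<inter> \<Inter>\<N>)"
  unfolding fully_invariant_def
proof (intro conjI ballI)
  show "submodule (carrier M \<inter> \<Inter>\<N>) R M"
    using submoduleD[OF fully_invariantD(1)[OF assms]] by (intro submoduleI) auto
  show "f ` (carrier M \<inter> \<Inter>\<N>) \<subseteq> carrier M \<inter> \<Inter>\<N>" if "f \<in> lmod_hom R M M" for f
    using that fully_invariantD(3)[OF assms] lmod_homD(3)[OF that] by auto
qed

lemma fully_invariant_Union_chain:
  assumes "\<N> \<noteq> {}" "\<And>N. N \<in> \<N> \<Longrightarrow> fully_invariant R M N"
    and chain: "\<And>N K. \<lbrakk>N \<in> \<N>; K \<in> \<N>\<rbrakk> \<Longrightarrow> N \<subseteq> K \<or> K \<subseteq> N"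
  shows "fully_invariant R M (\<Union>\<N>)"
  unfolding fully_invariant_def
proof (intro conjI ballI)
  note N = submoduleD[OF fully_invariantD(1)[OF assms(2)]]
  show "submodule (\<Union>\<N>) R M"
  proof (rule submoduleI)
    show "\<Union>\<N> \<subseteq> carrier M" "\<zero>\<^bsub>M\<^esub> \<in> \<Union>\<N>"
      using N assms(1) by auto
    fix x y assume "x \<in> \<Union>\<N>" "y \<in> \<Union>\<N>"
    then obtain N1 N2 where "N1 \<in> \<N>" "x \<in> N1" "N2 \<in> \<N>" "y \<in> N2"
      by blast
    then obtain N where "N \<in> \<N>" "x \<in> N" "y \<in> N"
      using chain[of N1 N2] by blast
    then show "x \<oplus>\<^bsub>M\<^esub> y \<in> \<Union>\<N>"
      using N(4) by blast
  next
    show "a \<odot>\<^bsub>M\<^esub> x \<in> \<Union>\<N>" if "a \<in> carrier R" "x \<in> \<Union>\<N>" for a x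
      using that N(5) by blast
  qed
  show "f ` \<Union>\<N> \<subseteq> \<Union>\<N>" if "f \<in> lmod_hom R M M" for f
    using that fully_invariantD(3)[OF assms(2)] by auto
qed

text \<open>If \<open>M\<close> is projective in \<open>\<sigma>[M]\<close>, this is the largest submodule \<open>T\<close> with \<open>J\<^sub>M T \<subseteq> Q\<close>.\<close>

definition transporter :: "'m set \<Rightarrow> 'm set \<Rightarrow> 'm set"
  where "transporter J Q =
    {x \<in> carrier M. \<forall>g\<in>lmod_hom R M M. g ` carrier M \<subseteq> cyclic_submodule R M x \<longrightarrow> g ` J \<subseteq> Q}"

text \<open>The submodule \<open>H\<close> contains Rx, so maps into Rx are among the maps into
  \<open>H\<close>.\<close>

lemma transporterI:
  assumes "x \<in> H" "submodule H R M"
    and "\<And>g j. \<lbrakk>g \<in> lmod_hom R M M; g ` carrier M \<subseteq> H; j \<in> J\<rbrakk> \<Longrightarrow> g j \<in> Q"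
  shows "x \<in> transporter J Q"
proof -
  have "cyclic_submodule R M x \<subseteq> H"
    using submoduleD(5)[OF assms(2) _ assms(1)] by auto
  then have "g ` J \<subseteq> Q"
    if "g \<in> lmod_hom R M M" "g ` carrier M \<subseteq> cyclic_submodule R M x" for g
    using assms(3)[OF that(1)] order_trans[OF that(2)] by (simp add: image_subset_iff)
  then show ?thesis
    using submoduleD(2)[OF assms(2,1)] by (simp add: transporter_def)
qed

text \<open>The counterpart of the two-sided ideal generated by an element.\<close>

definition fi_span :: "'m \<Rightarrow> 'm set"
  where "fi_span x = carrier M \<inter> \<Inter>{N. fully_invariant R M N \<and> x \<in> N}"

lemma fully_invariant_fi_span: "fully_invariant R M (fi_span x)"
  unfolding fi_span_def by (rule fully_invariant_Inter) auto

lemma mem_fi_span: "x \<in> carrier M \<Longrightarrow> x \<in> fi_span x"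
  by (auto simp: fi_span_def)

lemma fi_span_subset: "\<lbrakk>fully_invariant R M N; x \<in> N\<rbrakk> \<Longrightarrow> fi_span x \<subseteq> N"
  by (auto simp: fi_span_def)

section \<open>Minimal primes\<close>

text \<open>The intersection of a nonempty chain of primes is prime: if it contains neither of two
  submodules, then the smaller of two suitable members of the chain already contains neither. Zorn's
  lemma then applies.\<close>

lemma minimal_prime_below:
  assumes "prime_in R M P0"
  shows "\<exists>P\<in>minimal_primes_in R M. P \<subseteq> P0"
proof -
  \<comment> \<open>Complements reverse inclusion, so that Zorn's lemma for unions of chains
    produces a minimal element.\<close>
  define \<A> where "\<A> = uminus ` {P. prime_in R M P \<and> P \<subseteq> P0}"
  have "\<exists>X\<in>\<A>. \<forall>Y\<in>\<A>. X \<subseteq> Y \<longrightarrow> Y = X"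
  proof (rule subset_Zorn_nonempty)
    show "\<A> \<noteq> {}"
      using assms by (auto simp: \<A>_def)
    fix \<C> assume C: "\<C> \<noteq> {}" "subset.chain \<A> \<C>"
    define \<D> where "\<D> = uminus ` \<C>"
    have D: "prime_in R M D" "D \<subseteq> P0" if "D \<in> \<D>" for D
      using that C(2) by (auto simp: \<D>_def \<A>_def subset_chain_def)
    have chain: "D \<subseteq> D' \<or> D' \<subseteq> D" if "D \<in> \<D>" "D' \<in> \<D>" for D D'
      using that C(2) by (auto simp: \<D>_def subset_chain_def)
    obtain D0 where D0: "D0 \<in> \<D>"
      using C(1) by (auto simp: \<D>_def)
    have sub: "D0 \<subseteq> carrier M"
      by (rule fully_invariantD(2)[OF prime_inD(1)[OF D(1)[OF D0]]])
    have "prime_in R M (\<Inter>\<D>)"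
    proof (rule prime_inI)
      have "\<Inter>\<D> = carrier M \<inter> \<Inter>\<D>"
        using D0 sub by blast
      also have "fully_invariant R M \<dots>"
        using prime_inD(1)[OF D(1)] by (rule fully_invariant_Inter)
      finally show "fully_invariant R M (\<Inter>\<D>)" .
      show "\<Inter>\<D> \<noteq> carrier M"
        using D0 sub prime_inD(2)[OF D(1)[OF D0]] by blast
      fix N K assume NK: "fully_invariant R M N" "fully_invariant R M K"
        "\<And>f x. \<lbrakk>f \<in> lmod_hom R M M; f ` carrier M \<subseteq> K; x \<in> N\<rbrakk> \<Longrightarrow> f x \<in> \<Inter>\<D>"
      show "N \<subseteq> \<Inter>\<D> \<or> K \<subseteq> \<Inter>\<D>"
      proof (rule ccontr)
        assume "\<not> ?thesis"
        then obtain D1 D2 where "D1 \<in> \<D>" "\<not> N \<subseteq> D1" "D2 \<in> \<D>" "\<not> K \<subseteq> D2"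
          by blast
        then obtain D where "D \<in> \<D>" "\<not> N \<subseteq> D" "\<not> K \<subseteq> D"
          using chain[of D1 D2] by blast
        moreover have "N \<subseteq> D \<or> K \<subseteq> D"
          using NK \<open>D \<in> \<D>\<close> by (intro prime_inD(4)[OF D(1)]) auto
        ultimately show False
          by blast
      qed
    qed
    moreover have "\<Inter>\<D> \<subseteq> P0"
      using D0 D(2) by blast
    moreover have "\<Union>\<C> = - \<Inter>\<D>"
      by (auto simp: \<D>_def)
    ultimately show "\<Union>\<C> \<in> \<A>"
      by (auto simp: \<A>_def)
  qed
  then obtain P where P: "prime_in R M P" "P \<subseteq> P0" and max: "\<forall>Y\<in>\<A>. - P \<subseteq> Y \<longrightarrow> Y = - P"
    by (auto simp: \<A>_def)
  have "Q = P" if "prime_in R M Q" "Q \<subseteq> P" for Q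
  proof -
    have "- Q \<in> \<A>"
      using that P by (auto simp: \<A>_def)
    then have "- Q = - P"
      using max that by blast
    then show ?thesis
      by simp
  qed
  with P show ?thesis
    unfolding minimal_primes_in_def by blast
qed

text \<open>The product of fully invariant submodules lies in their intersection: its generators
  \<open>f x\<close> are in \<open>N\<close> by full invariance and in the other factor by the range
  of \<open>f\<close>. Primeness and induction do the rest.\<close>

lemma Inter_fully_invariant_not_subset_prime:
  assumes P: "prime_in R M P" and "finite \<N>"
    and "\<And>N. N \<in> \<N> \<Longrightarrow> fully_invariant R M N \<and> \<not> N \<subseteq> P"
  shows "\<not> carrier M \<inter> \<Inter>\<N> \<subseteq> P"
  using assms(2,3)
proof (induction \<N>)
  case empty
  then show ?case
    using prime_inD(2)[OF P] fully_invariantD(2)[OF prime_inD(1)[OF P]] by auto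
next
  case (insert N \<N>)
  let ?K = "carrier M \<inter> \<Inter>\<N>"
  have K: "fully_invariant R M ?K"
    using insert.prems by (intro fully_invariant_Inter) auto
  show ?case
  proof
    assume sub: "carrier M \<inter> \<Inter>(insert N \<N>) \<subseteq> P"
    have "N \<subseteq> P \<or> ?K \<subseteq> P"
    proof (rule prime_inD(4)[OF P _ K])
      fix f x assume f: "f \<in> lmod_hom R M M" "f ` carrier M \<subseteq> ?K" "x \<in> N"
      then have "f x \<in> N" "x \<in> carrier M"
        using fully_invariantD(2,3)[of N] insert.prems by auto
      then show "f x \<in> P"
        using sub f(2) by auto
    qed (use insert.prems in auto)
    then show False
      using insert by auto
  qed
qed

end

section \<open>Transporters, and primes avoiding a nonzero element\<close>

context projective_module
begin

text \<open>The definition tests maps into one cyclic submodule at a time. Projectivity extends the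
  test to maps into the whole transporter, and this also shows that the transporter is closed under
  sums.\<close>

lemma transporter:
  assumes J: "J \<subseteq> carrier M" and Q: "fully_invariant R M Q"
  shows "fully_invariant R M (transporter J Q)"
    and "\<And>g x. \<lbrakk>g \<in> lmod_hom R M M; g ` carrier M \<subseteq> transporter J Q; x \<in> J\<rbrakk> \<Longrightarrow> g x \<in> Q"
proof -
  let ?T = "transporter J Q"
  let ?V = "copower_module ?T M"
  interpret V: left_module R ?V by (rule left_module_copower)
  have T_carrier: "?T \<subseteq> carrier M"
    by (auto simp: transporter_def)
  (* Since M need not be finitely generated, a map from M to T is lifted to the direct sum of the
     cyclic submodules Rx, x in T, all at once. *)
  define B where "B = {v \<in> carrier ?V. \<forall>x\<in>?T. v x \<in> cyclic_submodule R M x}"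
  have cyc: "submodule (cyclic_submodule R M x) R M" if "x \<in> ?T" for x
    using that T_carrier by (intro submodule_cyclic) auto
  have B: "submodule B R ?V"
  proof (rule V.submoduleI)
    show "v \<oplus>\<^bsub>?V\<^esub> w \<in> B" if "v \<in> B" "w \<in> B" for v w
      unfolding B_def
    proof (intro CollectI conjI ballI)
      show "v \<oplus>\<^bsub>?V\<^esub> w \<in> carrier ?V"
        using that by (intro V.M.a_closed) (auto simp only: B_def mem_Collect_eq)
      show "(v \<oplus>\<^bsub>?V\<^esub> w) x \<in> cyclic_submodule R M x" if "x \<in> ?T" for x
        using submoduleD(4)[OF cyc[OF that]] \<open>v \<in> B\<close> \<open>w \<in> B\<close> that by (simp add: B_def)
    qed
    show "a \<odot>\<^bsub>?V\<^esub> v \<in> B" if "a \<in> carrier R" "v \<in> B" for a v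
      unfolding B_def
    proof (intro CollectI conjI ballI)
      show "a \<odot>\<^bsub>?V\<^esub> v \<in> carrier ?V"
        using that by (intro V.smult_closed) (auto simp only: B_def mem_Collect_eq)
      show "(a \<odot>\<^bsub>?V\<^esub> v) x \<in> cyclic_submodule R M x" if "x \<in> ?T" for x
        using submoduleD(5)[OF cyc[OF that]] \<open>v \<in> B\<close> \<open>a \<in> carrier R\<close> that by (simp add: B_def)
    qed
    show "\<zero>\<^bsub>?V\<^esub> \<in> B"
      unfolding B_def using V.M.zero_closed submoduleD(3)[OF cyc] by simp
  qed (auto simp: B_def)
  \<comment> \<open>The sum map to \<open>M\<close>. It sends \<open>B\<close> onto the sum of the
    submodules Rx with x in the transporter, which will turn out to be the transporter
    itself.\<close>
  define s where "s = (\<lambda>v\<in>carrier ?V. fsum M ?T v)"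
  have fsum_V: "fsum M ?T v \<in> carrier M" if "v \<in> carrier ?V" for v
    using that by (intro fsum_closed) auto
  have s: "s \<in> lmod_hom R ?V M"
  proof (rule lmod_homI)
    show "s \<in> carrier ?V \<rightarrow>\<^sub>E carrier M"
      using fsum_V unfolding s_def restrict_PiE_iff by blast
  next
    fix v w assume vw: "v \<in> carrier ?V" "w \<in> carrier ?V"
    have "fsum M ?T (v \<oplus>\<^bsub>?V\<^esub> w) = fsum M ?T (\<lambda>x. v x \<oplus>\<^bsub>M\<^esub> w x)"
      using vw by (intro fsum_cong) auto
    also have "\<dots> = fsum M ?T v \<oplus>\<^bsub>M\<^esub> fsum M ?T w"
      using vw by (intro fsum_add) auto
    finally show "s (v \<oplus>\<^bsub>?V\<^esub> w) = s v \<oplus>\<^bsub>M\<^esub> s w"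
      using vw V.M.a_closed[OF vw] by (simp only: s_def restrict_apply if_True)
  next
    fix a v assume v: "a \<in> carrier R" "v \<in> carrier ?V"
    have "fsum M ?T (a \<odot>\<^bsub>?V\<^esub> v) = fsum M ?T (\<lambda>x. a \<odot>\<^bsub>M\<^esub> v x)"
      using v by (intro fsum_cong) auto
    also have "\<dots> = a \<odot>\<^bsub>M\<^esub> fsum M ?T v"
      using v by (intro fsum_smult) auto
    finally show "s (a \<odot>\<^bsub>?V\<^esub> v) = a \<odot>\<^bsub>M\<^esub> s v"
      using v V.smult_closed[OF v] by (simp only: s_def restrict_apply if_True)
  qed
  let ?B = "?V\<lparr>carrier := B\<rparr>"
  have S: "submodule (s ` B) R M"
    by (rule submodule_image[OF V.left_module_axioms left_module_axioms B s])
  have sB: "restrict s B \<in> lmod_hom R ?B (M\<lparr>carrier := s ` B\<rparr>)"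
    using restrict_lmod_hom[OF V.left_module_axioms B s] submoduleD(1)[OF S]
    by (simp add: lmod_hom_carrier_update)
  have "?T \<lesssim> (UNIV :: 'u set)"
    using T_carrier M_lepoll by (meson lepoll_trans subset_imp_lepoll)
  then have "carrier ?V \<lesssim> (UNIV :: 'u set)"
    by (rule copower_lepoll[OF infinite_U _ M_lepoll])
  then have "B \<lesssim> (UNIV :: 'u set)"
    by (rule lepoll_trans[OF subset_imp_lepoll[OF V.submoduleD(1)[OF B]]])
  then have B_lepoll: "carrier ?B \<lesssim> (UNIV :: 'u set)"
    by simp
  have sgB: "subgenerated R M ?B"
    using B by (intro subgenerated_submodule subgenerated_copower subgenerated_self left_module_axioms)
  \<comment> \<open>Each coordinate of a lift of \<open>g\<close> through the sum map is an
    endomorphism with image in one Rt, so it sends \<open>J\<close> into \<open>Q\<close>;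
    \<open>g x\<close> is the sum of these coordinates at \<open>x\<close>.\<close>
  have kill: "g x \<in> Q" if g: "g \<in> lmod_hom R M M" "g ` carrier M \<subseteq> s ` B" and x: "x \<in> J" for g x
  proof -
    have "g \<in> lmod_hom R M (M\<lparr>carrier := s ` B\<rparr>)"
      using g submoduleD(1)[OF S] by (simp add: lmod_hom_carrier_update)
    then have "\<exists>k\<in>lmod_hom R M ?B. \<forall>m\<in>carrier M. restrict s B (k m) = g m"
      by (intro lift[OF sgB B_lepoll left_module_submodule[OF S] sB]) auto
    then obtain k where k: "k \<in> lmod_hom R M ?B" and sk: "\<And>m. m \<in> carrier M \<Longrightarrow> restrict s B (k m) = g m"
      by blast
    have kB: "k m \<in> B" if "m \<in> carrier M" for m
      using lmod_homD(3)[OF k that] by simp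
    have kV: "k m \<in> carrier ?V" if "m \<in> carrier M" for m
      using kB[OF that] unfolding B_def by blast
    have "k x t \<in> Q" if t: "t \<in> ?T" for t
    proof -
      let ?c = "\<lambda>m\<in>carrier M. k m t"
      have kt: "k m t \<in> carrier M" if "m \<in> carrier M" for m
        using kV[OF that] t by auto
      have "?c \<in> lmod_hom R M M"
        using kt t lmod_homD(4,5)[OF k] by (intro lmod_homI) auto
      moreover have "?c ` carrier M \<subseteq> cyclic_submodule R M t"
        using kB t unfolding B_def by auto
      ultimately have "?c ` J \<subseteq> Q"
        using t unfolding transporter_def by blast
      then show ?thesis
        using x J by auto
    qed
    then have "fsum M ?T (k x) \<in> Q"
      by (rule fsum_submodule[OF fully_invariantD(1)[OF Q]])
    moreover have "g x = fsum M ?T (k x)"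
      using sk[of x] kB[of x] kV[of x] x J by (auto simp: s_def simp del: copower_module_simps)
    ultimately show ?thesis
      by simp
  qed
  \<comment> \<open>A member x is the sum of the vector whose only possibly nonzero coordinate is x,
    at index x. The converse inclusion is \<open>transporterI\<close> with the image of
    \<open>B\<close> as test submodule.\<close>
  have T_eq: "?T = s ` B"
  proof
    show "?T \<subseteq> s ` B"
    proof
      fix x assume x: "x \<in> ?T"
      then have xM: "x \<in> carrier M"
        using T_carrier by blast
      let ?e = "\<lambda>y\<in>?T. if y = x then x else \<zero>\<^bsub>M\<^esub>"
      have "?e \<in> carrier ?V"
        using xM by auto
      moreover have "?e \<in> B"
        unfolding B_def using \<open>?e \<in> carrier ?V\<close> mem_cyclic xM submoduleD(3)[OF cyc] by auto
      moreover have "fsum M ?T ?e = x"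
        using fsum_cong[of ?T ?e "\<lambda>y. if y = x then x else \<zero>\<^bsub>M\<^esub>"] fsum_single[OF x xM] xM by auto
      ultimately show "x \<in> s ` B"
        by (intro image_eqI[of _ _ ?e]) (auto simp only: s_def restrict_apply if_True)
    qed
    show "s ` B \<subseteq> ?T"
    proof
      fix y assume y: "y \<in> s ` B"
      show "y \<in> ?T"
        by (rule transporterI[OF y S]) (rule kill)
    qed
  qed
  show "\<And>g x. \<lbrakk>g \<in> lmod_hom R M M; g ` carrier M \<subseteq> ?T; x \<in> J\<rbrakk> \<Longrightarrow> g x \<in> Q"
    using kill unfolding T_eq by blast
  \<comment> \<open>Whatever kills x kills \<open>e x\<close>, so a map \<open>g\<close> into R(e x)
    lifts to a map \<open>g'\<close> into Rx, and \<open>g\<close> is \<open>g'\<close> followed by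
    \<open>e\<close>. Now \<open>g'\<close> sends \<open>J\<close> into \<open>Q\<close>, and
    \<open>e\<close> preserves \<open>Q\<close>.\<close>
  have "e x \<in> ?T" if e: "e \<in> lmod_hom R M M" and x: "x \<in> ?T" for e x
    unfolding transporter_def
  proof (intro CollectI conjI ballI impI)
    have xM: "x \<in> carrier M"
      using x T_carrier by blast
    then show ex: "e x \<in> carrier M"
      using lmod_homD(3)[OF e] by blast
    have ann: "a \<odot>\<^bsub>M\<^esub> e x = \<zero>\<^bsub>M\<^esub>" if "a \<in> carrier R" "a \<odot>\<^bsub>M\<^esub> x = \<zero>\<^bsub>M\<^esub>" for a
      using lmod_homD(5)[OF e that(1) xM] that(2)
        lmod_hom_zero[OF left_module_axioms left_module_axioms e] by simp
    fix g assume g: "g \<in> lmod_hom R M M" "g ` carrier M \<subseteq> cyclic_submodule R M (e x)"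
    obtain g' where g': "g' \<in> lmod_hom R M M" "g' ` carrier M \<subseteq> cyclic_submodule R M x"
      "\<And>m a. \<lbrakk>m \<in> carrier M; a \<in> carrier R; g' m = a \<odot>\<^bsub>M\<^esub> x\<rbrakk> \<Longrightarrow> g m = a \<odot>\<^bsub>M\<^esub> e x"
      using lift_cyclic[OF subgenerated_self[OF left_module_axioms] xM left_module_axioms ex ann g] by blast
    have "g j \<in> Q" if j: "j \<in> J" for j
    proof -
      have jM: "j \<in> carrier M" using j J by blast
      then obtain a where a: "a \<in> carrier R" "g' j = a \<odot>\<^bsub>M\<^esub> x"
        using g'(2) by blast
      then have "g j = e (g' j)"
        using g'(3)[OF jM a] lmod_homD(5)[OF e a(1) xM] by simp
      moreover have "g' j \<in> Q"
        using x g'(1,2) j unfolding transporter_def by blast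
      ultimately show ?thesis
        using fully_invariantD(3)[OF Q e] by simp
    qed
    then show "g ` J \<subseteq> Q"
      by blast
  qed
  then show "fully_invariant R M ?T"
    unfolding fully_invariant_def using S T_eq by auto
qed

text \<open>As for ideals of a ring: \<open>P\<close> is maximal among the fully invariant submodules avoiding
  an \<open>m\<close>-sequence \<open>s\<close> that starts at \<open>m\<close>.\<close>

lemma prime_avoiding:
  assumes "semiprime_module R M" and m: "m \<in> carrier M" "m \<noteq> \<zero>\<^bsub>M\<^esub>"
  shows "\<exists>P. prime_in R M P \<and> m \<notin> P"
proof -
  \<comment> \<open>\<open>y\<close> is a generator of the product of the span of \<open>x\<close>
    with itself. For nonzero \<open>x\<close> this product is nonzero by semiprimeness, so the
    sequence can always be continued by a nonzero term.\<close>
  define step where "step x y \<longleftrightarrow>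
    (\<exists>f\<in>lmod_hom R M M. f ` carrier M \<subseteq> fi_span x \<and> (\<exists>a\<in>fi_span x. y = f a))" for x y
  have "\<exists>y. y \<in> carrier M \<and> y \<noteq> \<zero>\<^bsub>M\<^esub> \<and> step x y" if x: "x \<in> carrier M" "x \<noteq> \<zero>\<^bsub>M\<^esub>" for x
  proof (rule ccontr)
    assume no: "\<not> ?thesis"
    have span: "fi_span x \<subseteq> carrier M"
      by (rule fully_invariantD(2)[OF fully_invariant_fi_span])
    have "f a = \<zero>\<^bsub>M\<^esub>" if "f \<in> lmod_hom R M M" "f ` carrier M \<subseteq> fi_span x" "a \<in> fi_span x" for f a
      using no that span lmod_homD(3)[OF that(1)] unfolding step_def by blast
    then have "submodule_prod R M (fi_span x) (fi_span x) \<subseteq> {\<zero>\<^bsub>M\<^esub>}"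
      by (subst submodule_prod_subset_iff[OF span span submodule_zero]) auto
    then have "submodule_prod R M (fi_span x) (fi_span x) = {\<zero>\<^bsub>M\<^esub>}"
      using zero_mem_submodule_prod by blast
    then have "fi_span x = {\<zero>\<^bsub>M\<^esub>}"
      using assms(1) fully_invariant_fi_span unfolding semiprime_module_def by blast
    then show False
      using mem_fi_span x by auto
  qed
  then have "\<exists>s. \<forall>n::nat. (s n \<in> carrier M \<and> s n \<noteq> \<zero>\<^bsub>M\<^esub> \<and> (n = 0 \<longrightarrow> s n = m)) \<and> step (s n) (s (Suc n))"
    using m by (intro dependent_nat_choice) auto
  then obtain s where s: "\<And>n::nat. s n \<in> carrier M" "\<And>n. s n \<noteq> \<zero>\<^bsub>M\<^esub>" "s 0 = m"
    "\<And>n. step (s n) (s (Suc n))"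
    by metis
  \<comment> \<open>Each term lies in the span of its predecessor, so the spans decrease.\<close>
  have "fi_span (s (Suc n)) \<subseteq> fi_span (s n)" for n
    using s(4)[of n] fully_invariantD(2,3)[OF fully_invariant_fi_span]
    unfolding step_def by (intro fi_span_subset fully_invariant_fi_span) blast
  then have anti: "fi_span (s n) \<subseteq> fi_span (s k)" if "k \<le> n" for k n
    using that by (rule lift_Suc_antimono_le)
  define \<A> where "\<A> = {Q. fully_invariant R M Q \<and> Q \<inter> range s = {}}"
  have "\<exists>P\<in>\<A>. \<forall>Q\<in>\<A>. P \<subseteq> Q \<longrightarrow> Q = P"
  proof (rule subset_Zorn_nonempty)
    show "\<A> \<noteq> {}"
      using fully_invariant_zero s(2) by (auto simp: \<A>_def intro!: exI[of _ "{\<zero>\<^bsub>M\<^esub>}"])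
    fix \<C> assume "\<C> \<noteq> {}" "subset.chain \<A> \<C>"
    then show "\<Union>\<C> \<in> \<A>"
      unfolding \<A>_def subset_chain_def
      by (intro CollectI conjI fully_invariant_Union_chain) auto
  qed
  then obtain P where "P \<in> \<A>" and max_P: "\<forall>Q\<in>\<A>. P \<subseteq> Q \<longrightarrow> Q = P"
    by blast
  then have P: "fully_invariant R M P" "P \<inter> range s = {}"
    by (simp_all add: \<A>_def)
  have max: "Q = P" if "fully_invariant R M Q" "P \<subseteq> Q" "Q \<inter> range s = {}" for Q
    using that max_P by (simp add: \<A>_def)
  have "prime_in R M P"
  proof (rule prime_inI[OF P(1)])
    show "P \<noteq> carrier M"
      using P(2) s(1) by blast
    fix N K assume N: "fully_invariant R M N" and K: "fully_invariant R M K"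
      and NK: "\<And>f x. \<lbrakk>f \<in> lmod_hom R M M; f ` carrier M \<subseteq> K; x \<in> N\<rbrakk> \<Longrightarrow> f x \<in> P"
    show "N \<subseteq> P \<or> K \<subseteq> P"
    proof (rule ccontr)
      assume "\<not> ?thesis"
      then have not: "\<not> N \<subseteq> P" "\<not> K \<subseteq> P"
        by auto
      \<comment> \<open>\<open>?T\<close> and \<open>L\<close> take over the roles of K + P and N +
        P: they are fully invariant, contain these sums, and maps from \<open>M\<close> to
        \<open>?T\<close> send \<open>L\<close> into \<open>P\<close>. By maximality of
        \<open>P\<close> both meet the sequence.\<close>
      let ?T = "transporter N P"
      note T = transporter[OF fully_invariantD(2)[OF N] P(1)]
      define L where "L = {x \<in> carrier M. \<forall>g\<in>lmod_hom R M M. g ` carrier M \<subseteq> ?T \<longrightarrow> g x \<in> P}"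
      have "P \<subseteq> ?T"
      proof
        fix p assume p: "p \<in> P"
        show "p \<in> ?T"
          using fully_invariantD(2)[OF N] by (intro transporterI[OF p fully_invariantD(1)[OF P(1)]]) auto
      qed
      moreover have "K \<subseteq> ?T"
      proof
        fix k assume k: "k \<in> K"
        show "k \<in> ?T"
          by (rule transporterI[OF k fully_invariantD(1)[OF K]]) (rule NK)
      qed
      ultimately obtain b where b: "s b \<in> ?T"
        using max[OF T(1)] not(2) by blast
      have "fully_invariant R M L"
        unfolding fully_invariant_def
      proof (intro conjI ballI)
        note PD = submoduleD[OF fully_invariantD(1)[OF P(1)]]
        show "submodule L R M"
        proof (rule submoduleI)
          have "g \<zero>\<^bsub>M\<^esub> \<in> P" if "g \<in> lmod_hom R M M" for g
            using PD(3) lmod_hom_zero[OF left_module_axioms left_module_axioms that] by simp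
          then show "\<zero>\<^bsub>M\<^esub> \<in> L"
            by (simp add: L_def)
          fix x y assume xy: "x \<in> L" "y \<in> L"
          then have "g (x \<oplus>\<^bsub>M\<^esub> y) \<in> P"
            if "g \<in> lmod_hom R M M" "g ` carrier M \<subseteq> ?T" for g
            using that PD(4) by (simp add: L_def lmod_homD(4)[OF that(1)])
          with xy show "x \<oplus>\<^bsub>M\<^esub> y \<in> L"
            by (simp add: L_def)
        next
          fix a x assume ax: "a \<in> carrier R" "x \<in> L"
          then have "g (a \<odot>\<^bsub>M\<^esub> x) \<in> P"
            if "g \<in> lmod_hom R M M" "g ` carrier M \<subseteq> ?T" for g
            using that PD(5) by (simp add: L_def lmod_homD(5)[OF that(1)])
          with ax show "a \<odot>\<^bsub>M\<^esub> x \<in> L"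
            by (simp add: L_def)
        qed (auto simp: L_def)
        fix e assume e: "e \<in> lmod_hom R M M"
        have "g (e x) \<in> P" if x: "x \<in> L" and g: "g \<in> lmod_hom R M M" "g ` carrier M \<subseteq> ?T" for g x
        proof -
          have "compose (carrier M) g e ` carrier M \<subseteq> ?T"
            using g(2) lmod_homD(3)[OF e] by (auto simp: compose_def)
          then have "compose (carrier M) g e x \<in> P"
            using x compose_lmod_hom[OF left_module_axioms e g(1)] unfolding L_def by blast
          then show ?thesis
            using x by (simp add: L_def compose_def)
        qed
        then show "e ` L \<subseteq> L"
          using lmod_homD(3)[OF e] unfolding L_def by auto
      qed
      moreover have "P \<subseteq> L"
        using fully_invariantD(2,3)[OF P(1)] unfolding L_def by blast
      moreover have "N \<subseteq> L"
        using fully_invariantD(2)[OF N] T(2) unfolding L_def by blast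
      ultimately obtain a where a: "s a \<in> L"
        using max[of L] not(1) by blast
      \<comment> \<open>At the larger of the two indices the span lies in both \<open>?T\<close> and
        \<open>L\<close>, so the next term of the sequence falls into \<open>P\<close>, which avoids
        the sequence.\<close>
      obtain f x where f: "f \<in> lmod_hom R M M" "f ` carrier M \<subseteq> fi_span (s (max a b))"
        "x \<in> fi_span (s (max a b))" "s (Suc (max a b)) = f x"
        using s(4)[of "max a b"] unfolding step_def by blast
      have "fi_span (s (max a b)) \<subseteq> ?T"
        using anti[of b "max a b"] fi_span_subset[OF T(1) b] by auto
      moreover have "fi_span (s (max a b)) \<subseteq> L"
        using anti[of a "max a b"] fi_span_subset[OF \<open>fully_invariant R M L\<close> a] by auto
      ultimately have "f x \<in> P"
        using f(1-3) unfolding L_def by blast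
      then show False
        using f(4) P(2) by (metis disjoint_iff rangeI)
    qed
  qed
  moreover have "m \<notin> P"
    using P(2) s(3) by blast
  ultimately show ?thesis
    by blast
qed

text \<open>By \<open>ann\<close>, Rz is a copy of R(k + P). A map from \<open>M\<close> to Rk
  followed by Rk onto Rz kills \<open>I\<close>, so it sends \<open>I\<close> into \<open>P\<close>
  already in Rk. Hence \<open>k\<close> is in the transporter of \<open>I\<close> into
  \<open>P\<close>, which lies in \<open>P\<close> because \<open>P\<close> is prime and does not
  contain \<open>I\<close>.\<close>

lemma eq_zero_if_homs_kill:
  assumes P: "prime_in R M P" and I: "fully_invariant R M I" "\<not> I \<subseteq> P"
    and X: "left_module R X" "z \<in> carrier X" and k: "k \<in> carrier M"
    and ann: "\<And>a. a \<in> carrier R \<Longrightarrow> a \<odot>\<^bsub>X\<^esub> z = \<zero>\<^bsub>X\<^esub> \<longleftrightarrow> a \<odot>\<^bsub>M\<^esub> k \<in> P"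
    and kill: "\<And>h x. \<lbrakk>h \<in> lmod_hom R M X; h ` carrier M \<subseteq> cyclic_submodule R X z; x \<in> I\<rbrakk> \<Longrightarrow> h x = \<zero>\<^bsub>X\<^esub>"
  shows "z = \<zero>\<^bsub>X\<^esub>"
proof -
  interpret X: left_module R X by fact
  note PD = submoduleD[OF prime_inD(3)[OF P]]
  let ?T = "transporter I P"
  note T = transporter[OF fully_invariantD(2)[OF I(1)] prime_inD(1)[OF P]]
  let ?Rk = "cyclic_submodule R M k" and ?Rz = "cyclic_submodule R X z"
  obtain f where f_hom: "f \<in> lmod_hom R (M\<lparr>carrier := ?Rk\<rparr>) (X\<lparr>carrier := ?Rz\<rparr>)"
    and f: "\<And>a. a \<in> carrier R \<Longrightarrow> f (a \<odot>\<^bsub>M\<^esub> k) = a \<odot>\<^bsub>X\<^esub> z"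
    using cyclic_hom[OF left_module_axioms k X] ann PD(3) by metis
  have "k \<in> ?T"
    unfolding transporter_def
  proof (intro CollectI conjI ballI impI subsetI)
    fix g y assume g: "g \<in> lmod_hom R M M" "g ` carrier M \<subseteq> ?Rk" and "y \<in> g ` I"
    then obtain x where x: "x \<in> I" "x \<in> carrier M" "y = g x"
      using fully_invariantD(2)[OF I(1)] by blast
    then obtain a where a: "a \<in> carrier R" "g x = a \<odot>\<^bsub>M\<^esub> k"
      using g(2) by blast
    have "g \<in> lmod_hom R M (M\<lparr>carrier := ?Rk\<rparr>)"
      using g submoduleD(1)[OF submodule_cyclic[OF k]] by (simp add: lmod_hom_carrier_update)
    then have "compose (carrier M) f g \<in> lmod_hom R M (X\<lparr>carrier := ?Rz\<rparr>)"
      by (rule compose_lmod_hom[OF left_module_axioms _ f_hom])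
    then have "compose (carrier M) f g x = \<zero>\<^bsub>X\<^esub>"
      using X.submoduleD(1)[OF X.submodule_cyclic[OF X(2)]]
      by (intro kill) (auto simp: lmod_hom_carrier_update x)
    then have "a \<odot>\<^bsub>X\<^esub> z = \<zero>\<^bsub>X\<^esub>"
      using x a f by (simp add: compose_def)
    then show "y \<in> P"
      using ann a x by simp
  qed fact
  moreover have "?T \<subseteq> P"
    using prime_inD(4)[OF P I(1) T(1)] T(2) I(2) by blast
  ultimately have "k \<in> P"
    by blast
  then show ?thesis
    using ann[of "\<one>\<^bsub>R\<^esub>"] k X(2) by simp
qed

end

section \<open>Essential extensions of factor modules by minimal primes\<close>

text \<open>What is needed of an essential extension \<open>X\<close> of a submodule of \<open>M / P\<close>, in terms of annihilators
  only: a nonzero \<open>s \<odot> y\<close> in that submodule has the annihilator of its coset \<open>k + P\<close>.\<close>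

definition essentially_in_quotient ::
    "('r, 'x) ring_scheme \<Rightarrow> ('r, 'm) module \<Rightarrow> 'm set \<Rightarrow> ('r, 'n) module \<Rightarrow> bool"
  where "essentially_in_quotient R M P X \<longleftrightarrow>
    (\<forall>y\<in>carrier X. y \<noteq> \<zero>\<^bsub>X\<^esub> \<longrightarrow> (\<exists>s\<in>carrier R. s \<odot>\<^bsub>X\<^esub> y \<noteq> \<zero>\<^bsub>X\<^esub> \<and>
      (\<exists>k\<in>carrier M. \<forall>a\<in>carrier R. a \<odot>\<^bsub>X\<^esub> (s \<odot>\<^bsub>X\<^esub> y) = \<zero>\<^bsub>X\<^esub> \<longleftrightarrow> a \<odot>\<^bsub>M\<^esub> k \<in> P)))"

text \<open>A nonzero Ry meets the image of M / P in a nonzero element, the image of some coset k +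
  P; injectivity of \<open>\<iota>\<close> matches the two annihilators.\<close>

lemma (in left_module) essentially_in_quotient_hull:
  assumes P: "submodule P R M" and E: "left_module R E"
    and \<iota>: "\<iota> \<in> lmod_hom R (quotient_module M P) E" "inj_on \<iota> (carrier (quotient_module M P))"
    and ess: "essential_submodule R E (\<iota> ` carrier (quotient_module M P))"
  shows "essentially_in_quotient R M P E"
  unfolding essentially_in_quotient_def
proof (intro ballI impI)
  let ?Q = "quotient_module M P"
  interpret E: left_module R E by fact
  note Q = quotient_module_simps[OF P] and LQ = left_module_quotient[OF P]
  fix y assume y: "y \<in> carrier E" "y \<noteq> \<zero>\<^bsub>E\<^esub>"
  have "cyclic_submodule R E y \<noteq> {\<zero>\<^bsub>E\<^esub>}"
    using E.mem_cyclic y by blast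
  then have "\<iota> ` carrier ?Q \<inter> cyclic_submodule R E y \<noteq> {\<zero>\<^bsub>E\<^esub>}"
    using ess E.submodule_cyclic[OF y(1)] unfolding essential_submodule_def by blast
  moreover have "\<zero>\<^bsub>E\<^esub> \<in> \<iota> ` carrier ?Q \<inter> cyclic_submodule R E y"
    using ess E.submoduleD(3) E.submodule_cyclic[OF y(1)] unfolding essential_submodule_def by blast
  ultimately obtain z where z: "z \<in> \<iota> ` carrier ?Q" "z \<in> cyclic_submodule R E y" "z \<noteq> \<zero>\<^bsub>E\<^esub>"
    by blast
  obtain s where s: "s \<in> carrier R" "z = s \<odot>\<^bsub>E\<^esub> y"
    using z(2) by blast
  obtain k where k: "k \<in> carrier M" "z = \<iota> (P +>\<^bsub>M\<^esub> k)"
    using z(1) unfolding Q(1) by blast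
  have "a \<odot>\<^bsub>E\<^esub> z = \<zero>\<^bsub>E\<^esub> \<longleftrightarrow> a \<odot>\<^bsub>M\<^esub> k \<in> P" if a: "a \<in> carrier R" for a
  proof -
    have kQ: "P +>\<^bsub>M\<^esub> k \<in> carrier ?Q" "P +>\<^bsub>M\<^esub> (a \<odot>\<^bsub>M\<^esub> k) \<in> carrier ?Q"
      using a k Q(1) by auto
    have "a \<odot>\<^bsub>E\<^esub> z = \<iota> (P +>\<^bsub>M\<^esub> (a \<odot>\<^bsub>M\<^esub> k))"
      using lmod_homD(5)[OF \<iota>(1) a kQ(1)] Q(4)[OF a k(1)] k(2) by simp
    also have "\<dots> = \<zero>\<^bsub>E\<^esub> \<longleftrightarrow> P +>\<^bsub>M\<^esub> (a \<odot>\<^bsub>M\<^esub> k) = P"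
      using \<iota> inj_on_lmod_hom_iff[OF LQ E \<iota>(1)] lmod_hom_zero[OF LQ E \<iota>(1)] kQ(2) Q(2) by metis
    finally show ?thesis
      using a k(1) by (simp add: coset_eq_self_iff[OF P])
  qed
  then show "\<exists>s\<in>carrier R. s \<odot>\<^bsub>E\<^esub> y \<noteq> \<zero>\<^bsub>E\<^esub> \<and>
      (\<exists>k\<in>carrier M. \<forall>a\<in>carrier R. a \<odot>\<^bsub>E\<^esub> (s \<odot>\<^bsub>E\<^esub> y) = \<zero>\<^bsub>E\<^esub> \<longleftrightarrow> a \<odot>\<^bsub>M\<^esub> k \<in> P)"
    using s k(1) z(3) by blast
qed

lemma (in left_module) subgenerated_quotient:
  assumes "submodule P R M"
  shows "subgenerated R M (quotient_module M P)"
proof (rule subgenerated_image[OF subgenerated_self[OF left_module_axioms] left_module_quotient[OF assms]])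
  note Q = quotient_module_simps[OF assms]
  show "restrict (\<lambda>x. P +>\<^bsub>M\<^esub> x) (carrier M) \<in> lmod_hom R M (quotient_module M P)"
    by (rule lmod_homI) (use Q in auto)
  show "restrict (\<lambda>x. P +>\<^bsub>M\<^esub> x) (carrier M) ` carrier M = carrier (quotient_module M P)"
    using Q(1) by simp
qed

text \<open>On each coordinate \<open>h\<close> restricts to a homomorphism from \<open>M\<close> to
  \<open>X\<close>, which kills \<open>P\<close>. A vector with all coordinates in \<open>P\<close>
  is a finite sum of vectors with one coordinate.\<close>

lemma (in left_module) copower_hom_eq_zero:
  assumes X: "left_module R X" and h: "h \<in> lmod_hom R (copower_module I M) X"
    and P: "submodule P R M" and kill: "\<And>f p. \<lbrakk>f \<in> lmod_hom R M X; p \<in> P\<rbrakk> \<Longrightarrow> f p = \<zero>\<^bsub>X\<^esub>"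
    and v: "v \<in> carrier (copower_module I M)" "\<And>i. i \<in> I \<Longrightarrow> v i \<in> P"
  shows "h v = \<zero>\<^bsub>X\<^esub>"
proof -
  interpret X: left_module R X by fact
  let ?V = "copower_module I M"
  interpret V: left_module R ?V by (rule left_module_copower)
  define e where "e i m = (\<lambda>j\<in>I. if j = i then m else \<zero>\<^bsub>M\<^esub>)" for i m
  have e_V: "e i m \<in> carrier ?V" if "m \<in> carrier M" for i m
  proof -
    have "{j \<in> I. e i m j \<noteq> \<zero>\<^bsub>M\<^esub>} \<subseteq> {i}"
      by (auto simp: e_def)
    then have "finite {j \<in> I. e i m j \<noteq> \<zero>\<^bsub>M\<^esub>}"
      by (rule finite_subset) simp
    moreover have "e i m \<in> I \<rightarrow>\<^sub>E carrier M"
      using that by (auto simp: e_def)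
    ultimately show ?thesis
      by simp
  qed
  have h_e: "h (e i p) = \<zero>\<^bsub>X\<^esub>" if "p \<in> P" for i p
  proof -
    have "restrict (e i) (carrier M) \<in> lmod_hom R M ?V"
    proof (rule lmod_homI)
      show "restrict (e i) (carrier M) \<in> carrier M \<rightarrow>\<^sub>E carrier ?V"
        using e_V by (simp only: restrict_PiE_iff) blast
    qed (auto simp: e_def intro!: restrict_ext)
    then have "compose (carrier M) h (restrict (e i) (carrier M)) \<in> lmod_hom R M X"
      by (rule compose_lmod_hom[OF left_module_axioms _ h])
    then have "compose (carrier M) h (restrict (e i) (carrier M)) p = \<zero>\<^bsub>X\<^esub>"
      using that by (rule kill)
    then show ?thesis
      using submoduleD(2)[OF P that] by (simp add: compose_def)
  qed
  \<comment> \<open>Induction on a finite set containing the support; the induction step splits off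
    the coordinate at the added index.\<close>
  have "\<forall>w\<in>carrier ?V. {i \<in> I. w i \<noteq> \<zero>\<^bsub>M\<^esub>} \<subseteq> S \<longrightarrow> (\<forall>i\<in>I. w i \<in> P) \<longrightarrow> h w = \<zero>\<^bsub>X\<^esub>" if "finite S" for S
    using that
  proof (induction S)
    case empty
    have "w = \<zero>\<^bsub>?V\<^esub>" if "w \<in> carrier ?V" "{i \<in> I. w i \<noteq> \<zero>\<^bsub>M\<^esub>} \<subseteq> {}" for w
      using that by (intro extensionalityI[of _ I]) (auto simp: PiE_def)
    then show ?case
      using lmod_hom_zero[OF V.left_module_axioms X h] by blast
  next
    case (insert i S)
    show ?case
    proof (intro ballI impI)
      fix w assume w: "w \<in> carrier ?V" "{j \<in> I. w j \<noteq> \<zero>\<^bsub>M\<^esub>} \<subseteq> insert i S" "\<forall>j\<in>I. w j \<in> P"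
      show "h w = \<zero>\<^bsub>X\<^esub>"
      proof (cases "i \<in> I")
        case True
        then have wi: "w i \<in> P" "w i \<in> carrier M"
          using w(3) submoduleD(2)[OF P] by auto
        define w' where "w' = (\<lambda>j\<in>I. if j = i then \<zero>\<^bsub>M\<^esub> else w j)"
        have "finite {j \<in> I. w' j \<noteq> \<zero>\<^bsub>M\<^esub>}"
          by (rule finite_subset[of _ "{j \<in> I. w j \<noteq> \<zero>\<^bsub>M\<^esub>}"]) (use w(1) in \<open>auto simp: w'_def\<close>)
        moreover have "w' \<in> I \<rightarrow>\<^sub>E carrier M"
          using w(1) by (auto simp: w'_def)
        ultimately have w'V: "w' \<in> carrier ?V"
          by simp
        moreover have "{j \<in> I. w' j \<noteq> \<zero>\<^bsub>M\<^esub>} \<subseteq> S"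
          using w(2) by (auto simp: w'_def)
        moreover have "\<forall>j\<in>I. w' j \<in> P"
          using w(3) submoduleD(3)[OF P] by (auto simp: w'_def)
        ultimately have "h w' = \<zero>\<^bsub>X\<^esub>"
          using insert.IH by blast
        have "w = w' \<oplus>\<^bsub>?V\<^esub> e i (w i)"
          using w(1) wi by (intro extensionalityI[of _ I]) (auto simp: w'_def e_def PiE_iff)
        then have "h w = h (w' \<oplus>\<^bsub>?V\<^esub> e i (w i))"
          by (rule arg_cong)
        also have "\<dots> = h w' \<oplus>\<^bsub>X\<^esub> h (e i (w i))"
          by (rule lmod_homD(4)[OF h w'V e_V[OF wi(2)]])
        finally show ?thesis
          using h_e[OF wi(1)] \<open>h w' = \<zero>\<^bsub>X\<^esub>\<close> by simp
      next
        case False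
        then show ?thesis
          using insert.IH w by blast
      qed
    qed
  qed
  then show ?thesis
    using v by (metis (mono_tags, lifting) copower_module_simps(1) mem_Collect_eq order_refl)
qed

text \<open>Modulo \<open>N\<close>, \<open>C\<close> is maximal among the submodules that meet
  \<open>A\<close> only in zero. This maximality makes the image of a submodule \<open>A\<close>
  essential in the quotient by \<open>C\<close>.\<close>

lemma (in left_module) exists_complement:
  assumes N: "submodule N R M"
  obtains C where "submodule C R M" "N \<subseteq> C" "C \<inter> A \<subseteq> N"
    "\<And>D. \<lbrakk>submodule D R M; C \<subseteq> D; D \<inter> A \<subseteq> N\<rbrakk> \<Longrightarrow> D = C"
proof -
  define \<A> where "\<A> = {C. submodule C R M \<and> N \<subseteq> C \<and> C \<inter> A \<subseteq> N}"
  have "\<exists>C\<in>\<A>. \<forall>D\<in>\<A>. C \<subseteq> D \<longrightarrow> D = C"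
  proof (rule subset_Zorn_nonempty)
    show "\<A> \<noteq> {}"
      using N by (auto simp: \<A>_def)
    fix \<C> assume C: "\<C> \<noteq> {}" "subset.chain \<A> \<C>"
    then have CA: "submodule D R M" "N \<subseteq> D" "D \<inter> A \<subseteq> N" if "D \<in> \<C>" for D
      using that by (auto simp: \<A>_def subset_chain_def)
    have "submodule (\<Union>\<C>) R M"
    proof (rule submoduleI)
      show "\<Union>\<C> \<subseteq> carrier M" "\<zero>\<^bsub>M\<^esub> \<in> \<Union>\<C>"
        using submoduleD(1,3)[OF CA(1)] C(1) by auto
      fix x y assume "x \<in> \<Union>\<C>" "y \<in> \<Union>\<C>"
      then obtain D1 D2 where "D1 \<in> \<C>" "x \<in> D1" "D2 \<in> \<C>" "y \<in> D2"
        by blast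
      moreover from this have "D1 \<subseteq> D2 \<or> D2 \<subseteq> D1"
        using C(2) unfolding subset_chain_def by blast
      ultimately obtain D where "D \<in> \<C>" "x \<in> D" "y \<in> D"
        by blast
      then show "x \<oplus>\<^bsub>M\<^esub> y \<in> \<Union>\<C>"
        using submoduleD(4)[OF CA(1)] by blast
    next
      show "a \<odot>\<^bsub>M\<^esub> x \<in> \<Union>\<C>" if "a \<in> carrier R" "x \<in> \<Union>\<C>" for a x
        using that submoduleD(5)[OF CA(1)] by blast
    qed
    then show "\<Union>\<C> \<in> \<A>"
      using CA(2,3) C(1) unfolding \<A>_def by blast
  qed
  then obtain C where "C \<in> \<A>" and max: "\<forall>D\<in>\<A>. C \<subseteq> D \<longrightarrow> D = C"
    by blast
  then have C: "submodule C R M" "N \<subseteq> C" "C \<inter> A \<subseteq> N"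
    by (simp_all add: \<A>_def)
  show thesis
  proof (rule that[OF C])
    fix D assume "submodule D R M" "C \<subseteq> D" "D \<inter> A \<subseteq> N"
    then show "D = C"
      using max C(2) by (simp add: \<A>_def)
  qed
qed

section \<open>Homomorphisms into essential extensions of M / P\<close>

context projective_module
begin

lemma homs_kill_minimal_prime:
  assumes semi: "semiprime_module R M" and fin: "finite (minimal_primes_in R M)"
    and P: "P \<in> minimal_primes_in R M"
    and X: "left_module R X" "essentially_in_quotient R M P X"
    and f: "f \<in> lmod_hom R M X" and p: "p \<in> P"
  shows "f p = \<zero>\<^bsub>X\<^esub>"
proof (rule ccontr)
  assume "f p \<noteq> \<zero>\<^bsub>X\<^esub>"
  interpret X: left_module R X by fact
  have min: "prime_in R M Q" "\<And>Q'. \<lbrakk>prime_in R M Q'; Q' \<subseteq> Q\<rbrakk> \<Longrightarrow> Q' = Q"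
    if "Q \<in> minimal_primes_in R M" for Q
    using that unfolding minimal_primes_in_def by auto
  note PP = min(1)[OF P]
  \<comment> \<open>The intersection of the other minimal primes, or all of \<open>M\<close> if
    there are none.\<close>
  define I where "I = carrier M \<inter> \<Inter>(minimal_primes_in R M - {P})"
  have I: "fully_invariant R M I"
    unfolding I_def using prime_inD(1)[OF min(1)] by (intro fully_invariant_Inter) auto
  have I_P: "\<not> I \<subseteq> P"
    unfolding I_def
  proof (rule Inter_fully_invariant_not_subset_prime[OF PP])
    show "fully_invariant R M N \<and> \<not> N \<subseteq> P" if "N \<in> minimal_primes_in R M - {P}" for N
      using that prime_inD(1)[OF min(1)] min(2)[OF P] min(1) by blast
  qed (use fin in simp)
  \<comment> \<open>An element of \<open>I\<close> and \<open>P\<close> lies in every minimal prime,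
    but a nonzero element avoids some prime, and hence a minimal prime below it.\<close>
  have zero: "x = \<zero>\<^bsub>M\<^esub>" if x: "x \<in> I" "x \<in> P" for x
  proof (rule ccontr)
    assume "x \<noteq> \<zero>\<^bsub>M\<^esub>"
    then obtain Q0 where "prime_in R M Q0" "x \<notin> Q0"
      using prime_avoiding[OF semi, of x] x unfolding I_def by blast
    then obtain Q where "Q \<in> minimal_primes_in R M" "x \<notin> Q"
      using minimal_prime_below by blast
    then show False
      using x unfolding I_def by blast
  qed
  note PD = submoduleD[OF prime_inD(3)[OF PP]]
  have pM: "p \<in> carrier M"
    using PD(2)[OF p] .
  obtain s k where s: "s \<in> carrier R" "s \<odot>\<^bsub>X\<^esub> f p \<noteq> \<zero>\<^bsub>X\<^esub>" and k: "k \<in> carrier M"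
    and ann: "\<And>a. a \<in> carrier R \<Longrightarrow> a \<odot>\<^bsub>X\<^esub> (s \<odot>\<^bsub>X\<^esub> f p) = \<zero>\<^bsub>X\<^esub> \<longleftrightarrow> a \<odot>\<^bsub>M\<^esub> k \<in> P"
    using X(2) \<open>f p \<noteq> \<zero>\<^bsub>X\<^esub>\<close> lmod_homD(3)[OF f pM] unfolding essentially_in_quotient_def by meson
  let ?u = "s \<odot>\<^bsub>M\<^esub> p" and ?z = "s \<odot>\<^bsub>X\<^esub> f p"
  have u: "?u \<in> P" "?u \<in> carrier M"
    using PD(5)[OF s(1) p] PD(2) by auto
  have z: "?z \<in> carrier X"
    using s(1) lmod_homD(3)[OF f pM] by simp
  have fu: "f ?u = ?z"
    by (rule lmod_homD(5)[OF f s(1) pM])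
  have u_z: "a \<odot>\<^bsub>X\<^esub> ?z = \<zero>\<^bsub>X\<^esub>" if "a \<in> carrier R" "a \<odot>\<^bsub>M\<^esub> ?u = \<zero>\<^bsub>M\<^esub>" for a
    using lmod_homD(5)[OF f that(1) u(2)] that(2) fu lmod_hom_zero[OF left_module_axioms X(1) f] by simp
  have "?z = \<zero>\<^bsub>X\<^esub>"
  proof (rule eq_zero_if_homs_kill[OF PP I I_P X(1) z k ann])
    fix h x assume h: "h \<in> lmod_hom R M X" "h ` carrier M \<subseteq> cyclic_submodule R X ?z" and x: "x \<in> I"
    have xM: "x \<in> carrier M"
      using x by (simp add: I_def)
    obtain g where g: "g \<in> lmod_hom R M M" "g ` carrier M \<subseteq> cyclic_submodule R M ?u"
      "\<And>m a. \<lbrakk>m \<in> carrier M; a \<in> carrier R; g m = a \<odot>\<^bsub>M\<^esub> ?u\<rbrakk> \<Longrightarrow> h m = a \<odot>\<^bsub>X\<^esub> ?z"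
      using lift_cyclic[OF subgenerated_self[OF left_module_axioms] u(2) X(1) z u_z h] by blast
    have "g x \<in> I"
      by (rule fully_invariantD(3)[OF I g(1) x])
    moreover obtain a where "a \<in> carrier R" "g x = a \<odot>\<^bsub>M\<^esub> ?u"
      using g(2) xM by blast
    then have "g x \<in> P"
      using PD(5)[OF _ u(1)] by simp
    ultimately have "g x = \<zero>\<^bsub>M\<^esub>"
      by (rule zero)
    \<comment> \<open>Zero is the multiple of \<open>?u\<close> by the scalar 0, so the coefficient
      clause of the lift makes \<open>h x\<close> the zero multiple of \<open>?z\<close>.\<close>
    then show "h x = \<zero>\<^bsub>X\<^esub>"
      using g(3)[OF xM R.zero_closed] u(2) z by simp
  qed auto
  then show False
    using s(2) by simp
qed

text \<open>A map from \<open>M\<close> to Rz, where z is a multiple of \<open>f x\<close>, lifts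
  through \<open>f\<close> to a map into \<open>X\<close>, which kills \<open>P\<close>. So the map
  itself kills \<open>P\<close>, and \<open>eq_zero_if_homs_kill\<close> applies to the prime
  \<open>Q\<close>.\<close>

lemma hom_eq_zero_between_primes:
  assumes semi: "semiprime_module R M" and fin: "finite (minimal_primes_in R M)"
    and P: "P \<in> minimal_primes_in R M" and Q: "Q \<in> minimal_primes_in R M" and "P \<noteq> Q"
    and X: "subgenerated R M X" "essentially_in_quotient R M P X"
    and Y: "left_module R Y" "essentially_in_quotient R M Q Y"
    and f: "f \<in> lmod_hom R X Y" and x: "x \<in> carrier X"
  shows "f x = \<zero>\<^bsub>Y\<^esub>"
proof (rule ccontr)
  assume "f x \<noteq> \<zero>\<^bsub>Y\<^esub>"
  interpret X: left_module R X using X(1) by (rule subgenerated_left_module)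
  interpret Y: left_module R Y by fact
  \<comment> \<open>Distinct minimal primes are incomparable.\<close>
  have PQ: "prime_in R M P" "prime_in R M Q" "\<not> P \<subseteq> Q"
    using P Q \<open>P \<noteq> Q\<close> unfolding minimal_primes_in_def by auto
  obtain s k where s: "s \<in> carrier R" "s \<odot>\<^bsub>Y\<^esub> f x \<noteq> \<zero>\<^bsub>Y\<^esub>" and k: "k \<in> carrier M"
    and ann: "\<And>a. a \<in> carrier R \<Longrightarrow> a \<odot>\<^bsub>Y\<^esub> (s \<odot>\<^bsub>Y\<^esub> f x) = \<zero>\<^bsub>Y\<^esub> \<longleftrightarrow> a \<odot>\<^bsub>M\<^esub> k \<in> Q"
    using Y(2) \<open>f x \<noteq> \<zero>\<^bsub>Y\<^esub>\<close> lmod_homD(3)[OF f x] unfolding essentially_in_quotient_def by meson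
  let ?u = "s \<odot>\<^bsub>X\<^esub> x" and ?z = "s \<odot>\<^bsub>Y\<^esub> f x"
  have u: "?u \<in> carrier X" and z: "?z \<in> carrier Y"
    using s(1) x lmod_homD(3)[OF f x] by auto
  have fu: "f ?u = ?z"
    by (rule lmod_homD(5)[OF f s(1) x])
  have u_z: "a \<odot>\<^bsub>Y\<^esub> ?z = \<zero>\<^bsub>Y\<^esub>" if "a \<in> carrier R" "a \<odot>\<^bsub>X\<^esub> ?u = \<zero>\<^bsub>X\<^esub>" for a
    using lmod_homD(5)[OF f that(1) u] that(2) fu lmod_hom_zero[OF X.left_module_axioms Y(1) f] by simp
  have "?z = \<zero>\<^bsub>Y\<^esub>"
  proof (rule eq_zero_if_homs_kill[OF PQ(2) prime_inD(1)[OF PQ(1)] PQ(3) Y(1) z k ann])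
    fix h p assume h: "h \<in> lmod_hom R M Y" "h ` carrier M \<subseteq> cyclic_submodule R Y ?z" and p: "p \<in> P"
    have pM: "p \<in> carrier M"
      using p fully_invariantD(2)[OF prime_inD(1)[OF PQ(1)]] by blast
    obtain g where g: "g \<in> lmod_hom R M X"
      "\<And>m a. \<lbrakk>m \<in> carrier M; a \<in> carrier R; g m = a \<odot>\<^bsub>X\<^esub> ?u\<rbrakk> \<Longrightarrow> h m = a \<odot>\<^bsub>Y\<^esub> ?z"
      using lift_cyclic[OF X(1) u Y(1) z u_z h] by blast
    have "g p = \<zero>\<^bsub>X\<^esub>"
      by (rule homs_kill_minimal_prime[OF semi fin P X.left_module_axioms X(2) g(1) p])
    then show "h p = \<zero>\<^bsub>Y\<^esub>"
      using g(2)[OF pM R.zero_closed] u z by simp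
  qed auto
  then show False
    using s(2) by simp
qed

text \<open>As \<open>M\<close> is a generator, \<open>x\<close> is the image of a vector v under a
  map from a copower. A scalar a that kills the cosets of the nonzero coordinates of v puts all
  coordinates of a v into \<open>P\<close>, so the image a x is zero. These finitely many cosets
  witness subgeneration by M / P.\<close>

lemma subgenerated_quotient_if_homs_kill:
  assumes gen: "generator_in_sigma U R M" and P: "submodule P R M"
    and X: "subgenerated R M X" and kill: "\<And>f p. \<lbrakk>f \<in> lmod_hom R M X; p \<in> P\<rbrakk> \<Longrightarrow> f p = \<zero>\<^bsub>X\<^esub>"
  shows "subgenerated R (quotient_module M P) X"
  unfolding subgenerated_def
proof (intro conjI ballI)
  show LX: "left_module R X"
    using X by (rule subgenerated_left_module)
  interpret X: left_module R X by fact
  fix x assume x: "x \<in> carrier X"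
  let ?Rx = "cyclic_submodule R X x"
  let ?C = "X\<lparr>carrier := ?Rx\<rparr>"
  note Rx = X.submodule_cyclic[OF x]
  note LC = X.left_module_submodule[OF Rx]
  \<comment> \<open>Generation is available only for modules carried by \<open>'u\<close>, hence the
    copy of Rx there.\<close>
  have "carrier ?C \<lesssim> (UNIV :: 'u set)"
    using R_lepoll image_lepoll lepoll_trans by fastforce
  then obtain \<phi> :: "_ \<Rightarrow> 'u" where \<phi>: "inj_on \<phi> (carrier ?C)"
    unfolding lepoll_def by blast
  let ?C' = "push_module \<phi> ?C"
  note pC = push_module_inj[OF LC \<phi>]
  have "subgenerated R M ?C'"
    using pC by (intro subgenerated_image[OF subgenerated_submodule[OF X Rx] _ pC(4)]) auto
  then obtain I :: "('u \<times> nat) set" and h where h: "h \<in> lmod_hom R (copower_module I M) ?C'"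
    "h ` carrier (copower_module I M) = carrier ?C'"
    using gen unfolding generator_in_sigma_def in_sigma_iff_subgenerated[OF left_module_axioms] by blast
  let ?V = "copower_module I M"
  interpret V: left_module R ?V by (rule left_module_copower)
  let ?\<psi> = "restrict (inv_into (carrier ?C) (restrict \<phi> (carrier ?C))) (carrier ?C')"
  have inj: "inj_on (restrict \<phi> (carrier ?C)) (carrier ?C)"
    using \<phi> by (rule inj_on_restrict_eq[THEN iffD2])
  have \<psi>: "?\<psi> \<in> lmod_hom R ?C' ?C"
    by (rule inv_lmod_hom[OF LC pC(4) inj]) (use pC(1) in auto)
  have xC: "x \<in> carrier ?C"
    using X.mem_cyclic[OF x] by simp
  have \<psi>x: "?\<psi> (\<phi> x) = x"
    using inv_into_f_f[OF inj xC] xC pC(1) by simp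
  define g where "g = compose (carrier ?V) ?\<psi> h"
  have "g \<in> lmod_hom R ?V ?C"
    unfolding g_def by (rule compose_lmod_hom[OF V.left_module_axioms h(1) \<psi>])
  then have g: "g \<in> lmod_hom R ?V X"
    unfolding lmod_hom_carrier_update[OF X.submoduleD(1)[OF Rx]] by blast
  have "\<phi> x \<in> h ` carrier ?V"
    using xC pC(1) h(2) by blast
  then obtain v where v: "\<phi> x = h v" "v \<in> carrier ?V"
    by (rule imageE)
  have gv: "g v = x"
    using v(2) \<psi>x v(1) by (simp add: g_def compose_def del: copower_module_simps)
  note Q = quotient_module_simps[OF P]
  show "\<exists>F. finite F \<and> F \<subseteq> carrier (quotient_module M P) \<and>
    (\<forall>a\<in>carrier R. (\<forall>m\<in>F. a \<odot>\<^bsub>quotient_module M P\<^esub> m = \<zero>\<^bsub>quotient_module M P\<^esub>) \<longrightarrow>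
      a \<odot>\<^bsub>X\<^esub> x = \<zero>\<^bsub>X\<^esub>)"
  proof (intro exI conjI ballI impI)
    let ?F = "(\<lambda>i. P +>\<^bsub>M\<^esub> v i) ` {i \<in> I. v i \<noteq> \<zero>\<^bsub>M\<^esub>}"
    show "finite ?F" "?F \<subseteq> carrier (quotient_module M P)"
      using v(2) Q(1) by auto
    fix a assume a: "a \<in> carrier R" and
      ann: "\<forall>m\<in>?F. a \<odot>\<^bsub>quotient_module M P\<^esub> m = \<zero>\<^bsub>quotient_module M P\<^esub>"
    have "a \<odot>\<^bsub>M\<^esub> v i \<in> P" if i: "i \<in> I" for i
    proof (cases "v i = \<zero>\<^bsub>M\<^esub>")
      case True
      then show ?thesis
        using a submoduleD(3)[OF P] by simp
    next
      case False
      have "v i \<in> carrier M"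
        using v(2) i by auto
      moreover have "P +>\<^bsub>M\<^esub> v i \<in> ?F"
        using i False by blast
      with ann have "a \<odot>\<^bsub>quotient_module M P\<^esub> (P +>\<^bsub>M\<^esub> v i) = \<zero>\<^bsub>quotient_module M P\<^esub>"
        by (rule bspec)
      then have "P +>\<^bsub>M\<^esub> (a \<odot>\<^bsub>M\<^esub> v i) = P"
        using Q(4)[OF a \<open>v i \<in> carrier M\<close>] Q(2) by simp
      ultimately show ?thesis
        using a by (simp add: coset_eq_self_iff[OF P])
    qed
    then have "g (a \<odot>\<^bsub>?V\<^esub> v) = \<zero>\<^bsub>X\<^esub>"
      using V.smult_closed[OF a v(2)] by (intro copower_hom_eq_zero[OF LX g P]) (auto intro: kill)
    then show "a \<odot>\<^bsub>X\<^esub> x = \<zero>\<^bsub>X\<^esub>"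
      using lmod_homD(5)[OF g a v(2)] gv by simp
  qed
qed

end

section \<open>Factorisation of homomorphisms, quotients and essential images\<close>

lemma hom_factor:
  assumes A: "left_module R A" and Q: "left_module R Q" and E: "left_module R E"
    and i: "i \<in> lmod_hom R A Q" and g: "g \<in> lmod_hom R A E"
    and ker: "\<And>a. \<lbrakk>a \<in> carrier A; i a = \<zero>\<^bsub>Q\<^esub>\<rbrakk> \<Longrightarrow> g a = \<zero>\<^bsub>E\<^esub>"
  shows "\<exists>g'\<in>lmod_hom R (Q\<lparr>carrier := i ` carrier A\<rparr>) E. \<forall>a\<in>carrier A. g' (i a) = g a"
proof -
  interpret A: left_module R A by fact
  interpret Q: left_module R Q by fact
  interpret E: left_module R E by fact
  note I = lmod_homD[OF i] and G = lmod_homD[OF g]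
  have eq: "g a = g b" if "a \<in> carrier A" "b \<in> carrier A" "i a = i b" for a b
  proof -
    have "i (a \<ominus>\<^bsub>A\<^esub> b) = \<zero>\<^bsub>Q\<^esub>"
      using that I(3) by (subst lmod_hom_minus[OF A Q i]) (auto simp: Q.minus_eq_zero_iff)
    then have "g (a \<ominus>\<^bsub>A\<^esub> b) = \<zero>\<^bsub>E\<^esub>"
      using that by (intro ker) auto
    then show ?thesis
      using that G(3) by (simp add: lmod_hom_minus[OF A E g] E.minus_eq_zero_iff)
  qed
  define g' where "g' = (\<lambda>y\<in>i ` carrier A. g (inv_into (carrier A) i y))"
  have g': "g' (i a) = g a" if "a \<in> carrier A" for a
  proof -
    have "inv_into (carrier A) i (i a) \<in> carrier A" "i (inv_into (carrier A) i (i a)) = i a"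
      using that by (auto intro: inv_into_into f_inv_into_f)
    then show ?thesis
      using that eq[of "inv_into (carrier A) i (i a)" a] by (simp add: g'_def)
  qed
  have "g' \<in> lmod_hom R (Q\<lparr>carrier := i ` carrier A\<rparr>) E"
  proof (rule lmod_homI)
    have "g' y \<in> carrier E" if "y \<in> i ` carrier A" for y
      using that g' G(3) by auto
    then show "g' \<in> carrier (Q\<lparr>carrier := i ` carrier A\<rparr>) \<rightarrow>\<^sub>E carrier E"
      by (auto simp: g'_def)
  next
    fix x y assume "x \<in> carrier (Q\<lparr>carrier := i ` carrier A\<rparr>)" "y \<in> carrier (Q\<lparr>carrier := i ` carrier A\<rparr>)"
    then obtain a b where "a \<in> carrier A" "b \<in> carrier A" "x = i a" "y = i b"
      by auto
    then show "g' (x \<oplus>\<^bsub>Q\<lparr>carrier := i ` carrier A\<rparr>\<^esub> y) = g' x \<oplus>\<^bsub>E\<^esub> g' y"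
      using g' by (simp add: G(4) flip: I(4))
  next
    fix r x assume "r \<in> carrier R" "x \<in> carrier (Q\<lparr>carrier := i ` carrier A\<rparr>)"
    then obtain a where "a \<in> carrier A" "x = i a" "r \<in> carrier R"
      by auto
    then show "g' (r \<odot>\<^bsub>Q\<lparr>carrier := i ` carrier A\<rparr>\<^esub> x) = r \<odot>\<^bsub>E\<^esub> g' x"
      using g' by (simp add: G(5) flip: I(5))
  qed
  with g' show ?thesis
    by blast
qed

text \<open>Unlike \<^const>\<open>quotient_module\<close>, this realises the quotient in the type of the module itself.\<close>

lemma exists_quotient:
  fixes B :: "('r, 'b) module"
  assumes B: "left_module R B" and C: "submodule C R B"
  obtains Q :: "('r, 'b) module" and \<pi> where "left_module R Q" "\<pi> \<in> lmod_hom R B Q"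
    "\<pi> ` carrier B = carrier Q" "\<And>x. x \<in> carrier B \<Longrightarrow> \<pi> x = \<zero>\<^bsub>Q\<^esub> \<longleftrightarrow> x \<in> C"
proof -
  interpret left_module R B by fact
  note CD = submoduleD[OF C]
  \<comment> \<open>The representative is chosen from the coset as a set, so elements of one coset
    share it.\<close>
  define \<phi> where "\<phi> x = (SOME y. y \<in> C +>\<^bsub>B\<^esub> x)" for x
  have \<phi>_iff: "\<phi> x = \<phi> y \<longleftrightarrow> C +>\<^bsub>B\<^esub> x = C +>\<^bsub>B\<^esub> y" if "x \<in> carrier B" "y \<in> carrier B" for x y
  proof
    interpret C: abelian_subgroup C B by (rule abelian_subgroup_submodule) fact
    have "\<phi> z \<in> C +>\<^bsub>B\<^esub> z" if "z \<in> carrier B" for z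
      unfolding \<phi>_def using C.a_rcos_self[OF that] by (rule someI)
    then have "C +>\<^bsub>B\<^esub> \<phi> z = C +>\<^bsub>B\<^esub> z" if "z \<in> carrier B" for z
      using that C.a_repr_independence' by metis
    then show "\<phi> x = \<phi> y \<Longrightarrow> C +>\<^bsub>B\<^esub> x = C +>\<^bsub>B\<^esub> y"
      using that by metis
  qed (simp add: \<phi>_def)
  note Q = quotient_module_simps[OF C]
  have add: "\<phi> (x \<oplus>\<^bsub>B\<^esub> y) = \<phi> (x' \<oplus>\<^bsub>B\<^esub> y')"
    if "x \<in> carrier B" "x' \<in> carrier B" "y \<in> carrier B" "y' \<in> carrier B" "\<phi> x = \<phi> x'" "\<phi> y = \<phi> y'"
    for x x' y y'
    using that Q(3)[of x y] Q(3)[of x' y'] by (simp add: \<phi>_iff)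
  have smult: "\<phi> (a \<odot>\<^bsub>B\<^esub> x) = \<phi> (a \<odot>\<^bsub>B\<^esub> x')"
    if "a \<in> carrier R" "x \<in> carrier B" "x' \<in> carrier B" "\<phi> x = \<phi> x'" for a x x'
    using that Q(4)[of a x] Q(4)[of a x'] by (simp add: \<phi>_iff)
  note p = push_module[where \<phi> = \<phi>, OF B add smult]
  have "\<phi> x = \<phi> \<zero>\<^bsub>B\<^esub> \<longleftrightarrow> x \<in> C" if "x \<in> carrier B" for x
  proof -
    have "C +>\<^bsub>B\<^esub> \<zero>\<^bsub>B\<^esub> = C"
      using CD(1) by simp
    then show ?thesis
      using coset_eq_self_iff[OF C that] \<phi>_iff[OF that M.zero_closed] by simp
  qed
  then have "restrict \<phi> (carrier B) x = \<zero>\<^bsub>push_module \<phi> B\<^esub> \<longleftrightarrow> x \<in> C"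
    if "x \<in> carrier B" for x
    using that by (simp add: p(2))
  moreover have "restrict \<phi> (carrier B) ` carrier B = carrier (push_module \<phi> B)"
    by (simp add: p(1))
  ultimately show thesis
    using p(3,4) by (intro that)
qed

text \<open>As \<open>i\<close> and \<open>g\<close> have the same kernel, the image of
  \<open>A\<close> in \<open>Q\<close> is a copy of a submodule of \<open>E\<close>, and by
  \<open>meets\<close> it is essential in \<open>Q\<close>. From y one passes to r y =
  \<open>i a\<close>, then to a multiple s of \<open>g a\<close> in \<open>E\<close>; s r is the
  scalar sought.\<close>

lemma essentially_in_quotient_extension:
  assumes A: "left_module R A" and E: "left_module R E" and Q: "left_module R Q"
    and i: "i \<in> lmod_hom R A Q" and g: "g \<in> lmod_hom R A E"
    and ker: "\<And>a. a \<in> carrier A \<Longrightarrow> i a = \<zero>\<^bsub>Q\<^esub> \<longleftrightarrow> g a = \<zero>\<^bsub>E\<^esub>"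
    and meets: "\<And>y. \<lbrakk>y \<in> carrier Q; y \<noteq> \<zero>\<^bsub>Q\<^esub>\<rbrakk> \<Longrightarrow>
      \<exists>a\<in>carrier A. i a \<in> cyclic_submodule R Q y \<and> i a \<noteq> \<zero>\<^bsub>Q\<^esub>"
    and ess: "essentially_in_quotient R M P E"
  shows "essentially_in_quotient R M P Q"
  unfolding essentially_in_quotient_def
proof (intro ballI impI)
  interpret A: left_module R A by fact
  interpret Q: left_module R Q by fact
  fix y assume y: "y \<in> carrier Q" "y \<noteq> \<zero>\<^bsub>Q\<^esub>"
  then obtain a r where a: "a \<in> carrier A" "i a \<noteq> \<zero>\<^bsub>Q\<^esub>" and r: "r \<in> carrier R" "i a = r \<odot>\<^bsub>Q\<^esub> y"
    using meets by blast
  have ga: "g a \<in> carrier E" "g a \<noteq> \<zero>\<^bsub>E\<^esub>"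
    using a ker lmod_homD(3)[OF g] by auto
  obtain s k where s: "s \<in> carrier R" "s \<odot>\<^bsub>E\<^esub> g a \<noteq> \<zero>\<^bsub>E\<^esub>" and k: "k \<in> carrier M"
    and ann: "\<And>c. c \<in> carrier R \<Longrightarrow> c \<odot>\<^bsub>E\<^esub> (s \<odot>\<^bsub>E\<^esub> g a) = \<zero>\<^bsub>E\<^esub> \<longleftrightarrow> c \<odot>\<^bsub>M\<^esub> k \<in> P"
    using ess ga unfolding essentially_in_quotient_def by meson
  have sa: "s \<odot>\<^bsub>A\<^esub> a \<in> carrier A"
    using s a by simp
  have i_sa: "i (s \<odot>\<^bsub>A\<^esub> a) = (s \<otimes>\<^bsub>R\<^esub> r) \<odot>\<^bsub>Q\<^esub> y"
    using lmod_homD(5)[OF i s(1) a(1)] r s(1) y(1) by (simp add: Q.smult_assoc1)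
  have g_sa: "g (s \<odot>\<^bsub>A\<^esub> a) = s \<odot>\<^bsub>E\<^esub> g a"
    by (rule lmod_homD(5)[OF g s(1) a(1)])
  have "c \<odot>\<^bsub>Q\<^esub> ((s \<otimes>\<^bsub>R\<^esub> r) \<odot>\<^bsub>Q\<^esub> y) = \<zero>\<^bsub>Q\<^esub> \<longleftrightarrow> c \<odot>\<^bsub>M\<^esub> k \<in> P" if c: "c \<in> carrier R" for c
  proof -
    have "c \<odot>\<^bsub>Q\<^esub> ((s \<otimes>\<^bsub>R\<^esub> r) \<odot>\<^bsub>Q\<^esub> y) = i (c \<odot>\<^bsub>A\<^esub> (s \<odot>\<^bsub>A\<^esub> a))"
      using lmod_homD(5)[OF i c sa] i_sa by simp
    also have "\<dots> = \<zero>\<^bsub>Q\<^esub> \<longleftrightarrow> g (c \<odot>\<^bsub>A\<^esub> (s \<odot>\<^bsub>A\<^esub> a)) = \<zero>\<^bsub>E\<^esub>"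
      using c sa by (intro ker) simp
    finally show ?thesis
      using lmod_homD(5)[OF g c sa] g_sa ann[OF c] by simp
  qed
  moreover have "(s \<otimes>\<^bsub>R\<^esub> r) \<odot>\<^bsub>Q\<^esub> y \<noteq> \<zero>\<^bsub>Q\<^esub>"
    using ker[OF sa] i_sa g_sa s(2) by simp
  ultimately show "\<exists>s\<in>carrier R. s \<odot>\<^bsub>Q\<^esub> y \<noteq> \<zero>\<^bsub>Q\<^esub> \<and>
      (\<exists>k\<in>carrier M. \<forall>a\<in>carrier R. a \<odot>\<^bsub>Q\<^esub> (s \<odot>\<^bsub>Q\<^esub> y) = \<zero>\<^bsub>Q\<^esub> \<longleftrightarrow> a \<odot>\<^bsub>M\<^esub> k \<in> P)"
    using s(1) r(1) k by blast
qed

section \<open>Comparing injectivity in \<sigma>[M] and in \<sigma>[M / P]\<close>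

context projective_module
begin

text \<open>An extension problem in \<sigma>[M] is reduced to one in \<sigma>[M / P]: a quotient
  \<open>Q\<close> of \<open>B\<close> is formed that is an essential extension of the image of
  \<open>A\<close> under \<open>g\<close>. Such a \<open>Q\<close> lies in \<sigma>[M / P], so
  \<open>E\<close> solves the problem there, and the solution is composed with the projection of
  \<open>B\<close> onto \<open>Q\<close>.\<close>

lemma injective_in_sigma_if_quotient:
  assumes gen: "generator_in_sigma U R M"
    and semi: "semiprime_module R M" and fin: "finite (minimal_primes_in R M)"
    and P: "P \<in> minimal_primes_in R M"
    and inj: "injective_in_sigma U R (quotient_module M P) E"
    and ess: "essentially_in_quotient R M P E"
  shows "injective_in_sigma U R M E"
proof -
  let ?K = "quotient_module M P"
  have PS: "submodule P R M"
    using P prime_inD(3) unfolding minimal_primes_in_def by blast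
  note LK = left_module_quotient[OF PS] and KM = subgenerated_quotient[OF PS]
  have KE: "subgenerated R ?K E"
    using inj unfolding injective_in_sigma_def in_sigma_iff_subgenerated[OF LK] by blast
  have LE: "left_module R E"
    using KE by (rule subgenerated_left_module)
  have extend: "\<exists>h\<in>lmod_hom R B E. compose (carrier A) h f = g"
    if A: "subgenerated R M A" and B: "subgenerated R M B" and f: "f \<in> lmod_hom R A B" "inj_on f (carrier A)"
      and g: "g \<in> lmod_hom R A E"
    for A :: "('r, 'u) module" and B :: "('r, 'u) module" and f g
  proof -
    have LA: "left_module R A" and LB: "left_module R B"
      using A B by (auto intro: subgenerated_left_module)
    interpret A: left_module R A by fact
    interpret B: left_module R B by fact
    interpret E: left_module R E by fact
    let ?ker = "{a \<in> carrier A. g a \<in> {\<zero>\<^bsub>E\<^esub>}}"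
    have ker_B: "submodule (f ` ?ker) R B"
      using submodule_vimage[OF LA LE E.submodule_zero g] by (rule submodule_image[OF LA LB _ f(1)])
    \<comment> \<open>\<open>C\<close> meets the image of \<open>f\<close> exactly in the image of
      the kernel of \<open>g\<close>, so the map from \<open>A\<close> to the quotient by
      \<open>C\<close> has the same kernel as \<open>g\<close>.\<close>
    obtain C where C: "submodule C R B" "f ` ?ker \<subseteq> C" "C \<inter> f ` carrier A \<subseteq> f ` ?ker"
      and max: "\<And>D. \<lbrakk>submodule D R B; C \<subseteq> D; D \<inter> f ` carrier A \<subseteq> f ` ?ker\<rbrakk> \<Longrightarrow> D = C"
      by (rule B.exists_complement[OF ker_B, of "f ` carrier A"]) (rule that)
    obtain Q :: "('r, 'u) module" and \<pi> where LQ: "left_module R Q" and \<pi>: "\<pi> \<in> lmod_hom R B Q"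
      "\<pi> ` carrier B = carrier Q" "\<And>x. x \<in> carrier B \<Longrightarrow> \<pi> x = \<zero>\<^bsub>Q\<^esub> \<longleftrightarrow> x \<in> C"
      by (rule exists_quotient[OF LB C(1)]) (rule that)
    interpret Q: left_module R Q by fact
    have MQ: "subgenerated R M Q"
      by (rule subgenerated_image[OF B LQ \<pi>(1,2)])
    define i where "i = compose (carrier A) \<pi> f"
    have i: "i \<in> lmod_hom R A Q"
      unfolding i_def by (rule compose_lmod_hom[OF LA f(1) \<pi>(1)])
    have ker: "i a = \<zero>\<^bsub>Q\<^esub> \<longleftrightarrow> g a = \<zero>\<^bsub>E\<^esub>" if a: "a \<in> carrier A" for a
    proof -
      have "f a \<in> C \<longleftrightarrow> f a \<in> f ` ?ker"
        using C(2,3) a by blast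
      also have "\<dots> \<longleftrightarrow> g a = \<zero>\<^bsub>E\<^esub>"
        using inj_onD[OF f(2)] a by blast
      finally show ?thesis
        using a \<pi>(3)[OF lmod_homD(3)[OF f(1) a]] by (simp add: i_def compose_def)
    qed
    have meets: "\<exists>a\<in>carrier A. i a \<in> cyclic_submodule R Q y \<and> i a \<noteq> \<zero>\<^bsub>Q\<^esub>"
      if y: "y \<in> carrier Q" "y \<noteq> \<zero>\<^bsub>Q\<^esub>" for y
    proof -
      \<comment> \<open>The preimage of Ry properly contains \<open>C\<close>, so by maximality it
        meets the image of \<open>f\<close> outside the image of the kernel of
        \<open>g\<close>.\<close>
      define D where "D = {x \<in> carrier B. \<pi> x \<in> cyclic_submodule R Q y}"
      have D: "submodule D R B"
        unfolding D_def by (rule submodule_vimage[OF LB LQ Q.submodule_cyclic[OF y(1)] \<pi>(1)])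
      have "\<pi> x \<in> cyclic_submodule R Q y" if "x \<in> C" for x
        using \<pi>(3)[OF B.submoduleD(2)[OF C(1) that]] that
          Q.submoduleD(3)[OF Q.submodule_cyclic[OF y(1)]] by metis
      then have "C \<subseteq> D"
        using B.submoduleD(2)[OF C(1)] unfolding D_def by blast
      moreover obtain b where "b \<in> carrier B" "y = \<pi> b"
        using y(1) \<pi>(2) by blast
      then have "b \<in> D" "b \<notin> C"
        using y Q.mem_cyclic[OF y(1)] \<pi>(3) unfolding D_def by auto
      ultimately obtain x where "x \<in> D" "x \<in> f ` carrier A" "x \<notin> f ` ?ker"
        using max[OF D] by blast
      then obtain a where a: "a \<in> carrier A" "f a \<in> D" "g a \<noteq> \<zero>\<^bsub>E\<^esub>"
        by blast
      then show ?thesis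
        using ker[OF a(1)] unfolding D_def i_def by (intro bexI[of _ a]) (auto simp: compose_def)
    qed
    have essQ: "essentially_in_quotient R M P Q"
      by (rule essentially_in_quotient_extension[OF LA LE LQ i g ker meets ess])
    have KQ: "subgenerated R ?K Q"
      using homs_kill_minimal_prime[OF semi fin P LQ essQ]
      by (rule subgenerated_quotient_if_homs_kill[OF gen PS MQ])
    let ?A' = "Q\<lparr>carrier := i ` carrier A\<rparr>"
    have A': "submodule (i ` carrier A) R Q"
      by (rule submodule_image[OF LA LQ A.submodule_carrier i])
    have KA': "subgenerated R ?K ?A'"
      by (rule subgenerated_submodule[OF KQ A'])
    obtain g' where g': "g' \<in> lmod_hom R ?A' E" "\<And>a. a \<in> carrier A \<Longrightarrow> g' (i a) = g a"
      using hom_factor[OF LA LQ LE i g] ker by blast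
    let ?j = "restrict (\<lambda>x. x) (i ` carrier A)"
    have j: "?j \<in> lmod_hom R ?A' Q" "inj_on ?j (carrier ?A')"
      using Q.submoduleD[OF A'] by (auto intro!: lmod_homI simp: inj_on_def)
    have "\<exists>h\<in>lmod_hom R Q E. compose (carrier ?A') h ?j = g'"
      using inj KA' KQ j g'(1) unfolding injective_in_sigma_def in_sigma_iff_subgenerated[OF LK] by blast
    then obtain h where h: "h \<in> lmod_hom R Q E" "compose (carrier ?A') h ?j = g'"
      by blast
    have hi: "h (i a) = g a" if "a \<in> carrier A" for a
      using fun_cong[OF h(2), of "i a"] g'(2)[OF that] that by (simp add: compose_def)
    have "compose (carrier A) (compose (carrier B) h \<pi>) f = g"
    proof (rule extensionalityI[of _ "carrier A"])
      show "compose (carrier A) (compose (carrier B) h \<pi>) f a = g a" if "a \<in> carrier A" for a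
        using that hi[OF that] lmod_homD(3)[OF f(1) that] by (simp add: i_def compose_def)
    qed (use lmod_homD(1)[OF g] in auto)
    then show ?thesis
      using compose_lmod_hom[OF LB \<pi>(1) h(1)] by blast
  qed
  show ?thesis
    unfolding injective_in_sigma_def in_sigma_iff_subgenerated[OF left_module_axioms]
    using subgenerated_trans[OF KM KE] extend by blast
qed

text \<open>\<sigma>[M / P] lies in \<sigma>[M], so fewer extension problems remain; membership of
  \<open>E\<close> in the smaller category is assumed.\<close>

lemma injective_in_sigma_quotient:
  assumes P: "submodule P R M" and "injective_in_sigma U R M E" and "subgenerated R (quotient_module M P) E"
  shows "injective_in_sigma U R (quotient_module M P) E"
  using assms subgenerated_trans[OF subgenerated_quotient[OF P]]
  unfolding injective_in_sigma_def in_sigma_iff_subgenerated[OF left_module_axioms]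
    in_sigma_iff_subgenerated[OF left_module_quotient[OF P]]
  by blast

text \<open>The two notions share the embedding and its essentiality, which place \<open>E\<close>
  among the essential extensions treated above, so only injectivity has to be transferred.\<close>

lemma is_injective_hull_quotient_iff:
  assumes gen: "generator_in_sigma U R M"
    and semi: "semiprime_module R M" and fin: "finite (minimal_primes_in R M)"
    and P: "P \<in> minimal_primes_in R M"
  shows "is_injective_hull U R M (quotient_module M P) E \<iota> \<longleftrightarrow>
    is_injective_hull U R (quotient_module M P) (quotient_module M P) E \<iota>" (is "?L \<longleftrightarrow> ?R")
proof
  let ?K = "quotient_module M P"
  have PS: "submodule P R M"
    using P prime_inD(3) unfolding minimal_primes_in_def by blast
  note LK = left_module_quotient[OF PS]
  {
    assume L: ?L
    then have ME: "subgenerated R M E"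
      unfolding is_injective_hull_def injective_in_sigma_def in_sigma_iff_subgenerated[OF left_module_axioms]
      by blast
    then have LE: "left_module R E"
      by (rule subgenerated_left_module)
    have "essentially_in_quotient R M P E"
      using L unfolding is_injective_hull_def by (intro essentially_in_quotient_hull[OF PS LE]) auto
    then have "subgenerated R ?K E"
      by (intro subgenerated_quotient_if_homs_kill[OF gen PS ME]
          homs_kill_minimal_prime[OF semi fin P LE])
    then show ?R
      using L injective_in_sigma_quotient[OF PS] unfolding is_injective_hull_def by blast
  next
    assume R: ?R
    then have LE: "left_module R E"
      unfolding is_injective_hull_def injective_in_sigma_def in_sigma_def by blast
    have "essentially_in_quotient R M P E"
      using R unfolding is_injective_hull_def by (intro essentially_in_quotient_hull[OF PS LE]) auto
    then show ?L
      using R injective_in_sigma_if_quotient[OF gen semi fin P] unfolding is_injective_hull_def by blast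
  }
qed

lemma homs_between_hulls:
  assumes semi: "semiprime_module R M" and fin: "finite (minimal_primes_in R M)"
    and P: "P \<in> minimal_primes_in R M" and Q: "Q \<in> minimal_primes_in R M" and "P \<noteq> Q"
    and E: "is_injective_hull U R M (quotient_module M P) E \<iota>"
    and E': "is_injective_hull U R M (quotient_module M Q) E' \<iota>'"
  shows "lmod_hom R E E' = {zero_hom E E'}"
proof -
  have PS: "submodule P R M" and QS: "submodule Q R M"
    using P Q prime_inD(3) unfolding minimal_primes_in_def by auto
  have ME: "subgenerated R M E"
    using E unfolding is_injective_hull_def injective_in_sigma_def
      in_sigma_iff_subgenerated[OF left_module_axioms] by blast
  have LE': "left_module R E'"
    using E' unfolding is_injective_hull_def injective_in_sigma_def in_sigma_def by blast
  interpret E: left_module R E using ME by (rule subgenerated_left_module)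
  interpret E': left_module R E' by fact
  have ess: "essentially_in_quotient R M P E"
    using E unfolding is_injective_hull_def
    by (intro essentially_in_quotient_hull[OF PS E.left_module_axioms]) auto
  have ess': "essentially_in_quotient R M Q E'"
    using E' unfolding is_injective_hull_def
    by (intro essentially_in_quotient_hull[OF QS LE']) auto
  show ?thesis
  proof (intro equalityI subsetI)
    fix f assume f: "f \<in> lmod_hom R E E'"
    have "f = zero_hom E E'"
      unfolding zero_hom_def
      by (rule extensionalityI[OF lmod_homD(1)[OF f]])
        (use hom_eq_zero_between_primes[OF semi fin P Q \<open>P \<noteq> Q\<close> ME ess LE' ess' f] in auto)
    then show "f \<in> {zero_hom E E'}"
      by simp
  next
    have "zero_hom E E' \<in> lmod_hom R E E'"
      unfolding zero_hom_def by (rule lmod_homI) auto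
    then show "\<And>f. f \<in> {zero_hom E E'} \<Longrightarrow> f \<in> lmod_hom R E E'"
      by simp
  qed
qed

end

theorem proposition2p16:
  fixes R :: "('r, 'x) ring_scheme" and M :: "('r, 'm) module"
    and P :: "nat \<Rightarrow> 'm set" and n :: nat
  assumes "ring R" and "left_module R M"
    and "infinite (UNIV :: 'u set)"
    and "carrier R \<lesssim> (UNIV :: 'u set)" and "carrier M \<lesssim> (UNIV :: 'u set)"
    and "projective_in_sigma TYPE('u) R M"
    and "semiprime_module R M"
    and "goldie_module R M"
    and "bij_betw P {1..n} (minimal_primes_in R M)"
  shows
    "(\<forall>i\<in>{1..n}. \<forall>j\<in>{1..n}. i \<noteq> j \<longrightarrow>
       (\<forall>(E :: ('r, 'e) module) \<iota> (E' :: ('r, 'f) module) \<iota>'.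
          is_injective_hull TYPE('u) R M (quotient_module M (P i)) E \<iota> \<and>
          is_injective_hull TYPE('u) R M (quotient_module M (P j)) E' \<iota>' \<longrightarrow>
          lmod_hom R E E' = {zero_hom E E'})) \<and>
     (generator_in_sigma TYPE('u) R M \<longrightarrow>
       (\<forall>i\<in>{1..n}. \<forall>(E :: ('r, 'e) module) \<iota>.
          is_injective_hull TYPE('u) R M (quotient_module M (P i)) E \<iota> \<longleftrightarrow>
          is_injective_hull TYPE('u) R (quotient_module M (P i)) (quotient_module M (P i)) E \<iota>))"
proof -
  interpret projective_module R M "TYPE('u)"
    using assms by (intro projective_module.intro projective_module_axioms.intro)
  \<comment> \<open>The enumeration gives finiteness, and its injectivity makes the primes at
    different indices distinct.\<close>
  have fin: "finite (minimal_primes_in R M)"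
    using bij_betw_finite[OF assms(9)] by simp
  have P: "P i \<in> minimal_primes_in R M" if "i \<in> {1..n}" for i
    using bij_betwE[OF assms(9)] that by blast
  have ne: "P i \<noteq> P j" if "i \<in> {1..n}" "j \<in> {1..n}" "i \<noteq> j" for i j
    using inj_onD[OF bij_betw_imp_inj_on[OF assms(9)]] that by blast
  show ?thesis
    using homs_between_hulls[OF assms(7) fin P P ne]
      is_injective_hull_quotient_iff[OF _ assms(7) fin P] by blast
qed

end
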